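(* Let $f$, $M$, $B$, $S$, $N$ and the measure $\sigma_M$ on $\partial M$ be as in the context. Suppose $\varphi>0$ on $S$, that $\varphi\circ f:\partial M\to(0,\infty)$ is lower semicontinuous and belongs to $L^2(\sigma_M)$, and that $E$ is an LI-set of nonnegative integers. Then there is a nonconstant $(E,f)$-function $F\in H^2(M)$ whose boundary values $F^*$ satisfy $$|F^*(\zeta)|=\varphi(f(\zeta))\quad\text{for } \sigma_M\text{-almost every }\zeta\in\partial M.$$
   Context: Setting. $B$ is the open unit ball of $\mathbb{C}^2$, $S=\partial B$, and $\sigma$ is the rotation-invariant Borel probability measure on $S$. $f=(f_1,f_2):\mathbb{C}^2\to\mathbb{C}^2$ is holomorphic and $M\subset\mathbb{C}^2$ is a bounded domain with smooth boundary such that $f(M)=B$, $f(\partial M)=S$, and $f:\overline{M}\to\overline{B}$ is a finite ramified covering with $N$ sheets. Let $Z$ be the set of points of $\overline{M}$ at which $f_1$ or $f_2$ vanishes, $Z_1=Z\cap\partial M$, $Z_2=f(Z)\cap S$. It is assumed that $S\setminus Z_2$ has a finite open cover $\{U_i\}$ such that each $f^{-1}(U_i)$ is a union of $N$ disjoint components, each mapped biholomorphically onto $U_i$ by $f$, these components covering $\partial M\setminus Z_1$. Measure. $\sigma_M$ is the Borel measure on $\partial M$ induced by $\sigma$ through $f$: $\sigma_M(Z_1)=0$ and $\sigma_M(A)=\sigma(f(A))$ for every Borel set $A\subset\partial M$ contained in one of the components above. Consequently $\int_{\partial M}G(f(w))\,d\sigma_M(w)=N\int_S G\,d\sigma$ for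 integrable $G$ on $S$. Definitions. An $f$-homogeneous polynomial of degree $k$ is a function $p\circ f$ with $p$ a homogeneous polynomial of degree $k$ in two complex variables. For a set $E$ of nonnegative integers, an $(E,f)$-function is a (possibly infinite) sum $\sum_{k\in E}F_k$ with each $F_k$ an $f$-homogeneous polynomial of degree $k$. $E$ is an LI-set if there are integers $a_m$ ($m=1,2,3,\dots$) such that $E$ contains $a_m+j$ for all $j=1,\dots,m$, i.e. $E$ contains arbitrarily long intervals of consecutive integers. $H^2(M)$ is the Hardy space of holomorphic functions on $M$ (with respect to $\sigma_M$ on the boundary), and $F^*$ denotes the boundary value function (radial boundary limit) of $F$ on $\partial M$. *)

theory Defs
  imports "HOL-Probability.Probability"
begin

type_synonym C2 = "complex^2"

abbreviation B2 :: "C2 set" where "B2 \<equiv> ball 0 1"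
abbreviation S2 :: "C2 set" where "S2 \<equiv> sphere 0 1"

section \<open>Holomorphy and smooth domains\<close>

text \<open>The derivative of the library is real-linear; holomorphy asks in addition for
  complex linearity. (The operation \<open>*s\<close> is componentwise scalar multiplication.)\<close>

definition holo_on :: "(C2 \<Rightarrow> complex) \<Rightarrow> C2 set \<Rightarrow> bool" where
  "holo_on F U \<longleftrightarrow>
     (\<forall>z\<in>U. \<exists>D. (F has_derivative D) (at z) \<and> (\<forall>c v. D (c *s v) = c * D v))"

definition holo_map_on :: "(C2 \<Rightarrow> C2) \<Rightarrow> C2 set \<Rightarrow> bool" where
  "holo_map_on f U \<longleftrightarrow> (\<forall>i. holo_on (\<lambda>z. f z $ i) U)"

definition biholomorphism :: "C2 set \<Rightarrow> C2 set \<Rightarrow> (C2 \<Rightarrow> C2) \<Rightarrow> bool" where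
  "biholomorphism V U f \<longleftrightarrow> open V \<and> open U \<and> bij_betw f V U \<and>
     holo_map_on f V \<and> holo_map_on (inv_into V f) U"

text \<open>For sets \<open>V\<close>, \<open>U\<close> that are not open in \<open>\<complex>\<^sup>2\<close> (here: relatively open pieces of real
  hypersurfaces), \<open>f\<close> maps \<open>V\<close> biholomorphically onto \<open>U\<close> if it does so for suitable
  open neighbourhoods.\<close>

definition maps_biholomorphically :: "(C2 \<Rightarrow> C2) \<Rightarrow> C2 set \<Rightarrow> C2 set \<Rightarrow> bool" where
  "maps_biholomorphically f V U \<longleftrightarrow> f ` V = U \<and>
     (\<exists>V' U'. V \<subseteq> V' \<and> U \<subseteq> U' \<and> biholomorphism V' U' f)"

primrec Ck_on :: "nat \<Rightarrow> ('a::real_normed_vector \<Rightarrow> real) \<Rightarrow> 'a set \<Rightarrow> bool" where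
  "Ck_on 0 g U \<longleftrightarrow> continuous_on U g"
| "Ck_on (Suc k) g U \<longleftrightarrow> (\<forall>x\<in>U. g differentiable (at x)) \<and>
     (\<forall>v. Ck_on k (\<lambda>x. frechet_derivative g (at x) v) U)"

definition has_smooth_boundary :: "'a::real_normed_vector set \<Rightarrow> bool" where
  "has_smooth_boundary M \<longleftrightarrow>
     (\<forall>p\<in>frontier M. \<exists>U \<rho>. open U \<and> p \<in> U \<and> (\<forall>k. Ck_on k \<rho> U) \<and>
        (\<forall>x\<in>U. frechet_derivative \<rho> (at x) \<noteq> (\<lambda>v. 0)) \<and> M \<inter> U = {x\<in>U. \<rho> x < 0})"

section \<open>Ramified coverings and the decomposition into sheets\<close>

text \<open>A continuous surjection with finite fibres that is an \<open>N\<close>-sheeted covering off a closed,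
  nowhere dense ramification set \<open>T\<close> whose preimage is nowhere dense too.\<close>

definition finite_ramified_covering ::
    "'a::topological_space set \<Rightarrow> ('a \<Rightarrow> 'b) \<Rightarrow> 'b::topological_space set \<Rightarrow> nat \<Rightarrow> bool" where
  "finite_ramified_covering X f Y N \<longleftrightarrow>
     continuous_on X f \<and> f ` X = Y \<and> (\<forall>y\<in>Y. finite {x\<in>X. f x = y}) \<and>
     (\<exists>T. closedin (top_of_set Y) T \<and> Y \<subseteq> closure (Y - T) \<and> X \<subseteq> closure (X - f -` T) \<and>
        covering_space (X - f -` T) f (Y - T) \<and> (\<forall>y\<in>Y - T. card {x\<in>X. f x = y} = N))"

definition Z_set :: "(C2 \<Rightarrow> C2) \<Rightarrow> C2 set \<Rightarrow> C2 set" where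
  "Z_set f M = {w \<in> closure M. f w $ 1 = 0 \<or> f w $ 2 = 0}"

definition Z1 :: "(C2 \<Rightarrow> C2) \<Rightarrow> C2 set \<Rightarrow> C2 set" where
  "Z1 f M = Z_set f M \<inter> frontier M"

definition Z2 :: "(C2 \<Rightarrow> C2) \<Rightarrow> C2 set \<Rightarrow> C2 set" where
  "Z2 f M = f ` Z_set f M \<inter> S2"

text \<open>Here \<open>f\<close> is regarded as a map on the closure of \<open>M\<close>, so that the preimage of a subset
  of the sphere lies in the boundary of \<open>M\<close>.\<close>

definition sheets :: "(C2 \<Rightarrow> C2) \<Rightarrow> C2 set \<Rightarrow> C2 set \<Rightarrow> C2 set set" where
  "sheets f M U = components (closure M \<inter> f -` U)"

definition sheet_cover :: "(C2 \<Rightarrow> C2) \<Rightarrow> C2 set \<Rightarrow> nat \<Rightarrow> C2 set set \<Rightarrow> bool" where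
  "sheet_cover f M N \<U> \<longleftrightarrow>
     finite \<U> \<and> (\<forall>U\<in>\<U>. openin (top_of_set S2) U) \<and> \<Union>\<U> = S2 - Z2 f M \<and>
     (\<forall>U\<in>\<U>. card (sheets f M U) = N \<and> (\<forall>V\<in>sheets f M U. maps_biholomorphically f V U)) \<and>
     frontier M - Z1 f M \<subseteq> (\<Union>U\<in>\<U>. \<Union>(sheets f M U))"

definition ramified_setting :: "(C2 \<Rightarrow> C2) \<Rightarrow> C2 set \<Rightarrow> nat \<Rightarrow> C2 set set \<Rightarrow> bool" where
  "ramified_setting f M N \<U> \<longleftrightarrow>
     holo_map_on f UNIV \<and>
     open M \<and> connected M \<and> bounded M \<and> has_smooth_boundary M \<and>
     f ` M = B2 \<and> f ` frontier M = S2 \<and>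
     finite_ramified_covering (closure M) f (closure B2) N \<and>
     sheet_cover f M N \<U>"

section \<open>The measures\<close>

definition rotation_invariant_probability :: "C2 measure \<Rightarrow> bool" where
  "rotation_invariant_probability \<sigma> \<longleftrightarrow>
     sets \<sigma> = sets (restrict_space borel S2) \<and> prob_space \<sigma> \<and>
     (\<forall>T. orthogonal_transformation T \<longrightarrow> (\<forall>A\<in>sets \<sigma>. emeasure \<sigma> (T ` A) = emeasure \<sigma> A))"

definition induced_boundary_measure ::
    "(C2 \<Rightarrow> C2) \<Rightarrow> C2 set \<Rightarrow> C2 set set \<Rightarrow> C2 measure \<Rightarrow> C2 measure \<Rightarrow> bool" where
  "induced_boundary_measure f M \<U> \<sigma> \<sigma>M \<longleftrightarrow>
     sets \<sigma>M = sets (restrict_space borel (frontier M)) \<and>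
     emeasure \<sigma>M (Z1 f M) = 0 \<and>
     (\<forall>U\<in>\<U>. \<forall>V\<in>sheets f M U. \<forall>A\<in>sets \<sigma>M. A \<subseteq> V \<longrightarrow> emeasure \<sigma>M A = emeasure \<sigma> (f ` A))"

section \<open>Function classes\<close>

definition homogeneous_poly :: "nat \<Rightarrow> (C2 \<Rightarrow> complex) \<Rightarrow> bool" where
  "homogeneous_poly k p \<longleftrightarrow> (\<exists>c. p = (\<lambda>z. \<Sum>j\<le>k. c j * (z $ 1) ^ j * (z $ 2) ^ (k - j)))"

definition f_homogeneous_poly :: "(C2 \<Rightarrow> C2) \<Rightarrow> nat \<Rightarrow> (C2 \<Rightarrow> complex) \<Rightarrow> bool" where
  "f_homogeneous_poly f k G \<longleftrightarrow> (\<exists>p. homogeneous_poly k p \<and> G = p \<circ> f)"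

text \<open>Infinite sums are understood in the sense of locally uniform convergence on \<open>M\<close>.\<close>

definition Ef_function :: "nat set \<Rightarrow> (C2 \<Rightarrow> C2) \<Rightarrow> C2 set \<Rightarrow> (C2 \<Rightarrow> complex) \<Rightarrow> bool" where
  "Ef_function E f M F \<longleftrightarrow>
     (\<exists>G. (\<forall>k\<in>E. f_homogeneous_poly f k (G k)) \<and>
        (\<forall>K. compact K \<and> K \<subseteq> M \<longrightarrow>
           uniform_limit K (\<lambda>n w. \<Sum>k\<in>E \<inter> {..<n}. G k w) F sequentially))"

definition LI_set :: "nat set \<Rightarrow> bool" where
  "LI_set E \<longleftrightarrow> (\<exists>a::nat \<Rightarrow> int. \<forall>m\<ge>1. \<forall>j\<in>{1..m}. a m + int j \<in> int ` E)"

definition lower_semicontinuous_on :: "'a::topological_space set \<Rightarrow> ('a \<Rightarrow> real) \<Rightarrow> bool" where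
  "lower_semicontinuous_on A g \<longleftrightarrow> (\<forall>c. openin (top_of_set A) {x\<in>A. c < g x})"

text \<open>The level sets \<open>{w \<in> M. norm (f w) = r}\<close>, \<open>0 < r < 1\<close>, exhaust \<open>M\<close>. Each of them
  carries the measure induced by \<open>\<sigma>\<close> through \<open>f\<close> in the same way as \<open>\<sigma>M\<close> is induced on the
  boundary (the case \<open>r = 1\<close>): the integral of \<open>g\<close> is the \<open>\<sigma>\<close>-integral over \<open>z\<close> of the sum of
  \<open>g\<close> over the finite fibre above \<open>r z\<close>. Membership in \<open>H\<^sup>2(M)\<close> means that the quadratic means
  over these level sets are bounded.\<close>

definition Hardy2 ::
    "(C2 \<Rightarrow> C2) \<Rightarrow> C2 set \<Rightarrow> C2 measure \<Rightarrow> (C2 \<Rightarrow> complex) set" where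
  "Hardy2 f M \<sigma> = {F. holo_on F M \<and>
     (SUP r\<in>{0<..<1::real}. \<integral>\<^sup>+ z. (\<Sum>w\<in>{w\<in>M. f w = r *\<^sub>R z}. ennreal ((cmod (F w))\<^sup>2)) \<partial>\<sigma>) < \<infinity>}"

text \<open>Radii in \<open>M\<close> are taken through \<open>f\<close>: the radius at \<open>\<zeta>\<close> is the set of points of \<open>M\<close> that
  \<open>f\<close> maps into the ordinary radius of the ball ending at \<open>f \<zeta>\<close>. Near a boundary point outside
  \<open>Z1\<close> this is a single arc ending at \<open>\<zeta>\<close>. For \<open>f\<close> the identity one gets the usual radial limit.\<close>

definition f_radius :: "(C2 \<Rightarrow> C2) \<Rightarrow> C2 set \<Rightarrow> C2 \<Rightarrow> C2 set" where
  "f_radius f M \<zeta> = {w\<in>M. \<exists>r\<in>{0..<1::real}. f w = r *\<^sub>R f \<zeta>}"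

definition has_boundary_value ::
    "(C2 \<Rightarrow> C2) \<Rightarrow> C2 set \<Rightarrow> (C2 \<Rightarrow> complex) \<Rightarrow> C2 \<Rightarrow> complex \<Rightarrow> bool" where
  "has_boundary_value f M F \<zeta> L \<longleftrightarrow>
     \<zeta> islimpt f_radius f M \<zeta> \<and> (F \<longlongrightarrow> L) (at \<zeta> within f_radius f M \<zeta>)"

end

theory Submission
  imports Defs "HOL-Complex_Analysis.Residue_Theorem"
begin

text \<open>Composition with \<open>f\<close> reduces the theorem to the ball. There, peak functions \<open>\<langle>z,\<zeta>\<rangle>\<^sup>k\<close> centred at
  a net of mesh comparable with \<open>k\<^sup>-\<^sup>1\<^sup>/\<^sup>2\<close>, multiplied by polynomials that approximate a positive
  continuous \<open>\<psi>\<close> on the circle through each centre, add up to a polynomial of modulus less than \<open>\<psi>\<close>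
  whose \<open>L\<^sup>2\<close> norm is at least a fixed fraction of that of \<open>\<psi>\<close>; its degrees fill one long interval
  and hence can be taken in \<open>E\<close>. Applying this repeatedly below \<open>\<phi> - \<bar>s\<^sub>n\<bar>\<close>, where \<open>s\<^sub>n\<close> is the sum
  obtained so far, and using the orthogonality of different degrees, one gets a series whose partial
  sums satisfy \<open>\<bar>s\<^sub>n\<bar> < \<phi>\<close> and \<open>\<bar>s\<^sub>n\<bar> \<rightarrow> \<phi>\<close> in \<open>L\<^sup>2\<close>. A maximal inequality on the circles through the
  origin yields the radial limits. The quadratic means on \<open>M\<close> are at most \<open>N\<close> times those on the
  ball because \<open>f\<close> is open at isolated points of its fibres, so that no fibre in \<open>M\<close> has more than
  \<open>N\<close> points; openness follows from a maximum principle on the zero set of one coordinate.\<close>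

text \<open>The modulus of \<open>hip z \<zeta> ^ k\<close> is constant on the circles
  \<open>u *s z\<close> with |u| = 1, so a peak concentrates on a whole circle, along which
  \<open>\<psi>\<close> may vary. Hence the polynomial factor: on the circle through the centre,
  \<open>\<psi>\<close> is uniformly close to a real polynomial, which after multiplication by a
  power of \<open>u\<close> is an ordinary polynomial in \<open>u\<close>. Its degree bound n and
  its coefficient bound are the same for all centres and are fixed before k is chosen. This is where
  LI-sets enter: n + 1 consecutive exponents are required, placed as far out as the error estimates
  demand. Different peaks carry unrelated phases, so only moduli can be controlled. Strict
  inequality everywhere on the sphere keeps the remainder positive and lower semicontinuous, which
  is exactly what the next step asks for. The terms of degree k are kept below k on the sphere; this
  growth bound makes the series converge locally uniformly in the ball.\<close>

no_notation fps_nth (infixl \<open>$\<close> 75)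

section \<open>Complex geometry of the sphere\<close>

lemma C2_norm_sq: "(norm (z::C2))\<^sup>2 = (cmod (z$1))\<^sup>2 + (cmod (z$2))\<^sup>2"
  by (simp add: norm_vec_def L2_set_def sum_2)

lemma C2_sphere_iff: "(z::C2) \<in> S2 \<longleftrightarrow> (cmod (z$1))\<^sup>2 + (cmod (z$2))\<^sup>2 = 1"
  by (simp add: C2_norm_sq[symmetric] power2_eq_1_iff) (smt (verit) norm_ge_zero)

lemma norm_vector_smult: "norm (c *s (z::C2)) = cmod c * norm z"
proof -
  have "(norm (c *s z))\<^sup>2 = (cmod c * norm z)\<^sup>2"
    by (simp add: C2_norm_sq norm_mult power_mult_distrib algebra_simps)
  thus ?thesis by (simp add: power2_eq_iff_nonneg)
qed

text \<open>The Hermitian inner product, conjugate linear in the second argument, so that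
  \<open>hip z w ^ k\<close> is a homogeneous polynomial in \<open>z\<close>.\<close>

definition hip :: "C2 \<Rightarrow> C2 \<Rightarrow> complex" where
  "hip z w = z$1 * cnj (w$1) + z$2 * cnj (w$2)"

text \<open>The Hopf map: it carries the unit sphere onto the unit 2-sphere of
  \<open>real \<times> complex\<close>, and its fibres there are the circles \<open>u *s z\<close>
  with |u| = 1. Quantities that ignore phases, such as \<open>cmod (hip z w)\<close> on the sphere,
  are functions of the Hopf images.\<close>

definition hopf :: "C2 \<Rightarrow> real \<times> complex" where
  "hopf z = ((cmod (z$1))\<^sup>2 - (cmod (z$2))\<^sup>2, 2 * z$1 * cnj (z$2))"

text \<open>The matrix with rows \<open>(p, - cnj q)\<close> and \<open>(q, cnj p)\<close>. For
  |p|^2 + |q|^2 = 1 these are the elements of SU(2), that is, multiplications by unit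
  quaternions.\<close>

definition rot :: "complex \<Rightarrow> complex \<Rightarrow> C2 \<Rightarrow> C2" where
  "rot p q z = vector [p * z$1 - cnj q * z$2, q * z$1 + cnj p * z$2]"

lemma rot_nth [simp]:
  "rot p q z $ 1 = p * z$1 - cnj q * z$2" "rot p q z $ 2 = q * z$1 + cnj p * z$2"
  by (simp_all add: rot_def)

text \<open>The left side is the squared cosine of half the angle between the Hopf images, and their
  chord is twice the sine of that half angle. This identity is what turns powers of
  \<open>cmod (hip z w)\<close> into Gaussians of the Hopf distance.\<close>

lemma hopf_dist_sq:
  assumes "z \<in> S2" "w \<in> S2"
  shows "(cmod (hip z w))\<^sup>2 = 1 - (dist (hopf z) (hopf w))\<^sup>2 / 4"
proof -
  obtain a b c d where z: "z$1 = Complex a b" "z$2 = Complex c d" by (metis complex.collapse)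
  obtain a' b' c' d' where w: "w$1 = Complex a' b'" "w$2 = Complex c' d'" by (metis complex.collapse)
  have 1: "a^2+b^2+c^2+d^2 = 1" and 2: "a'^2+b'^2+c'^2+d'^2 = 1"
    using assms unfolding C2_sphere_iff z w by (simp_all add: cmod_power2)
  have "(dist (hopf z) (hopf w))\<^sup>2 = ((a^2+b^2-(c^2+d^2)) - (a'^2+b'^2-(c'^2+d'^2)))^2
     + (2*(a*c+b*d) - 2*(a'*c'+b'*d'))^2 + (2*(b*c-a*d) - 2*(b'*c'-a'*d'))^2"
    unfolding hopf_def dist_Pair_Pair z w
    by (simp add: dist_norm cmod_power2) (simp add: power2_eq_square algebra_simps)
  also have "\<dots> = (a^2+b^2+c^2+d^2)^2 + (a'^2+b'^2+c'^2+d'^2)^2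
     + 2*(a^2+b^2+c^2+d^2)*(a'^2+b'^2+c'^2+d'^2)
     - 4*((a*a'+b*b'+c*c'+d*d')^2 + (b*a'-a*b'+d*c'-c*d')^2)"
    by (simp add: power2_eq_square algebra_simps)
  also have "(a*a'+b*b'+c*c'+d*d')^2 + (b*a'-a*b'+d*c'-c*d')^2 = (cmod (hip z w))\<^sup>2"
    unfolding hip_def z w cmod_power2 by (simp add: power2_eq_square algebra_simps)
  finally have "(dist (hopf z) (hopf w))\<^sup>2 = 4 - 4 * (cmod (hip z w))\<^sup>2" unfolding 1 2 by simp
  thus ?thesis by (simp add: field_simps)
qed

lemma hopf_rot_dist:
  assumes "(cmod p)\<^sup>2 + (cmod q)\<^sup>2 = 1"
  shows "hip (rot p q z) (rot p q w) = hip z w"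
proof -
  have "p * cnj p + q * cnj q = 1"
    using assms by (metis complex_norm_square of_real_1 of_real_add)
  hence 1: "x * (p * cnj p) + x * (q * cnj q) = x" for x by (simp add: distrib_left[symmetric])
  have "hip (rot p q z) (rot p q w) = (z$1 * cnj (w$1)) * (p * cnj p) + (z$1 * cnj (w$1)) * (q * cnj q)
     + ((z$2 * cnj (w$2)) * (p * cnj p) + (z$2 * cnj (w$2)) * (q * cnj q))"
    unfolding hip_def by (simp add: algebra_simps)
  thus ?thesis unfolding 1 hip_def .
qed

lemma hip_self: "hip z z = of_real ((norm z)\<^sup>2)"
  unfolding hip_def C2_norm_sq of_real_add complex_norm_square by simp

lemma norm_rot:
  assumes "(cmod p)\<^sup>2 + (cmod q)\<^sup>2 = 1"
  shows "norm (rot p q z) = norm z"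
  using hopf_rot_dist[OF assms, of z z] by (metis hip_self norm_ge_zero of_real_eq_iff power2_eq_iff_nonneg)

lemma linear_rot: "linear (rot p q)"
  by (rule linearI) (simp_all add: vec_eq_iff forall_2 algebra_simps scaleR_diff_right scaleR_add_right)

lemma orth_rot:
  assumes "(cmod p)\<^sup>2 + (cmod q)\<^sup>2 = 1"
  shows "orthogonal_transformation (rot p q)"
  using orthogonal_transformation linear_rot norm_rot[OF assms] by blast

lemma linear_smult: "linear (\<lambda>z::C2. c *s z)"
  by (rule linearI) (simp_all add: vec_eq_iff forall_2 algebra_simps)

lemma orth_smult:
  assumes "cmod c = 1"
  shows "orthogonal_transformation (\<lambda>z::C2. c *s z)"
  using orthogonal_transformation linear_smult norm_vector_smult assms by fastforce

text \<open>In quaternion terms \<open>p\<close> and \<open>q\<close> are the coordinates of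
  \<open>w\<close> times the inverse of \<open>z\<close>. Since \<open>rot p q\<close> minus the
  identity is again multiplication by a quaternion, it stretches all vectors by the same factor, and
  evaluation at \<open>z\<close> shows that this factor is \<open>norm (w - z)\<close>. So
  \<open>z\<close> can be taken to a nearby \<open>w\<close> without moving any point of the sphere
  farther than \<open>z\<close> itself.\<close>

lemma rot_transitive:
  assumes "z \<in> S2" "w \<in> S2"
  obtains p q where "(cmod p)\<^sup>2 + (cmod q)\<^sup>2 = 1" "rot p q z = w"
    "\<And>x. norm (rot p q x - x) = norm (w - z) * norm x"
proof -
  define p where "p = w$1 * cnj (z$1) + cnj (w$2) * z$2"
  define q where "q = w$2 * cnj (z$1) - cnj (w$1) * z$2"
  have z: "z$1 * cnj (z$1) + z$2 * cnj (z$2) = 1" and w: "w$1 * cnj (w$1) + w$2 * cnj (w$2) = 1"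
    using assms hip_self[of z] hip_self[of w] by (simp_all add: hip_def)
  have "of_real ((cmod p)\<^sup>2 + (cmod q)\<^sup>2) = p * cnj p + q * cnj q"
    unfolding of_real_add complex_norm_square ..
  also have "\<dots> = (z$1 * cnj (z$1) + z$2 * cnj (z$2)) * (w$1 * cnj (w$1) + w$2 * cnj (w$2))"
    unfolding p_def q_def by (simp add: algebra_simps)
  also have "\<dots> = of_real 1" unfolding z w by simp
  finally have pq: "(cmod p)\<^sup>2 + (cmod q)\<^sup>2 = 1" unfolding of_real_eq_iff .
  have "rot p q z $ 1 = w$1 * (z$1 * cnj (z$1) + z$2 * cnj (z$2))"
    "rot p q z $ 2 = w$2 * (z$1 * cnj (z$1) + z$2 * cnj (z$2))"
    unfolding p_def q_def by (simp_all add: algebra_simps)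
  hence rz: "rot p q z = w" unfolding z by (simp add: vec_eq_iff forall_2)
  have sq: "(norm (rot p q x - x))\<^sup>2 = ((cmod (p-1))\<^sup>2 + (cmod q)\<^sup>2) * (norm x)\<^sup>2" for x
  proof -
    have "of_real ((norm (rot p q x - x))\<^sup>2) = hip (rot p q x - x) (rot p q x - x)" by (simp add: hip_self)
    also have "\<dots> = ((p-1) * cnj (p-1) + q * cnj q) * hip x x"
      unfolding hip_def by (simp add: algebra_simps)
    also have "\<dots> = of_real (((cmod (p-1))\<^sup>2 + (cmod q)\<^sup>2) * (norm x)\<^sup>2)"
      unfolding hip_self of_real_mult of_real_add complex_norm_square by simp
    finally show ?thesis unfolding of_real_eq_iff .
  qed
  have "norm (rot p q x - x) = norm (w - z) * norm x" for x
  proof -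
    have "(norm (rot p q x - x))\<^sup>2 = (norm (w - z) * norm x)\<^sup>2"
      using sq[of x] sq[of z] assms(1) by (simp add: rz power_mult_distrib)
    thus ?thesis by (simp add: power2_eq_iff_nonneg)
  qed
  with pq rz show ?thesis using that by blast
qed

lemma hip_le_1:
  assumes "z \<in> S2" "w \<in> S2"
  shows "cmod (hip z w) \<le> 1"
  by (rule power2_le_imp_le) (use hopf_dist_sq[OF assms] in auto)

lemma dist_phase:
  assumes "z \<in> S2" "w \<in> S2" "hip z w = of_real r"
  shows "(norm (z - w))\<^sup>2 = 2 - 2 * r"
proof -
  have "hip w z = cnj (hip z w)" by (simp add: hip_def)
  hence "hip w z = of_real r" using assms by simp
  moreover have "hip (z - w) (z - w) = hip z z + hip w w - hip z w - hip w z"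
    by (simp add: hip_def algebra_simps)
  ultimately have "of_real ((norm (z - w))\<^sup>2) = (of_real (2 - 2*r) :: complex)"
    using assms by (simp add: hip_self)
  thus ?thesis unfolding of_real_eq_iff .
qed

lemma hip_smult: "hip (c *s z) w = c * hip z w" "hip z (c *s w) = cnj c * hip z w"
  by (simp_all add: hip_def algebra_simps)

lemma smult_sphere: "cmod c = 1 \<Longrightarrow> z \<in> S2 \<Longrightarrow> c *s z \<in> S2"
  by (simp add: norm_vector_smult)

lemma hopf_smult: "cmod c = 1 \<Longrightarrow> hopf (c *s z) = hopf z"
proof -
  assume c: "cmod c = 1"
  hence "c * cnj c = 1" by (metis complex_norm_square of_real_1 one_power2)
  moreover have "c * z$1 * (cnj c * cnj (z$2)) = (c * cnj c) * (z$1 * cnj (z$2))" by (simp add: algebra_simps)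
  ultimately have "c * z$1 * (cnj c * cnj (z$2)) = z$1 * cnj (z$2)" by simp
  thus ?thesis using c by (simp add: hopf_def norm_mult)
qed

lemma dist_hopf_rot:
  assumes "(cmod p)\<^sup>2 + (cmod q)\<^sup>2 = 1" "z \<in> S2" "w \<in> S2"
  shows "dist (hopf (rot p q z)) (hopf (rot p q w)) = dist (hopf z) (hopf w)"
proof -
  have "rot p q z \<in> S2" "rot p q w \<in> S2" using assms norm_rot by auto
  hence "(dist (hopf (rot p q z)) (hopf (rot p q w)))\<^sup>2 = (dist (hopf z) (hopf w))\<^sup>2"
    using hopf_dist_sq hopf_dist_sq[OF assms(2,3)] hopf_rot_dist[OF assms(1), of z w] by fastforce
  thus ?thesis by (simp add: power2_eq_iff_nonneg)
qed

lemma continuous_on_hopf: "continuous_on A hopf"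
  unfolding hopf_def by (intro continuous_intros)

text \<open>\<open>u\<close> is the phase of the inner product, so \<open>hip z (u *s w)\<close> is
  nonnegative and \<open>u *s w\<close> is the point of the circle through \<open>w\<close> closest
  to \<open>z\<close>. With h = |hip z w| its squared distance 2 - 2h is at most the squared Hopf
  distance 4 - 4h^2, because h^2 \<le> h \<le> 1. For orthogonal vectors the phase is set to
  1.\<close>

lemma phase_align:
  assumes "z \<in> S2" "w \<in> S2"
  obtains u where "cmod u = 1" "hip z w = of_real (cmod (hip z w)) * u"
    "norm (z - u *s w) \<le> dist (hopf z) (hopf w)"
proof -
  define h where "h = hip z w"
  define u where "u = (if h = 0 then 1 else h / cmod h)"
  have u: "cmod u = 1" by (simp add: u_def norm_divide)
  have hu: "h = of_real (cmod h) * u" by (simp add: u_def)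
  have "cnj u * u = 1" using u by (metis complex_norm_square mult.commute of_real_1 one_power2)
  hence "hip z (u *s w) = of_real (cmod h)"
    unfolding hip_smult h_def[symmetric] using hu by (metis mult.left_commute mult.right_neutral)
  from dist_phase[OF assms(1) smult_sphere[OF u assms(2)] this]
  have 1: "(norm (z - u *s w))\<^sup>2 = 2 - 2 * cmod h" .
  have "(cmod h)\<^sup>2 \<le> cmod h" using hip_le_1[OF assms] unfolding h_def[symmetric]
    by (simp add: power2_eq_square mult_left_le)
  hence "(norm (z - u *s w))\<^sup>2 \<le> (dist (hopf z) (hopf w))\<^sup>2"
    using 1 hopf_dist_sq[OF assms] hip_le_1[OF assms] unfolding h_def[symmetric] by linarith
  hence "norm (z - u *s w) \<le> dist (hopf z) (hopf w)" by (rule power2_le_imp_le) simp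
  thus ?thesis using that u hu h_def by blast
qed

section \<open>Homogeneous polynomials in two variables\<close>

lemma homogeneous_poly_smult:
  assumes "homogeneous_poly k p"
  shows "p (c *s z) = c ^ k * p z"
proof -
  obtain b where p: "p = (\<lambda>z. \<Sum>j\<le>k. b j * (z $ 1) ^ j * (z $ 2) ^ (k - j))"
    using assms unfolding homogeneous_poly_def by blast
  have "b j * (c * z $ 1) ^ j * (c * z $ 2) ^ (k - j) = c ^ k * (b j * (z $ 1) ^ j * (z $ 2) ^ (k - j))"
    if "j \<le> k" for j
  proof -
    have "c ^ k = c ^ j * c ^ (k - j)" using that by (metis le_add_diff_inverse power_add)
    thus ?thesis by (simp add: power_mult_distrib)
  qed
  hence "(\<Sum>j\<le>k. b j * (c * z $ 1) ^ j * (c * z $ 2) ^ (k - j))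
      = (\<Sum>j\<le>k. c ^ k * (b j * (z $ 1) ^ j * (z $ 2) ^ (k - j)))"
    by (intro sum.cong) auto
  thus ?thesis unfolding p by (simp add: sum_distrib_left)
qed

lemma continuous_on_homogeneous_poly:
  assumes "homogeneous_poly k p"
  shows "continuous_on A p"
proof -
  obtain b where p: "p = (\<lambda>z. \<Sum>j\<le>k. b j * (z $ 1) ^ j * (z $ 2) ^ (k - j))"
    using assms unfolding homogeneous_poly_def by blast
  show ?thesis unfolding p by (intro continuous_intros)
qed

lemma homogeneous_poly_zero: "homogeneous_poly k (\<lambda>z. 0)"
  unfolding homogeneous_poly_def by (rule exI[of _ "\<lambda>j. 0"]) simp

lemma homogeneous_poly_add:
  assumes "homogeneous_poly k p" "homogeneous_poly k q"
  shows "homogeneous_poly k (\<lambda>z. p z + q z)"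
proof -
  obtain b c where p: "p = (\<lambda>z. \<Sum>j\<le>k. b j * (z $ 1) ^ j * (z $ 2) ^ (k - j))"
    and q: "q = (\<lambda>z. \<Sum>j\<le>k. c j * (z $ 1) ^ j * (z $ 2) ^ (k - j))"
    using assms unfolding homogeneous_poly_def by blast
  show ?thesis unfolding homogeneous_poly_def p q
    by (rule exI[of _ "\<lambda>j. b j + c j"]) (simp add: algebra_simps sum.distrib)
qed

lemma homogeneous_poly_cmult:
  assumes "homogeneous_poly k p"
  shows "homogeneous_poly k (\<lambda>z. a * p z)"
proof -
  obtain b where p: "p = (\<lambda>z. \<Sum>j\<le>k. b j * (z $ 1) ^ j * (z $ 2) ^ (k - j))"
    using assms unfolding homogeneous_poly_def by blast
  show ?thesis unfolding homogeneous_poly_def p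
    by (rule exI[of _ "\<lambda>j. a * b j"]) (simp add: algebra_simps sum_distrib_left)
qed

lemma homogeneous_poly_sum:
  assumes "\<And>i. i \<in> I \<Longrightarrow> homogeneous_poly k (p i)"
  shows "homogeneous_poly k (\<lambda>z. \<Sum>i\<in>I. p i z)"
  using assms by (induction I rule: infinite_finite_induct)
    (auto simp: homogeneous_poly_zero intro: homogeneous_poly_add)

lemma homogeneous_poly_hip_power: "homogeneous_poly k (\<lambda>z. hip z w ^ k)"
proof -
  have "hip z w ^ k = (\<Sum>j\<le>k. (of_nat (k choose j) * cnj (w$1) ^ j * cnj (w$2) ^ (k - j))
       * (z $ 1) ^ j * (z $ 2) ^ (k - j))" for z
    unfolding hip_def binomial_ring by (simp add: power_mult_distrib algebra_simps)
  thus ?thesis unfolding homogeneous_poly_def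
    by (intro exI[of _ "\<lambda>j. of_nat (k choose j) * cnj (w$1) ^ j * cnj (w$2) ^ (k - j)"]) auto
qed

section \<open>Integration against the rotation-invariant measure\<close>

locale sphere_measure =
  fixes \<sigma> :: "C2 measure"
  assumes rip: "rotation_invariant_probability \<sigma>"
begin

sublocale prob_space \<sigma> using rip unfolding rotation_invariant_probability_def by blast

lemma sets_sigma: "sets \<sigma> = sets (restrict_space borel S2)"
  using rip unfolding rotation_invariant_probability_def by blast

lemma space_sigma [simp]: "space \<sigma> = S2"
  using sets_eq_imp_space_eq[OF sets_sigma] by (simp add: space_restrict_space)

lemma in_sets_sigma: "A \<in> sets \<sigma> \<longleftrightarrow> A \<in> sets borel \<and> A \<subseteq> S2"
  unfolding sets_sigma by (subst sets_restrict_space_iff) auto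

lemma measurable_sigma [measurable_cong]: "sets \<sigma> = sets (restrict_space borel S2)"
  by (rule sets_sigma)

lemma borel_measurable_cont:
  assumes "continuous_on S2 h"
  shows "h \<in> borel_measurable \<sigma>"
  using borel_measurable_continuous_on_restrict[OF assms] measurable_cong_sets[OF sets_sigma refl] by blast

lemma integrable_cont:
  fixes h :: "C2 \<Rightarrow> 'a::{banach,second_countable_topology}"
  assumes "continuous_on S2 h"
  shows "integrable \<sigma> h"
proof -
  have "bounded (h ` S2)"
    by (rule compact_imp_bounded[OF compact_continuous_image[OF assms]]) simp
  then obtain B where "\<And>z. z \<in> S2 \<Longrightarrow> norm (h z) \<le> B" unfolding bounded_iff by blast
  thus ?thesis
    by (intro integrable_const_bound[of _ B] borel_measurable_cont assms) auto
qed

text \<open>The defining invariance concerns images of sets, whereas a change of variables in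
  integrals needs preimages; surjectivity of \<open>T\<close> turns one into the other.\<close>

lemma distr_orth:
  assumes "orthogonal_transformation T"
  shows "T \<in> measurable \<sigma> \<sigma>" "distr \<sigma> \<sigma> T = \<sigma>"
proof -
  have nT: "norm (T x) = norm x" for x using assms by (rule orthogonal_transformation_norm)
  have cT: "continuous_on A T" for A
    using assms by (simp add: linear_continuous_on linear_linear orthogonal_transformation_linear)
  show T: "T \<in> measurable \<sigma> \<sigma>"
  proof (rule measurableI)
    fix x assume "x \<in> space \<sigma>" thus "T x \<in> space \<sigma>" by (simp add: nT)
  next
    fix A assume A: "A \<in> sets \<sigma>"
    have "T \<in> borel_measurable borel" using cT by (rule borel_measurable_continuous_onI)
    hence "T -` A \<in> sets borel" using A unfolding in_sets_sigma
      using measurable_sets[of T borel borel A] by simp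
    thus "T -` A \<inter> space \<sigma> \<in> sets \<sigma>" unfolding in_sets_sigma by auto
  qed
  show "distr \<sigma> \<sigma> T = \<sigma>"
  proof (rule measure_eqI)
    fix A assume "A \<in> sets (distr \<sigma> \<sigma> T)"
    hence A: "A \<in> sets \<sigma>" by simp
    have pre: "T -` A \<inter> space \<sigma> \<in> sets \<sigma>" using measurable_sets[OF T A] .
    have "T ` (T -` A \<inter> space \<sigma>) = A"
    proof -
      have "surj T" using assms by (rule orthogonal_transformation_surj)
      hence "T ` (T -` A) = A" by (rule surj_image_vimage_eq)
      moreover have "T -` A \<inter> space \<sigma> = T -` A"
        using A unfolding in_sets_sigma by (auto simp: nT subset_iff) 
      ultimately show ?thesis by simp
    qed
    moreover have "emeasure \<sigma> (T ` (T -` A \<inter> space \<sigma>)) = emeasure \<sigma> (T -` A \<inter> space \<sigma>)"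
      using rip assms pre unfolding rotation_invariant_probability_def by blast
    ultimately show "emeasure (distr \<sigma> \<sigma> T) A = emeasure \<sigma> A"
      using emeasure_distr[OF T A] by simp
  qed simp
qed

lemma emeasure_vimage_orth:
  assumes "orthogonal_transformation T" "A \<in> sets \<sigma>"
  shows "emeasure \<sigma> (T -` A \<inter> space \<sigma>) = emeasure \<sigma> A"
  using emeasure_distr[OF distr_orth(1)[OF assms(1)] assms(2)] distr_orth(2)[OF assms(1)] by simp

lemma integral_orth:
  fixes h :: "C2 \<Rightarrow> 'a::{banach,second_countable_topology}"
  assumes "orthogonal_transformation T" "h \<in> borel_measurable \<sigma>"
  shows "(\<integral>z. h (T z) \<partial>\<sigma>) = (\<integral>z. h z \<partial>\<sigma>)"
  using integral_distr[OF distr_orth(1)[OF assms(1)] assms(2)] distr_orth(2)[OF assms(1)] by simp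

lemma nn_integral_orth:
  assumes "orthogonal_transformation T" "h \<in> borel_measurable \<sigma>"
  shows "(\<integral>\<^sup>+z. h (T z) \<partial>\<sigma>) = (\<integral>\<^sup>+z. h z \<partial>\<sigma>)"
  using nn_integral_distr[OF distr_orth(1)[OF assms(1)], of h] assms(2) distr_orth(2)[OF assms(1)] by simp

text \<open>A single rotation suffices: \<open>z \<mapsto> c *s z\<close> leaves the integral
  unchanged and multiplies the integrand by \<open>c ^ k * cnj (c ^ l)\<close>, and the angle
  \<open>t\<close> is chosen so that this factor is -1.\<close>

lemma integral_homogeneous_orthogonal:
  assumes "homogeneous_poly k p" "homogeneous_poly l q" "k \<noteq> l"
  shows "(\<integral>z. p z * cnj (q z) \<partial>\<sigma>) = 0"
proof -
  define t where "t = pi / (real k - real l)"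
  define c where "c = cis t"
  have c: "cmod c = 1" by (simp add: c_def)
  have "c ^ k * cnj (c ^ l) = cis (real k * t - real l * t)"
    
    unfolding c_def by (simp add: Complex.DeMoivre cis_mult cis_cnj algebra_simps)
  also have "real k * t - real l * t = pi" 
    unfolding t_def left_diff_distrib[symmetric] using assms(3) by simp
  finally have m: "c ^ k * cnj (c ^ l) = -1" by simp
  have "continuous_on S2 (\<lambda>z. p z * cnj (q z))"
    using assms by (intro continuous_intros continuous_on_homogeneous_poly)
  from integral_orth[OF orth_smult[OF c] borel_measurable_cont[OF this]]
  have "(\<integral>z. p z * cnj (q z) \<partial>\<sigma>) = (\<integral>z. p (c *s z) * cnj (q (c *s z)) \<partial>\<sigma>)" by simp
  also have "\<dots> = (\<integral>z. (c ^ k * cnj (c ^ l)) * (p z * cnj (q z)) \<partial>\<sigma>)"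
    using assms by (simp add: homogeneous_poly_smult algebra_simps)
  also have "\<dots> = - (\<integral>z. p z * cnj (q z) \<partial>\<sigma>)" unfolding m by simp
  finally show ?thesis by simp
qed

lemma integral_sum_homogeneous:
  assumes "finite I" "\<And>k. k \<in> I \<Longrightarrow> homogeneous_poly k (H k)"
  shows "(\<integral>z. (cmod (\<Sum>k\<in>I. H k z))\<^sup>2 \<partial>\<sigma>) = (\<Sum>k\<in>I. \<integral>z. (cmod (H k z))\<^sup>2 \<partial>\<sigma>)"
proof -
  have cont: "continuous_on S2 (H k)" if "k \<in> I" for k
    using continuous_on_homogeneous_poly[OF assms(2)[OF that]] .
  have "complex_of_real (\<integral>z. (cmod (\<Sum>k\<in>I. H k z))\<^sup>2 \<partial>\<sigma>)
      = (\<integral>z. (\<Sum>k\<in>I. \<Sum>l\<in>I. H k z * cnj (H l z)) \<partial>\<sigma>)"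
    unfolding integral_complex_of_real[symmetric] complex_norm_square cnj_sum sum_product ..
  also have "\<dots> = (\<Sum>k\<in>I. \<Sum>l\<in>I. \<integral>z. H k z * cnj (H l z) \<partial>\<sigma>)"
    by (subst Bochner_Integration.integral_sum)
      (auto intro!: sum.cong Bochner_Integration.integral_sum integrable_cont continuous_intros cont)
  also have "\<dots> = (\<Sum>k\<in>I. \<Sum>l\<in>I. if l = k then complex_of_real (\<integral>z. (cmod (H k z))\<^sup>2 \<partial>\<sigma>) else 0)"
    using integral_homogeneous_orthogonal[OF assms(2) assms(2)]
    by (intro sum.cong refl) (auto simp del: of_real_power
        simp add: integral_complex_of_real[symmetric] complex_norm_square)
  also have "\<dots> = complex_of_real (\<Sum>k\<in>I. \<integral>z. (cmod (H k z))\<^sup>2 \<partial>\<sigma>)"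
    using assms(1) by simp
  finally show ?thesis unfolding of_real_eq_iff .
qed

text \<open>The sets \<open>A t\<close> are circles that rotations carry to \<open>A 0\<close>, and
  those for distinct real \<open>t\<close> are disjoint on the sphere. A probability measure cannot
  give infinitely many disjoint sets the same positive mass. The other coordinate circle is the
  preimage of \<open>A 0\<close> under \<open>rot 0 1\<close>.\<close>

lemma emeasure_coordinate_circle:
  "emeasure \<sigma> {z \<in> S2. z $ 1 = 0} = 0" "emeasure \<sigma> {z \<in> S2. z $ 2 = 0} = 0"
proof -
  define A where "A t = {z \<in> S2. z $ 1 = of_real t * z $ 2}" for t :: real
  have clA: "A t \<in> sets \<sigma>" for t
  proof -
    have "closed {z::C2. z $ 1 = of_real t * z $ 2}" by (intro closed_Collect_eq continuous_intros)
    hence "closed (S2 \<inter> {z::C2. z $ 1 = of_real t * z $ 2})" by (intro closed_Int) auto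
    moreover have "S2 \<inter> {z::C2. z $ 1 = of_real t * z $ 2} = A t" unfolding A_def by blast
    ultimately have "closed (A t)" by simp
    thus ?thesis unfolding in_sets_sigma by (auto simp: A_def)
  qed
  have eq: "emeasure \<sigma> (A t) = emeasure \<sigma> (A 0)" for t
  proof -
    define s where "s = sqrt (1 + t\<^sup>2)"
    have s: "s > 0" "s\<^sup>2 = 1 + t\<^sup>2" unfolding s_def by (auto simp: add_pos_nonneg)
    define p where "p = complex_of_real (1 / s)"
    define q where "q = complex_of_real (t / s)"
    have "1 + t\<^sup>2 \<noteq> 0" using zero_le_power2[of t] by linarith
    hence pq: "(cmod p)\<^sup>2 + (cmod q)\<^sup>2 = 1"
      unfolding p_def q_def norm_of_real using s by (simp add: power_divide add_divide_distrib[symmetric])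
    have T: "orthogonal_transformation (rot p q)" using pq by (rule orth_rot)
    have r: "rot p q z $ 1 = (z$1 - of_real t * z$2) / of_real s" for z
      unfolding rot_nth p_def q_def by (simp add: diff_divide_distrib)
    have "rot p q z \<in> A 0 \<longleftrightarrow> z \<in> A t" if "z \<in> S2" for z
      using that s norm_rot[OF pq] unfolding A_def by (simp add: r del: rot_nth)
    moreover have "A t \<subseteq> S2" unfolding A_def by blast
    ultimately have "A t = rot p q -` A 0 \<inter> space \<sigma>" unfolding space_sigma by blast
    thus ?thesis using emeasure_vimage_orth[OF T clA] by simp
  qed
  have "disjoint_family_on (\<lambda>n. A (real n)) {..<N}" for N
  proof (unfold disjoint_family_on_def, intro ballI impI)
    fix m n :: nat assume "m \<noteq> n"
    show "A (real m) \<inter> A (real n) = {}"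
    proof (rule ccontr)
      assume "A (real m) \<inter> A (real n) \<noteq> {}"
      then obtain z where z: "z \<in> S2" "z $ 1 = of_real (real m) * z $ 2" "z $ 1 = of_real (real n) * z $ 2"
        unfolding A_def by blast
      hence "z $ 2 = 0" using \<open>m \<noteq> n\<close> by simp
      thus False using z unfolding C2_sphere_iff by simp
    qed
  qed
  hence "measure \<sigma> (\<Union>n<N. A (real n)) = (\<Sum>n<N. measure \<sigma> (A (real n)))" for N
    by (intro finite_measure_finite_Union) (auto simp: clA)
  moreover have "(\<Sum>n<N. measure \<sigma> (A (real n))) = (\<Sum>n<N. measure \<sigma> (A 0))" for N
    by (rule sum.cong) (simp_all add: measure_def eq[of "real _"])
  ultimately have "real N * measure \<sigma> (A 0) \<le> 1" for N
    using prob_le_1[of "\<Union>n<N. A (real n)"] by simp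
  hence "\<not> 0 < measure \<sigma> (A 0)"
    using reals_Archimedean3[of "measure \<sigma> (A 0)"] by (auto simp: not_less[symmetric])
  hence "measure \<sigma> (A 0) = 0" using measure_nonneg[of \<sigma> "A 0"] by linarith
  hence 0: "emeasure \<sigma> (A 0) = 0" by (simp add: emeasure_eq_measure)
  thus "emeasure \<sigma> {z \<in> S2. z $ 1 = 0} = 0" by (simp add: A_def)
  have pq: "(cmod 0)\<^sup>2 + (cmod 1)\<^sup>2 = 1" by simp
  have "{z \<in> S2. z $ 2 = 0} = rot 0 1 -` A 0 \<inter> space \<sigma>"
    using norm_rot[OF pq] unfolding A_def by auto
  thus "emeasure \<sigma> {z \<in> S2. z $ 2 = 0} = 0"
    using 0 emeasure_vimage_orth[OF orth_rot[OF pq] clA] by simp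
qed

end

section \<open>Nets and peak functions\<close>

text \<open>\<open>max i (- i - 1)\<close> is the distance of the interval [i, i + 1] from 0, a
  lower bound for |t| when the floor of t is i. As m \<le> m^2 for naturals, the Gaussian terms on
  each half line are dominated by a geometric series.\<close>

lemma exp_square_sum_int:
  fixes \<beta> :: real
  assumes "\<beta> > 0"
  shows "(\<Sum>i\<in>{- int n..<int n}. exp (- \<beta> * (real_of_int (max i (- i - 1)))\<^sup>2)) \<le> 2 / (1 - exp (- \<beta>))"
proof -
  define g where "g i = exp (- \<beta> * (real_of_int (max i (- i - 1)))\<^sup>2)" for i
  have gp: "g (int m) \<le> exp (- \<beta>) ^ m" and gn: "g (- int m - 1) \<le> exp (- \<beta>) ^ m" for m
  proof -
    have "real m \<le> (real m)\<^sup>2" by (cases m) (auto simp: power2_eq_square)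
    hence 1: "exp (- \<beta> * (real m)\<^sup>2) \<le> exp (- \<beta> * real m)" using assms by simp
    have "max (int m) (- int m - 1) = int m" "max (- int m - 1) (- (- int m - 1) - 1) = int m" by auto
    thus "g (int m) \<le> exp (- \<beta>) ^ m" "g (- int m - 1) \<le> exp (- \<beta>) ^ m"
      using 1 unfolding g_def exp_of_nat_mult[symmetric] by (simp_all add: mult.commute)
  qed
  have "{- int n..<int n} = int ` {..<n} \<union> (\<lambda>m. - int m - 1) ` {..<n}"
  proof (intro equalityI subsetI)
    fix i assume i: "i \<in> {- int n..<int n}"
    show "i \<in> int ` {..<n} \<union> (\<lambda>m. - int m - 1) ` {..<n}"
    proof (cases "i \<ge> 0")
      case True hence "i = int (nat i)" "nat i < n" using i by auto
      thus ?thesis by blast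
    next
      case False hence "i = - int (nat (- i - 1)) - 1" "nat (- i - 1) < n" using i by auto
      thus ?thesis by blast
    qed
  qed auto
  hence "sum g {- int n..<int n} = sum g (int ` {..<n}) + sum g ((\<lambda>m. - int m - 1) ` {..<n})"
    by (simp only:) (rule sum.union_disjoint, auto)
  also have "\<dots> = (\<Sum>m<n. g (int m)) + (\<Sum>m<n. g (- int m - 1))"
    by (simp add: sum.reindex inj_on_def)
  also have "\<dots> \<le> (\<Sum>m<n. exp (- \<beta>) ^ m) + (\<Sum>m<n. exp (- \<beta>) ^ m)"
    by (intro add_mono sum_mono gp gn)
  also have "(\<Sum>m<n. exp (- \<beta>) ^ m) \<le> 1 / (1 - exp (- \<beta>))"
    using assms by (simp add: sum_gp_strict divide_right_mono)
  finally show ?thesis unfolding g_def by simp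
qed

text \<open>Separated points lie in distinct cells of a cubic grid, so the sum is dominated by the
  cube of a one-dimensional Gaussian sum.\<close>

lemma separated_gaussian_sum:
  fixes P :: "(real \<times> complex) set"
  assumes fin: "finite P" and s: "s > 0" and a: "a > 0"
    and sep: "\<And>p q. p \<in> P \<Longrightarrow> q \<in> P \<Longrightarrow> p \<noteq> q \<Longrightarrow> s \<le> dist p q"
  shows "(\<Sum>p\<in>P. exp (- a * (dist x p)\<^sup>2)) \<le> (2 / (1 - exp (- (a * s\<^sup>2 / 4)))) ^ 3"
proof -
  \<comment> \<open>The exponent after cells of side \<open>s/2\<close> are rescaled to side 1. Two
    points in a cube of side \<open>s/2\<close> are at most \<open>sqrt 3 / 2 * s\<close> apart,
    which is less than \<open>s\<close>; this is why the side is half the separation.\<close>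
  define \<beta> where "\<beta> = a * s\<^sup>2 / 4"
  have \<beta>: "\<beta> > 0" using a s by (simp add: \<beta>_def)
  define cell :: "real \<Rightarrow> int" where "cell t = \<lfloor>t / (s/2)\<rfloor>" for t
  define g where "g i = exp (- \<beta> * (real_of_int (max i (- i - 1)))\<^sup>2)" for i
  define c where "c p = (cell (fst p - fst x), cell (Re (snd p - snd x)), cell (Im (snd p - snd x)))" for p
  have cell_close: "\<bar>t - u\<bar> < s/2" if "cell t = cell u" for t u
  proof -
    have "\<bar>X - Y\<bar> < 1" if "\<lfloor>X\<rfloor> = \<lfloor>Y\<rfloor>" for X Y :: real using that by linarith
    from this[OF that[unfolded cell_def]] have "\<bar>(t - u) / (s/2)\<bar> < 1"
      unfolding diff_divide_distrib .
    hence "t * 2 < s + u * 2 \<and> u * 2 < s + t * 2" using s by (simp add: abs_less_iff field_simps)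
    thus ?thesis by linarith
  qed
  have cell_g: "exp (- a * t\<^sup>2) \<le> g (cell t)" for t
  proof -
    define i where "i = cell t"
    have nn: "0 \<le> max i (- i - 1)" by linarith
    define y where "y = t / (s/2)"
    have "i = \<lfloor>y\<rfloor>" by (simp add: i_def cell_def y_def)
    hence "real_of_int (max i (- i - 1)) \<le> \<bar>y\<bar>" by (simp add: max_def) linarith
    hence "(real_of_int (max i (- i - 1)))\<^sup>2 \<le> \<bar>y\<bar>\<^sup>2"
      by (rule power_mono) (simp only: of_int_0_le_iff nn)
    hence "(real_of_int (max i (- i - 1)))\<^sup>2 \<le> (t / (s/2))\<^sup>2" unfolding power2_abs y_def .
    also have "\<dots> = 4 * t\<^sup>2 / s\<^sup>2" by (simp add: power_divide)
    finally have "\<beta> * (real_of_int (max i (- i - 1)))\<^sup>2 \<le> \<beta> * (4 * t\<^sup>2 / s\<^sup>2)"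
      using \<beta> by (intro mult_left_mono) (simp_all only: less_imp_le)
    also have "\<beta> * (4 * t\<^sup>2 / s\<^sup>2) = a * t\<^sup>2" unfolding \<beta>_def using s by simp
    finally show ?thesis unfolding g_def i_def[symmetric]
      by (simp only: exp_le_cancel_iff minus_mult_left[symmetric] neg_le_iff_le)
  qed
  have dist_sq: "(dist p q)\<^sup>2 = (fst p - fst q)\<^sup>2 + (Re (snd p - snd q))\<^sup>2 + (Im (snd p - snd q))\<^sup>2"
    for p q :: "real \<times> complex"
    by (simp add: dist_prod_def dist_norm cmod_power2)
  have inj: "inj_on c P"
  proof (rule inj_onI, rule ccontr)
    fix p q assume p: "p \<in> P" and q: "q \<in> P" and eq: "c p = c q" and ne: "p \<noteq> q"
    have "\<bar>fst p - fst q\<bar> < s/2" "\<bar>Re (snd p - snd q)\<bar> < s/2" "\<bar>Im (snd p - snd q)\<bar> < s/2"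
      using eq cell_close[of "fst p - fst x" "fst q - fst x"]
        cell_close[of "Re (snd p - snd x)" "Re (snd q - snd x)"]
        cell_close[of "Im (snd p - snd x)" "Im (snd q - snd x)"] unfolding c_def by simp_all
    moreover have sq: "u\<^sup>2 \<le> (s/2)\<^sup>2" if "\<bar>u\<bar> < s/2" for u
      using abs_le_square_iff[of u "s/2"] that s by linarith
    ultimately have "(fst p - fst q)\<^sup>2 \<le> (s/2)\<^sup>2" "(Re (snd p - snd q))\<^sup>2 \<le> (s/2)\<^sup>2"
      "(Im (snd p - snd q))\<^sup>2 \<le> (s/2)\<^sup>2" by (intro sq; blast)+
    hence "(dist p q)\<^sup>2 \<le> 3 * (s/2)\<^sup>2" unfolding dist_sq by simp
    also have "\<dots> < s\<^sup>2" using s by (simp add: power2_eq_square)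
    finally have "dist p q < s" using s by (simp add: power2_less_imp_less)
    thus False using sep[OF p q ne] by simp
  qed
  have cell_term: "exp (- a * (dist x p)\<^sup>2) \<le> (\<lambda>(i,j,k). g i * (g j * g k)) (c p)" for p
  proof -
    have "exp (- a * (dist x p)\<^sup>2) = exp (- a * (fst p - fst x)\<^sup>2) *
       (exp (- a * (Re (snd p - snd x))\<^sup>2) * exp (- a * (Im (snd p - snd x))\<^sup>2))"
      unfolding dist_commute[of x p] dist_sq exp_add[symmetric] by (simp add: algebra_simps)
    also have "\<dots> \<le> g (cell (fst p - fst x)) * (g (cell (Re (snd p - snd x))) * g (cell (Im (snd p - snd x))))"
      by (intro mult_mono cell_g) (auto simp: g_def)
    finally show ?thesis by (simp add: c_def)
  qed
  obtain n where n: "\<forall>z\<in>c ` P. \<bar>fst z\<bar> < int n \<and> \<bar>fst (snd z)\<bar> < int n \<and> \<bar>snd (snd z)\<bar> < int n"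
  proof -
    define B where "B = (\<Sum>z\<in>c ` P. \<bar>fst z\<bar> + \<bar>fst (snd z)\<bar> + \<bar>snd (snd z)\<bar>) + 1"
    have "\<bar>fst z\<bar> + \<bar>fst (snd z)\<bar> + \<bar>snd (snd z)\<bar> < B" if "z \<in> c ` P" for z
      using member_le_sum[OF that, of "\<lambda>z. \<bar>fst z\<bar> + \<bar>fst (snd z)\<bar> + \<bar>snd (snd z)\<bar>"] fin
      unfolding B_def by simp
    note sumB = this
    have B: "\<bar>fst z\<bar> < B \<and> \<bar>fst (snd z)\<bar> < B \<and> \<bar>snd (snd z)\<bar> < B" if "z \<in> c ` P" for z
    proof -
      have "\<bar>fst z\<bar> + \<bar>fst (snd z)\<bar> + \<bar>snd (snd z)\<bar> < B" using sumB[OF that] .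
      thus ?thesis by linarith
    qed
    have "0 \<le> B" unfolding B_def by (intro add_nonneg_nonneg sum_nonneg) auto
    hence "\<forall>z\<in>c ` P. \<bar>fst z\<bar> < int (nat B) \<and> \<bar>fst (snd z)\<bar> < int (nat B) \<and> \<bar>snd (snd z)\<bar> < int (nat B)"
      using B by simp
    thus ?thesis by (rule that)
  qed
  define I where "I = {- int n..<int n}"
  have sub: "c ` P \<subseteq> I \<times> (I \<times> I)"
  proof
    fix z assume "z \<in> c ` P"
    hence "\<bar>fst z\<bar> < int n" "\<bar>fst (snd z)\<bar> < int n" "\<bar>snd (snd z)\<bar> < int n" using n by auto
    thus "z \<in> I \<times> (I \<times> I)" unfolding I_def by (cases z) auto
  qed
  have "(\<Sum>p\<in>P. exp (- a * (dist x p)\<^sup>2)) \<le> (\<Sum>p\<in>P. (\<lambda>(i,j,k). g i * (g j * g k)) (c p))"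
    by (intro sum_mono cell_term)
  also have "\<dots> = (\<Sum>z\<in>c ` P. (\<lambda>(i,j,k). g i * (g j * g k)) z)" using inj by (simp add: sum.reindex)
  also have "\<dots> \<le> (\<Sum>z\<in>I \<times> (I \<times> I). (\<lambda>(i,j,k). g i * (g j * g k)) z)"
    by (rule sum_mono2) (use sub in \<open>auto simp: I_def g_def\<close>)
  also have "\<dots> = (\<Sum>i\<in>I. g i) ^ 3"
  proof -
    have "(\<Sum>z\<in>I \<times> (I \<times> I). (\<lambda>(i,j,k). g i * (g j * g k)) z) = (\<Sum>i\<in>I. \<Sum>j\<in>I. \<Sum>k\<in>I. g i * (g j * g k))"
      unfolding sum.cartesian_product by (simp add: split_def)
    also have "\<dots> = (\<Sum>i\<in>I. g i) * ((\<Sum>i\<in>I. g i) * (\<Sum>i\<in>I. g i))"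
      unfolding sum_distrib_left[symmetric] sum_distrib_right[symmetric] ..
    finally show ?thesis by (simp add: power3_eq_cube)
  qed
  also have "\<dots> \<le> (2 / (1 - exp (- \<beta>))) ^ 3"
    using exp_square_sum_int[OF \<beta>, of n] unfolding I_def g_def by (intro power_mono) (auto intro: sum_nonneg)
  finally show ?thesis unfolding \<beta>_def .
qed

text \<open>A separated subset of largest cardinality is a net, since a point far from all of it
  could be added. Cardinalities are bounded because each ball of radius \<open>e/2\<close> in a
  finite cover contains at most one point of a separated set.\<close>

lemma separated_net:
  fixes X :: "'a::metric_space set"
  assumes "compact X" "e > 0"
  obtains P where "finite P" "P \<subseteq> X" "\<And>p q. p \<in> P \<Longrightarrow> q \<in> P \<Longrightarrow> p \<noteq> q \<Longrightarrow> e \<le> dist p q"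
    "\<And>x. x \<in> X \<Longrightarrow> \<exists>p\<in>P. dist x p < e"
proof -
  define sep where "sep P \<longleftrightarrow> P \<subseteq> X \<and> (\<forall>p\<in>P. \<forall>q\<in>P. p \<noteq> q \<longrightarrow> e \<le> dist p q)" for P
  obtain K where K: "finite K" "K \<subseteq> X" "X \<subseteq> (\<Union>x\<in>K. ball x (e/2))"
    using seq_compact_imp_totally_bounded[of X] assms half_gt_zero[OF assms(2)]
    unfolding compact_eq_seq_compact_metric by blast
  have bound: "finite P \<and> card P \<le> card K" if "sep P" for P
  proof -
    have "\<exists>k\<in>K. dist k p < e/2" if "p \<in> P" for p
    proof -
      have "p \<in> (\<Union>x\<in>K. ball x (e/2))" using K(3) \<open>sep P\<close> that unfolding sep_def by blast
      thus ?thesis by auto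
    qed
    then obtain h where h: "\<And>p. p \<in> P \<Longrightarrow> h p \<in> K \<and> dist (h p) p < e/2" by metis
    have "inj_on h P"
    proof (rule inj_onI, rule ccontr)
      fix p q assume "p \<in> P" "q \<in> P" "h p = h q" "p \<noteq> q"
      hence "dist p q < e" using h[of p] h[of q] dist_triangle_half_r[of "h p" p e q] by simp
      moreover have "e \<le> dist p q"
        using \<open>sep P\<close> \<open>p \<in> P\<close> \<open>q \<in> P\<close> \<open>p \<noteq> q\<close> unfolding sep_def by blast
      ultimately show False by simp
    qed
    moreover have "h ` P \<subseteq> K" using h by blast
    ultimately show ?thesis using K(1) card_inj_on_le inj_on_finite by blast
  qed
  have "sep {}" by (simp add: sep_def)
  moreover have "\<forall>Q. sep Q \<longrightarrow> card Q < Suc (card K)" using bound less_Suc_eq_le by blast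
  ultimately have "\<exists>P. sep P \<and> (\<forall>Q. sep Q \<longrightarrow> card Q \<le> card P)"
    by (rule ex_has_greatest_nat)
  then obtain P where P: "sep P" "\<And>Q. sep Q \<Longrightarrow> card Q \<le> card P" by blast
  have "\<exists>p\<in>P. dist x p < e" if x: "x \<in> X" for x
  proof (rule ccontr)
    assume *: "\<not> (\<exists>p\<in>P. dist x p < e)"
    hence "x \<notin> P" using assms(2) by auto
    have "sep (insert x P)" using P(1) x * unfolding sep_def
      by (auto simp: dist_commute not_less)
    from P(2)[OF this] bound[OF P(1)] \<open>x \<notin> P\<close> show False by simp
  qed
  moreover have "P \<subseteq> X" "\<And>p q. p \<in> P \<Longrightarrow> q \<in> P \<Longrightarrow> p \<noteq> q \<Longrightarrow> e \<le> dist p q"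
    using P(1) unfolding sep_def by blast+
  moreover have "finite P" using bound[OF P(1)] ..
  ultimately show ?thesis using that[of P] by simp
qed

text \<open>The net is chosen on the Hopf sphere, with one representative on each circle above it,
  so separation and mesh refer to circles and not to points. The Gaussian bound is also given for
  subsets, because later sums run over parts of the net.\<close>

lemma sphere_net:
  assumes "s > 0"
  obtains P where "finite P" "P \<subseteq> S2"
    "\<And>p q. p \<in> P \<Longrightarrow> q \<in> P \<Longrightarrow> p \<noteq> q \<Longrightarrow> s \<le> dist (hopf p) (hopf q)"
    "\<And>z. z \<in> S2 \<Longrightarrow> \<exists>p\<in>P. dist (hopf z) (hopf p) < s"
    "\<And>z a. a > 0 \<Longrightarrow> (\<Sum>p\<in>P. exp (- a * (dist (hopf z) (hopf p))\<^sup>2)) \<le> (2 / (1 - exp (- (a * s\<^sup>2 / 4)))) ^ 3"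
    "\<And>z a Q. a > 0 \<Longrightarrow> Q \<subseteq> P \<Longrightarrow> (\<Sum>p\<in>Q. exp (- a * (dist (hopf z) (hopf p))\<^sup>2)) \<le> (2 / (1 - exp (- (a * s\<^sup>2 / 4)))) ^ 3"
proof -
  have "compact (hopf ` S2)" by (intro compact_continuous_image continuous_on_hopf) simp
  then obtain P0 where P0: "finite P0" "P0 \<subseteq> hopf ` S2"
    "\<And>p q. p \<in> P0 \<Longrightarrow> q \<in> P0 \<Longrightarrow> p \<noteq> q \<Longrightarrow> s \<le> dist p q"
    "\<And>x. x \<in> hopf ` S2 \<Longrightarrow> \<exists>p\<in>P0. dist x p < s"
    by (rule separated_net[OF _ assms]) simp
  obtain P where P: "P \<subseteq> S2" "inj_on hopf P" "P0 = hopf ` P"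
    using subset_image_inj[THEN iffD1, OF P0(2)] by blast
  have fin: "finite P" using P P0(1) by (simp add: finite_image_iff)
  have g: "(\<Sum>p\<in>Q. exp (- a * (dist (hopf z) (hopf p))\<^sup>2)) \<le> (2 / (1 - exp (- (a * s\<^sup>2 / 4)))) ^ 3"
    if "a > 0" "Q \<subseteq> P" for z a Q
  proof -
    have "inj_on hopf Q" using P that inj_on_subset by blast
    moreover have "(\<Sum>p\<in>hopf ` Q. exp (- a * (dist (hopf z) p)\<^sup>2)) \<le> (2 / (1 - exp (- (a * s\<^sup>2 / 4)))) ^ 3"
    proof (rule separated_gaussian_sum[OF _ assms that(1)])
      show "finite (hopf ` Q)" using that(2) fin finite_subset by blast
      show "s \<le> dist p q" if "p \<in> hopf ` Q" "q \<in> hopf ` Q" "p \<noteq> q" for p q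
        using that \<open>Q \<subseteq> P\<close> P(3) by (intro P0(3)) blast+
    qed
    ultimately show ?thesis by (simp add: sum.reindex)
  qed
  show ?thesis
  proof (rule that[of P])
    show "s \<le> dist (hopf p) (hopf q)" if "p \<in> P" "q \<in> P" "p \<noteq> q" for p q
      using that P inj_onD[OF P(2)] by (intro P0(3)) blast+
    show "\<exists>p\<in>P. dist (hopf z) (hopf p) < s" if "z \<in> S2" for z
      using P0(4)[of "hopf z"] that P(3) by blast
    show "(\<Sum>p\<in>P. exp (- a * (dist (hopf z) (hopf p))\<^sup>2)) \<le> (2 / (1 - exp (- (a * s\<^sup>2 / 4)))) ^ 3"
      if "a > 0" for z a using g[OF that subset_refl] .
  qed (fact fin P(1) g)+
qed

text \<open>On |u| = 1 the conjugate of \<open>u\<close> is its inverse, so a real polynomial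
  restricted to the circle is a Laurent polynomial in \<open>u\<close>, and a power of
  \<open>u\<close> clears the denominators. The order of quantifiers matters: \<open>m\<close>, the
  degree bound \<open>n\<close> and the coefficient bound \<open>K\<close> serve all centres
  \<open>\<zeta>\<close> at once.\<close>

lemma circle_restriction_poly:
  assumes "real_polynomial_function (P :: C2 \<Rightarrow> real)"
  shows "\<exists>m n K. \<forall>\<zeta>\<in>S2. \<exists>p::complex poly. degree p \<le> n \<and> (\<forall>i. cmod (coeff p i) \<le> K) \<and>
      (\<forall>u. cmod u = 1 \<longrightarrow> u ^ m * of_real (P (u *s \<zeta>)) = poly p u)"
  using assms
proof (induction P rule: real_polynomial_function.induct)
  case (linear L)
  interpret L: bounded_linear L by fact
  obtain B where B: "\<And>x. norm (L x) \<le> norm x * B" using L.bounded by blast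
  show ?case
  proof (rule exI, rule exI, rule exI, rule ballI)
    fix \<zeta> :: C2 assume \<zeta>: "\<zeta> \<in> S2"
    define X where "X = L \<zeta>"
    define Y where "Y = L (\<i> *s \<zeta>)"
    \<comment> \<open>By real linearity \<open>L (u *s \<zeta>)\<close> is
      \<open>Re u * X + Im u * Y\<close>, which is half of
      \<open>u * (X - \<i> * Y) + cnj u * (X + \<i> * Y)\<close>; multiplied by \<open>u\<close> on
      the unit circle this becomes the quadratic polynomial \<open>p\<close>.\<close>
    define p where "p = [: Complex (X/2) (Y/2), 0, Complex (X/2) (- Y/2) :]"
    have XY: "\<bar>X\<bar> \<le> B" "\<bar>Y\<bar> \<le> B"
      using B[of \<zeta>] B[of "\<i> *s \<zeta>"] \<zeta> unfolding X_def Y_def by (simp_all add: norm_vector_smult)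
    have c: "cmod (Complex (X/2) (Y/2)) \<le> B" "cmod (Complex (X/2) (- Y/2)) \<le> B"
      using cmod_le[of "Complex (X/2) (Y/2)"] cmod_le[of "Complex (X/2) (- Y/2)"] XY by auto
    have "cmod (coeff p i) \<le> B" for i
      unfolding p_def using c XY by (auto simp: coeff_pCons split: nat.split)
    moreover have "u ^ 1 * of_real (L (u *s \<zeta>)) = poly p u" if u: "cmod u = 1" for u
    proof -
      have "u *s \<zeta> = Re u *\<^sub>R \<zeta> + Im u *\<^sub>R (\<i> *s \<zeta>)"
        by (simp add: vec_eq_iff complex_eq_iff)
      hence "L (u *s \<zeta>) = Re u * X + Im u * Y" by (simp add: L.add L.scaleR X_def Y_def)
      moreover have "(Re u)\<^sup>2 = 1 - (Im u)\<^sup>2" using u by (simp add: cmod_def algebra_simps)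
      moreover have "c * (Im u * (Im u * 2)) + c * (Re u * (Re u * 2)) = c * 2 * ((Re u)\<^sup>2 + (Im u)\<^sup>2)" for c :: real
        by (simp add: power2_eq_square algebra_simps)
      ultimately show ?thesis
        unfolding p_def by (simp add: complex_eq_iff algebra_simps power2_eq_square) (simp add: field_simps)
    qed
    ultimately show "\<exists>p. degree p \<le> 2 \<and> (\<forall>i. cmod (coeff p i) \<le> B) \<and>
      (\<forall>u. cmod u = 1 \<longrightarrow> u ^ 1 * of_real (L (u *s \<zeta>)) = poly p u)"
      by (intro exI[of _ p]) (auto simp: p_def)
  qed
next
  case (const c)
  show ?case
    by (rule exI[of _ 0], rule exI[of _ 0], rule exI[of _ "\<bar>c\<bar>"], intro ballI, rule exI[of _ "[:of_real c:]"])
      (auto simp: coeff_pCons split: nat.split)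
next
  case (add f g)
  from add.IH(1) obtain m1 n1 K1 where
    f: "\<forall>\<zeta>\<in>S2. \<exists>p::complex poly. degree p \<le> n1 \<and> (\<forall>i. cmod (coeff p i) \<le> K1) \<and>
      (\<forall>u. cmod u = 1 \<longrightarrow> u ^ m1 * of_real (f (u *s \<zeta>)) = poly p u)" by (elim exE)
  from add.IH(2) obtain m2 n2 K2 where
    g: "\<forall>\<zeta>\<in>S2. \<exists>p::complex poly. degree p \<le> n2 \<and> (\<forall>i. cmod (coeff p i) \<le> K2) \<and>
      (\<forall>u. cmod u = 1 \<longrightarrow> u ^ m2 * of_real (g (u *s \<zeta>)) = poly p u)" by (elim exE)
  show ?case
  proof (rule exI, rule exI, rule exI, rule ballI)
    fix \<zeta> :: C2 assume \<zeta>: "\<zeta> \<in> S2"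
    obtain p where p: "degree p \<le> n1" "\<And>i. cmod (coeff p i) \<le> K1"
      "\<And>u. cmod u = 1 \<Longrightarrow> u ^ m1 * of_real (f (u *s \<zeta>)) = poly p u" using bspec[OF f \<zeta>] by blast
    obtain q where q: "degree q \<le> n2" "\<And>i. cmod (coeff q i) \<le> K2"
      "\<And>u. cmod u = 1 \<Longrightarrow> u ^ m2 * of_real (g (u *s \<zeta>)) = poly q u" using bspec[OF g \<zeta>] by blast
    define r where "r = monom 1 m2 * p + monom 1 m1 * q"
    have K: "0 \<le> K1" "0 \<le> K2" using order_trans[OF norm_ge_zero p(2)] order_trans[OF norm_ge_zero q(2)] by blast+
    have d1: "degree (monom 1 m2 * p) \<le> m2 + n1"
      by (rule order_trans[OF degree_mult_le]) (use p(1) degree_monom_le[of "1::complex" m2] in linarith)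
    have d2: "degree (monom 1 m1 * q) \<le> m1 + n2"
      by (rule order_trans[OF degree_mult_le]) (use q(1) degree_monom_le[of "1::complex" m1] in linarith)
    have "degree r \<le> m1 + m2 + n1 + n2" unfolding r_def by (rule degree_add_le) (use d1 d2 in linarith)+
    moreover have "cmod (coeff r i) \<le> K1 + K2" for i
      unfolding r_def coeff_add by (rule norm_triangle_le, rule add_mono) (use p q K in \<open>auto simp: coeff_monom_mult\<close>)
    moreover have "u ^ (m1 + m2) * of_real (f (u *s \<zeta>) + g (u *s \<zeta>)) = poly r u" if "cmod u = 1" for u
      using p(3)[OF that] q(3)[OF that] unfolding r_def
      by (simp add: poly_monom power_add algebra_simps)
    ultimately show "\<exists>r. degree r \<le> m1 + m2 + n1 + n2 \<and> (\<forall>i. cmod (coeff r i) \<le> K1 + K2) \<and>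
      (\<forall>u. cmod u = 1 \<longrightarrow> u ^ (m1 + m2) * of_real (f (u *s \<zeta>) + g (u *s \<zeta>)) = poly r u)" by blast
  qed
next
  case (mult f g)
  from mult.IH(1) obtain m1 n1 K1 where
    f: "\<forall>\<zeta>\<in>S2. \<exists>p::complex poly. degree p \<le> n1 \<and> (\<forall>i. cmod (coeff p i) \<le> K1) \<and>
      (\<forall>u. cmod u = 1 \<longrightarrow> u ^ m1 * of_real (f (u *s \<zeta>)) = poly p u)" by (elim exE)
  from mult.IH(2) obtain m2 n2 K2 where
    g: "\<forall>\<zeta>\<in>S2. \<exists>p::complex poly. degree p \<le> n2 \<and> (\<forall>i. cmod (coeff p i) \<le> K2) \<and>
      (\<forall>u. cmod u = 1 \<longrightarrow> u ^ m2 * of_real (g (u *s \<zeta>)) = poly p u)" by (elim exE)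
  show ?case
  proof (rule exI, rule exI, rule exI, rule ballI)
    fix \<zeta> :: C2 assume \<zeta>: "\<zeta> \<in> S2"
    obtain p where p: "degree p \<le> n1" "\<And>i. cmod (coeff p i) \<le> K1"
      "\<And>u. cmod u = 1 \<Longrightarrow> u ^ m1 * of_real (f (u *s \<zeta>)) = poly p u" using bspec[OF f \<zeta>] by blast
    obtain q where q: "degree q \<le> n2" "\<And>i. cmod (coeff q i) \<le> K2"
      "\<And>u. cmod u = 1 \<Longrightarrow> u ^ m2 * of_real (g (u *s \<zeta>)) = poly q u" using bspec[OF g \<zeta>] by blast
    have K: "0 \<le> K1" "0 \<le> K2" using order_trans[OF norm_ge_zero p(2)] order_trans[OF norm_ge_zero q(2)] by blast+
    have d: "degree (p * q) \<le> n1 + n2" using order_trans[OF degree_mult_le] p(1) q(1) by (meson add_mono)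
    moreover have "cmod (coeff (p * q) i) \<le> real (n1 + n2 + 1) * (K1 * K2)" for i
    proof (cases "i \<le> n1 + n2")
      case True
      have "cmod (coeff (p * q) i) \<le> (\<Sum>j\<le>i. cmod (coeff p j * coeff q (i - j)))"
        unfolding coeff_mult by (rule norm_sum)
      also have "\<dots> \<le> (\<Sum>j\<le>i. K1 * K2)"
        unfolding norm_mult by (intro sum_mono mult_mono p q K) auto
      also have "\<dots> = real (i + 1) * (K1 * K2)" by simp
      also have "\<dots> \<le> real (n1 + n2 + 1) * (K1 * K2)" using True K by (intro mult_right_mono) auto
      finally show ?thesis .
    next
      case False
      hence "coeff (p * q) i = 0" using d by (intro coeff_eq_0) linarith
      thus ?thesis using K by simp
    qed
    moreover have "u ^ (m1 + m2) * of_real (f (u *s \<zeta>) * g (u *s \<zeta>)) = poly (p * q) u" if "cmod u = 1" for u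
      using p(3)[OF that] q(3)[OF that] by (simp add: power_add algebra_simps)
    ultimately show "\<exists>r. degree r \<le> n1 + n2 \<and> (\<forall>i. cmod (coeff r i) \<le> real (n1 + n2 + 1) * (K1 * K2)) \<and>
      (\<forall>u. cmod u = 1 \<longrightarrow> u ^ (m1 + m2) * of_real (f (u *s \<zeta>) * g (u *s \<zeta>)) = poly r u)" by blast
  qed
qed

lemma poly_sum_atMost:
  fixes p :: "'a::comm_ring_1 poly"
  assumes "degree p \<le> n"
  shows "poly p x = (\<Sum>i\<le>n. coeff p i * x ^ i)"
  unfolding poly_altdef using assms by (intro sum.mono_neutral_left) (auto simp: coeff_eq_0)

text \<open>Long intervals can be found arbitrarily far out: an interval of N + n + 1 natural
  numbers in \<open>E\<close>, stripped of its first N members, starts at N or later and still has n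
  + 1 members.\<close>

lemma LI_set_interval:
  assumes "LI_set E"
  obtains k where "k \<ge> N" "\<And>i. i \<le> n \<Longrightarrow> k + i \<in> E"
proof -
  obtain a :: "nat \<Rightarrow> int" where a: "\<And>m j. m \<ge> 1 \<Longrightarrow> j \<in> {1..m} \<Longrightarrow> a m + int j \<in> int ` E"
    using assms unfolding LI_set_def by blast
  define m where "m = N + n + 1"
  have "a m + int 1 \<in> int ` E" by (rule a) (auto simp: m_def)
  hence a0: "a m + 1 \<ge> 0" by auto
  define k where "k = nat (a m + 1 + int N)"
  have k: "int k = a m + 1 + int N" using a0 by (simp add: k_def)
  have "k + i \<in> E" if "i \<le> n" for i
  proof -
    have "a m + int (N + i + 1) \<in> int ` E" by (rule a) (use that in \<open>auto simp: m_def\<close>)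
    moreover have "a m + int (N + i + 1) = int (k + i)" using k by simp
    ultimately show ?thesis by (metis imageE of_nat_eq_iff)
  qed
  moreover have "k \<ge> N" using k a0 by linarith
  ultimately show ?thesis using that by blast
qed

lemma one_minus_power_le:
  fixes \<rho> :: real
  assumes "0 \<le> \<rho>" "\<rho> \<le> 1"
  shows "1 - \<rho> ^ i \<le> real i * (1 - \<rho>)"
  using Bernoulli_inequality[of "\<rho> - 1" i] assms by (simp add: algebra_simps)

text \<open>On the sphere, the peak function \<open>hip z \<zeta> ^ k\<close> times a polynomial that reproduces \<open>\<psi>\<close> on
  the circle through \<open>\<zeta>\<close> has modulus close to \<open>\<bar>hip z \<zeta>\<bar> ^ k * \<psi> z\<close>.\<close>

lemma peak_approx:
  fixes \<psi> :: "C2 \<Rightarrow> real" and p :: "complex poly"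
  assumes z: "z \<in> S2" and \<zeta>: "\<zeta> \<in> S2"
    and p: "degree p \<le> n" "\<And>i. cmod (coeff p i) \<le> K"
    and pP: "\<And>u. cmod u = 1 \<Longrightarrow> u ^ m * of_real (P (u *s \<zeta>)) = poly p u"
    and P: "\<And>w. w \<in> S2 \<Longrightarrow> \<bar>\<psi> w - P w\<bar> \<le> e"
    and uc: "\<And>v w. v \<in> S2 \<Longrightarrow> w \<in> S2 \<Longrightarrow> norm (v - w) < t \<Longrightarrow> \<bar>\<psi> v - \<psi> w\<bar> \<le> e"
    and B: "\<And>w. w \<in> S2 \<Longrightarrow> \<bar>\<psi> w\<bar> \<le> B" and t: "t > 0" and e: "e \<ge> 0"
  obtains v where "cmod v = 1"
    "cmod (hip z \<zeta> ^ k * poly p (hip z \<zeta>) - of_real (cmod (hip z \<zeta>) ^ k) * v * of_real (\<psi> z))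
      \<le> cmod (hip z \<zeta>) ^ k * (2 * e + (K * (real n + 1)\<^sup>2 / 4 + 2 * B / t\<^sup>2) * (dist (hopf z) (hopf \<zeta>))\<^sup>2)"
proof -
  define \<rho> where "\<rho> = cmod (hip z \<zeta>)"
  define D where "D = dist (hopf z) (hopf \<zeta>)"
  obtain u where u: "cmod u = 1" "hip z \<zeta> = of_real \<rho> * u" "norm (z - u *s \<zeta>) \<le> D"
    using phase_align[OF z \<zeta>] unfolding \<rho>_def D_def by metis
  have uz: "u *s \<zeta> \<in> S2" by (rule smult_sphere[OF u(1) \<zeta>])
  have \<rho>: "0 \<le> \<rho>" "\<rho> \<le> 1" unfolding \<rho>_def using hip_le_1[OF z \<zeta>] by auto
  have K0: "0 \<le> K" using order_trans[OF norm_ge_zero p(2)] .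
  have B0: "0 \<le> B" using order_trans[OF abs_ge_zero B[OF z]] .
  have "\<rho>\<^sup>2 \<le> \<rho>" using \<rho> by (simp add: power2_eq_square mult_left_le)
  moreover have "\<rho>\<^sup>2 = 1 - D\<^sup>2 / 4" unfolding \<rho>_def D_def by (rule hopf_dist_sq[OF z \<zeta>])
  ultimately have \<rho>D: "1 - \<rho> \<le> D\<^sup>2 / 4" by linarith
  \<comment> \<open>The price for moving the argument \<open>\<rho> * u\<close> of \<open>p\<close>
    to the unit circle: each power changes by at most \<open>real i * (1 - \<rho>)\<close>, and
    \<open>1 - \<rho>\<close> is quadratic in \<open>D\<close>.\<close>
  have 1: "cmod (poly p (hip z \<zeta>) - poly p u) \<le> K * (real n + 1)\<^sup>2 / 4 * D\<^sup>2"
  proof -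
    have "cmod (coeff p i * (hip z \<zeta> ^ i - u ^ i)) \<le> K * ((real n + 1) * (D\<^sup>2 / 4))" if "i \<le> n" for i
    proof -
      have "hip z \<zeta> ^ i - u ^ i = of_real (\<rho> ^ i - 1) * u ^ i" unfolding u(2) by (simp add: power_mult_distrib algebra_simps)
      hence "cmod (hip z \<zeta> ^ i - u ^ i) = \<bar>\<rho> ^ i - 1\<bar>" using u(1) by (simp add: norm_mult norm_power del: of_real_diff)
      also have "\<dots> = 1 - \<rho> ^ i" using \<rho> by (simp add: power_le_one)
      also have "\<dots> \<le> real i * (1 - \<rho>)" by (rule one_minus_power_le[OF \<rho>])
      also have "\<dots> \<le> (real n + 1) * (D\<^sup>2 / 4)" using that \<rho> \<rho>D by (intro mult_mono) auto
      finally show ?thesis unfolding norm_mult using p(2)[of i] K0 by (intro mult_mono) auto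
    qed
    hence "cmod (\<Sum>i\<le>n. coeff p i * (hip z \<zeta> ^ i - u ^ i)) \<le> (\<Sum>i\<le>n. K * ((real n + 1) * (D\<^sup>2 / 4)))"
      by (intro sum_norm_le) auto
    also have "\<dots> = K * (real n + 1)\<^sup>2 / 4 * D\<^sup>2" by (simp add: power2_eq_square algebra_simps)
    finally show ?thesis
      unfolding poly_sum_atMost[OF p(1)] by (simp add: sum_subtractf[symmetric] right_diff_distrib)
  qed
  have 2: "\<bar>P (u *s \<zeta>) - \<psi> (u *s \<zeta>)\<bar> \<le> e" using P[OF uz] by linarith
  \<comment> \<open>Beyond distance \<open>t\<close> uniform continuity says nothing. There the
    trivial bound \<open>2 * B\<close> is multiplied by
    \<open>D\<^sup>2 / t\<^sup>2 \<ge> 1\<close>, so that this error is quadratic in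
    \<open>D\<close> as well.\<close>
  have 3: "\<bar>\<psi> (u *s \<zeta>) - \<psi> z\<bar> \<le> e + 2 * B / t\<^sup>2 * D\<^sup>2"
  proof (cases "norm (z - u *s \<zeta>) < t")
    case True
    have "0 \<le> 2 * B / t\<^sup>2 * D\<^sup>2" using B0 by simp
    thus ?thesis using uc[OF z uz True] by linarith
  next
    case False
    hence "t \<le> D" using u(3) by linarith
    hence "1 \<le> D\<^sup>2 / t\<^sup>2" using t by (simp add: le_divide_eq power_mono)
    hence "2 * B * 1 \<le> 2 * B * (D\<^sup>2 / t\<^sup>2)" using B0 by (intro mult_left_mono) auto
    thus ?thesis using B[OF z] B[OF uz] e by simp
  qed
  have "cmod (poly p (hip z \<zeta>) - u ^ m * of_real (\<psi> z)) \<le> cmod (poly p (hip z \<zeta>) - poly p u) + cmod (poly p u - u ^ m * of_real (\<psi> z))"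
    by (rule order_trans[OF _ norm_triangle_ineq]) simp
  also have "poly p u - u ^ m * of_real (\<psi> z) = u ^ m * of_real (P (u *s \<zeta>) - \<psi> z)"
    using pP[OF u(1)] by (simp add: algebra_simps)
  also have "cmod (u ^ m * of_real (P (u *s \<zeta>) - \<psi> z)) = \<bar>P (u *s \<zeta>) - \<psi> z\<bar>"
    using u(1) by (simp add: norm_mult norm_power del: of_real_diff)
  also have "cmod (poly p (hip z \<zeta>) - poly p u) + \<bar>P (u *s \<zeta>) - \<psi> z\<bar>
      \<le> 2 * e + (K * (real n + 1)\<^sup>2 / 4 + 2 * B / t\<^sup>2) * D\<^sup>2"
    using 1 2 3 unfolding distrib_right by linarith
  finally have main: "cmod (poly p (hip z \<zeta>) - u ^ m * of_real (\<psi> z)) \<le> 2 * e + (K * (real n + 1)\<^sup>2 / 4 + 2 * B / t\<^sup>2) * D\<^sup>2" .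
  have "hip z \<zeta> ^ k * poly p (hip z \<zeta>) - of_real (\<rho> ^ k) * (u ^ k * u ^ m) * of_real (\<psi> z)
      = of_real (\<rho> ^ k) * u ^ k * (poly p (hip z \<zeta>) - u ^ m * of_real (\<psi> z))"
    unfolding u(2) by (simp add: power_mult_distrib algebra_simps)
  hence "cmod (hip z \<zeta> ^ k * poly p (hip z \<zeta>) - of_real (\<rho> ^ k) * (u ^ k * u ^ m) * of_real (\<psi> z))
      = \<rho> ^ k * cmod (poly p (hip z \<zeta>) - u ^ m * of_real (\<psi> z))"
    using u(1) \<rho> by (simp add: norm_mult norm_power)
  also have "\<dots> \<le> \<rho> ^ k * (2 * e + (K * (real n + 1)\<^sup>2 / 4 + 2 * B / t\<^sup>2) * D\<^sup>2)"
    using main \<rho> by (intro mult_left_mono) auto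
  finally show ?thesis
    using u(1) by (intro that[of "u ^ k * u ^ m"]) (auto simp: norm_mult norm_power \<rho>_def D_def)
qed

text \<open>The inequality \<open>1 - x \<le> exp (- x)\<close> for the squared modulus: peaks are
  dominated by Gaussians of width of order \<open>1 / sqrt k\<close> in the Hopf distance.\<close>

lemma hip_power_le_exp:
  assumes "z \<in> S2" "w \<in> S2"
  shows "cmod (hip z w) ^ k \<le> exp (- (real k / 8) * (dist (hopf z) (hopf w))\<^sup>2)"
proof -
  define D where "D = dist (hopf z) (hopf w)"
  have "(cmod (hip z w))\<^sup>2 = 1 - D\<^sup>2 / 4" unfolding D_def by (rule hopf_dist_sq[OF assms])
  also have "\<dots> \<le> exp (- (D\<^sup>2 / 4))" using exp_ge_add_one_self[of "- (D\<^sup>2 / 4)"] by simp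
  also have "\<dots> = (exp (- (D\<^sup>2 / 8)))\<^sup>2" unfolding exp_of_nat_mult[symmetric] by simp
  finally have "cmod (hip z w) \<le> exp (- (D\<^sup>2 / 8))" by (rule power2_le_imp_le) simp
  hence "cmod (hip z w) ^ k \<le> exp (- (D\<^sup>2 / 8)) ^ k" by (intro power_mono) auto
  also have "\<dots> = exp (- (real k / 8) * D\<^sup>2)" unfolding exp_of_nat_mult[symmetric] by simp
  finally show ?thesis unfolding D_def .
qed

text \<open>The value 72 serves the peak estimates: it makes the Gaussian sum at most (144/71)^3 <
  9, and 9/72 = 1/8 will bound the contribution of the distant peaks.\<close>

lemma exp_five: "exp (5::real) \<ge> 72"
proof -
  have "(5/2 :: real) \<le> exp 1" using exp_lower_Taylor_quadratic[of "1::real"] by (simp add: power2_eq_square)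
  hence "(5/2 :: real) ^ 5 \<le> exp 1 ^ 5" by (intro power_mono) auto
  also have "exp 1 ^ 5 = exp (5::real)" unfolding exp_of_nat_mult[symmetric] by simp
  finally show ?thesis by (simp add: power_divide)
qed

section \<open>Caps around circles and nets of peaks\<close>

context sphere_measure
begin

definition cap :: "C2 \<Rightarrow> real \<Rightarrow> C2 set" where
  "cap \<zeta> s = {z \<in> S2. dist (hopf z) (hopf \<zeta>) < s}"

lemma cap_sets [measurable]: "cap \<zeta> s \<in> sets \<sigma>"
proof -
  have "open {z. dist (hopf z) (hopf \<zeta>) < s}"
    by (intro open_Collect_less continuous_intros continuous_on_hopf)
  moreover have "cap \<zeta> s = S2 \<inter> {z. dist (hopf z) (hopf \<zeta>) < s}" unfolding cap_def by blast
  ultimately show ?thesis unfolding in_sets_sigma by (auto intro!: borel_closed)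
qed

text \<open>A rotation taking the circle of \<open>p\<close> to that of \<open>q\<close> maps one
  cap onto the other and moves every point of the sphere by less than \<open>t\<close>. Under it
  \<open>\<psi>\<close> changes by at most \<open>\<mu>\<close>, hence at most doubles, because
  \<open>\<mu>\<close> is a lower bound of \<open>\<psi>\<close>; the factor 4 is the square of
  2.\<close>

lemma integral_cap_shift:
  fixes \<psi> :: "C2 \<Rightarrow> real"
  assumes q: "q \<in> S2" and p: "p \<in> S2" and d: "dist (hopf q) (hopf p) < s" and s: "s \<le> t"
    and cont: "continuous_on S2 \<psi>" and pos: "\<And>z. z \<in> S2 \<Longrightarrow> \<mu> \<le> \<psi> z" "\<mu> > 0"
    and uc: "\<And>v w. v \<in> S2 \<Longrightarrow> w \<in> S2 \<Longrightarrow> norm (v - w) < t \<Longrightarrow> \<bar>\<psi> v - \<psi> w\<bar> \<le> \<mu>"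
  shows "(\<integral>z. (\<psi> z)\<^sup>2 * indicator (cap q r) z \<partial>\<sigma>) \<le> 4 * (\<integral>z. (\<psi> z)\<^sup>2 * indicator (cap p r) z \<partial>\<sigma>)"
proof -
  obtain u where u: "cmod u = 1" "norm (q - u *s p) \<le> dist (hopf q) (hopf p)"
    using phase_align[OF q p] by metis
  have up: "u *s p \<in> S2" by (rule smult_sphere[OF u(1) p])
  obtain a b where ab: "(cmod a)\<^sup>2 + (cmod b)\<^sup>2 = 1" "rot a b (u *s p) = q"
    "\<And>x. norm (rot a b x - x) = norm (q - u *s p) * norm x"
    using rot_transitive[OF up q] by metis
  have i2: "integrable \<sigma> (\<lambda>z. (\<psi> z)\<^sup>2)" by (intro integrable_cont continuous_intros cont)
  have int: "integrable \<sigma> (\<lambda>z. (\<psi> z)\<^sup>2 * indicator (cap c r) z)" for c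
    by (rule integrable_real_mult_indicator[OF cap_sets i2])
  have le: "(\<psi> (rot a b z))\<^sup>2 * indicator (cap q r) (rot a b z) \<le> 4 * ((\<psi> z)\<^sup>2 * indicator (cap p r) z)" if z: "z \<in> S2" for z
  proof -
    have rz: "rot a b z \<in> S2" using z norm_rot[OF ab(1)] by simp
    have "dist (hopf (rot a b z)) (hopf q) = dist (hopf z) (hopf p)"
      using dist_hopf_rot[OF ab(1) z up] hopf_smult[OF u(1)] ab(2) by simp
    hence ind: "indicator (cap q r) (rot a b z) = (indicator (cap p r) z :: real)"
      using z rz by (simp add: cap_def indicator_def)
    have "norm (rot a b z - z) < t" using ab(3)[of z] z u(2) d s by simp
    hence "\<psi> (rot a b z) \<le> 2 * \<psi> z" "0 \<le> \<psi> (rot a b z)"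
      using uc[OF rz z] pos(1)[OF z] pos(1)[OF rz] pos(2) by linarith+
    hence "(\<psi> (rot a b z))\<^sup>2 \<le> (2 * \<psi> z)\<^sup>2" by (rule power_mono)
    thus ?thesis unfolding ind by (simp add: indicator_def)
  qed
  have "(\<integral>z. (\<psi> z)\<^sup>2 * indicator (cap q r) z \<partial>\<sigma>) = (\<integral>z. (\<psi> (rot a b z))\<^sup>2 * indicator (cap q r) (rot a b z) \<partial>\<sigma>)"
    using integral_orth[OF orth_rot[OF ab(1)] borel_measurable_integrable[OF int[of q]]] by simp
  also have "\<dots> \<le> (\<integral>z. 4 * ((\<psi> z)\<^sup>2 * indicator (cap p r) z) \<partial>\<sigma>)"
    by (rule integral_mono') (use le int in auto)
  finally show ?thesis by simp
qed

text \<open>A bound for the number of points of an \<open>s/12\<close>-separated net in a Hopf ball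
  of radius \<open>s\<close>: each contributes at least \<open>exp (- 1)\<close> to the Gaussian sum
  with \<open>a = 1 / s\<^sup>2\<close>, for which
  \<open>a * (s/12)\<^sup>2 / 4 = 1/576\<close>.\<close>

definition net_const :: real where
  "net_const = exp 1 * (2 / (1 - exp (- (1 / 576)))) ^ 3"

lemma net_const_pos: "net_const > 0"
  by (simp add: net_const_def)

text \<open>The small caps around \<open>P\<close> need not cover the sphere, but those around a
  finer net \<open>Q\<close> of mesh \<open>s/12\<close> do. Each point of \<open>Q\<close> is
  assigned to a point of \<open>P\<close> within \<open>s\<close>, at most \<open>net_const\<close>
  of them to the same one, and passing to the cap around the assigned point costs a factor
  4.\<close>

lemma integral_le_caps:
  fixes \<psi> :: "C2 \<Rightarrow> real"
  assumes s: "0 < s" "s \<le> t" and P: "finite P" "P \<subseteq> S2" "\<And>z. z \<in> S2 \<Longrightarrow> \<exists>p\<in>P. dist (hopf z) (hopf p) < s"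
    and cont: "continuous_on S2 \<psi>" and pos: "\<And>z. z \<in> S2 \<Longrightarrow> \<mu> \<le> \<psi> z" "\<mu> > 0"
    and uc: "\<And>v w. v \<in> S2 \<Longrightarrow> w \<in> S2 \<Longrightarrow> norm (v - w) < t \<Longrightarrow> \<bar>\<psi> v - \<psi> w\<bar> \<le> \<mu>"
  shows "(\<integral>z. (\<psi> z)\<^sup>2 \<partial>\<sigma>) \<le> 4 * net_const * (\<Sum>p\<in>P. \<integral>z. (\<psi> z)\<^sup>2 * indicator (cap p (s/12)) z \<partial>\<sigma>)"
proof -
  have s12: "s / 12 > 0" using s by simp
  obtain Q where Q: "finite Q" "Q \<subseteq> S2" "\<And>z. z \<in> S2 \<Longrightarrow> \<exists>q\<in>Q. dist (hopf z) (hopf q) < s/12"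
    "\<And>z a Q'. a > 0 \<Longrightarrow> Q' \<subseteq> Q \<Longrightarrow> (\<Sum>p\<in>Q'. exp (- a * (dist (hopf z) (hopf p))\<^sup>2)) \<le> (2 / (1 - exp (- (a * (s/12)\<^sup>2 / 4)))) ^ 3"
    by (rule sphere_net[OF s12]) blast
  define I where "I c = (\<integral>z. (\<psi> z)\<^sup>2 * indicator (cap c (s/12)) z \<partial>\<sigma>)" for c
  have i2: "integrable \<sigma> (\<lambda>z. (\<psi> z)\<^sup>2)" by (intro integrable_cont continuous_intros cont)
  have int: "integrable \<sigma> (\<lambda>z. (\<psi> z)\<^sup>2 * indicator (cap c (s/12)) z)" for c
    by (rule integrable_real_mult_indicator[OF cap_sets i2])
  have I0: "I c \<ge> 0" for c unfolding I_def by (rule Bochner_Integration.integral_nonneg) auto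
  obtain g where g: "\<And>q. q \<in> Q \<Longrightarrow> g q \<in> P \<and> dist (hopf q) (hopf (g q)) < s"
    using P(3) Q(2) by (metis subsetD)
  have count: "real (card {q \<in> Q. g q = p}) \<le> net_const" for p
  proof -
    define Q' where "Q' = {q \<in> Q. g q = p}"
    have a: "1 / s\<^sup>2 > 0" using s by simp
    have "exp (-1) \<le> exp (- (1/s\<^sup>2) * (dist (hopf p) (hopf q))\<^sup>2)" if "q \<in> Q'" for q
    proof -
      have "dist (hopf p) (hopf q) < s" using g[of q] that by (auto simp: Q'_def dist_commute)
      hence "(dist (hopf p) (hopf q))\<^sup>2 \<le> s\<^sup>2" by (intro power_mono) auto
      thus ?thesis using s by (simp add: divide_le_eq)
    qed
    hence "(\<Sum>q\<in>Q'. exp (-1)) \<le> (\<Sum>q\<in>Q'. exp (- (1/s\<^sup>2) * (dist (hopf p) (hopf q))\<^sup>2))" by (rule sum_mono)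
    also have "\<dots> \<le> (2 / (1 - exp (- (1/s\<^sup>2 * (s/12)\<^sup>2 / 4)))) ^ 3" by (rule Q(4)[OF a]) (auto simp: Q'_def)
    also have "1/s\<^sup>2 * (s/12)\<^sup>2 / 4 = 1 / 576" using s by (simp add: power2_eq_square)
    finally have "real (card Q') * exp (-1) \<le> (2 / (1 - exp (- (1 / 576)))) ^ 3" by simp
    hence "exp 1 * (real (card Q') * exp (-1)) \<le> net_const" unfolding net_const_def by (intro mult_left_mono) auto
    moreover have "exp 1 * (c * exp (-1)) = c" for c :: real by (simp add: exp_minus)
    ultimately show ?thesis unfolding Q'_def by simp
  qed
  have "(\<integral>z. (\<psi> z)\<^sup>2 \<partial>\<sigma>) \<le> (\<integral>z. (\<Sum>q\<in>Q. (\<psi> z)\<^sup>2 * indicator (cap q (s/12)) z) \<partial>\<sigma>)"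
  proof (rule integral_mono'[OF Bochner_Integration.integrable_sum[OF int]])
    fix z assume "z \<in> space \<sigma>"
    hence z: "z \<in> S2" by simp
    then obtain q where q: "q \<in> Q" "dist (hopf z) (hopf q) < s/12" using Q(3) by blast
    have "(\<psi> z)\<^sup>2 = (\<psi> z)\<^sup>2 * indicator (cap q (s/12)) z" using q z by (simp add: cap_def)
    also have "\<dots> \<le> (\<Sum>q\<in>Q. (\<psi> z)\<^sup>2 * indicator (cap q (s/12)) z)"
      by (rule member_le_sum[OF q(1)]) (use Q(1) in auto)
    finally show "(\<psi> z)\<^sup>2 \<le> (\<Sum>q\<in>Q. (\<psi> z)\<^sup>2 * indicator (cap q (s/12)) z)" .
  qed (auto intro: sum_nonneg)
  also have "\<dots> = (\<Sum>q\<in>Q. I q)" unfolding I_def by (rule Bochner_Integration.integral_sum[OF int])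
  also have "\<dots> \<le> (\<Sum>q\<in>Q. 4 * I (g q))"
  proof (rule sum_mono)
    fix q assume q: "q \<in> Q"
    show "I q \<le> 4 * I (g q)" unfolding I_def
      by (rule integral_cap_shift[OF _ _ _ s(2) cont pos uc]) (use q g[OF q] Q(2) P(2) in auto)
  qed
  also have "\<dots> = (\<Sum>p\<in>P. \<Sum>q\<in>{q \<in> Q. g q = p}. 4 * I (g q))"
    by (rule sum.group[symmetric]) (use Q(1) P(1) g in auto)
  also have "\<dots> = (\<Sum>p\<in>P. real (card {q \<in> Q. g q = p}) * (4 * I p))"
    by (intro sum.cong) auto
  also have "\<dots> \<le> (\<Sum>p\<in>P. net_const * (4 * I p))"
    by (intro sum_mono mult_right_mono count) (use I0 in auto)
  also have "\<dots> = 4 * net_const * (\<Sum>p\<in>P. I p)" by (simp add: sum_distrib_left sum_distrib_right algebra_simps)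
  finally show ?thesis unfolding I_def .
qed

text \<open>Sum of peak functions over a net of mesh \<open>s\<close>, \<open>s\<^sup>2 = 320 / k\<close>: the width of a peak is comparable
  with the mesh, so that the sum is bounded while the peaks still dominate the off-diagonal terms.\<close>

lemma peak_net:
  assumes k: "k \<ge> (1::nat)"
  obtains P where "finite P" "P \<subseteq> S2" "\<And>z. z \<in> S2 \<Longrightarrow> \<exists>p\<in>P. dist (hopf z) (hopf p) < sqrt (320 / k)"
    "\<And>z. z \<in> S2 \<Longrightarrow> (\<Sum>p\<in>P. cmod (hip z p) ^ k) \<le> 9"
    "\<And>z. z \<in> S2 \<Longrightarrow> (\<Sum>p\<in>P. cmod (hip z p) ^ k * (dist (hopf z) (hopf p))\<^sup>2) \<le> 144 / k"
    "\<And>z p. z \<in> S2 \<Longrightarrow> p \<in> P \<Longrightarrow> z \<in> cap p (sqrt (320 / k) / 12) \<Longrightarrow>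
        cmod (hip z p) ^ k \<ge> 1/2 \<and> (\<Sum>q\<in>P - {p}. cmod (hip z q) ^ k) \<le> 1/8"
    "\<And>p q z. p \<in> P \<Longrightarrow> q \<in> P \<Longrightarrow> z \<in> cap p (sqrt (320 / k) / 12) \<Longrightarrow> z \<in> cap q (sqrt (320 / k) / 12) \<Longrightarrow> p = q"
proof -
  define s where "s = sqrt (320 / k)"
  have s: "s > 0" "s\<^sup>2 = 320 / k" using k by (auto simp: s_def)
  define D where "D z p = dist (hopf z) (hopf p)" for z p
  obtain P where P: "finite P" "P \<subseteq> S2"
    "\<And>p q. p \<in> P \<Longrightarrow> q \<in> P \<Longrightarrow> p \<noteq> q \<Longrightarrow> s \<le> D p q"
    "\<And>z. z \<in> S2 \<Longrightarrow> \<exists>p\<in>P. D z p < s"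
    "\<And>z a Q. a > 0 \<Longrightarrow> Q \<subseteq> P \<Longrightarrow> (\<Sum>p\<in>Q. exp (- a * (D z p)\<^sup>2)) \<le> (2 / (1 - exp (- (a * s\<^sup>2 / 4)))) ^ 3"
    unfolding D_def by (rule sphere_net[OF s(1)]) blast
  \<comment> \<open>Half of the Gaussian exponent \<open>k/8\<close>. With 320 = 16 * 4 * 5 the
    number \<open>k/16 * s\<^sup>2 / 4\<close> is 5, which makes the sums of \<open>g\<close>
    bounded. The other half is spent on absorbing a factor \<open>D\<^sup>2\<close> or on making
    distant peaks small.\<close>
  define g where "g z p = exp (- (real k / 16) * (D z p)\<^sup>2)" for z p
  have g9: "(\<Sum>p\<in>Q. g z p) \<le> 9" if "Q \<subseteq> P" for Q z
  proof -
    have "(\<Sum>p\<in>Q. g z p) \<le> (2 / (1 - exp (- (real k / 16 * s\<^sup>2 / 4)))) ^ 3"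
      unfolding g_def by (rule P(5)) (use k that in auto)
    also have "real k / 16 * s\<^sup>2 / 4 = 5" using k s by simp
    also have "(2 / (1 - exp (- 5 :: real))) ^ 3 \<le> (2 / (1 - 1/72)) ^ 3"
      using exp_five by (intro power_mono divide_left_mono) (auto simp: exp_minus field_simps)
    also have "\<dots> \<le> 9" by (simp add: power_divide)
    finally show ?thesis .
  qed
  have hg: "cmod (hip z p) ^ k \<le> g z p * g z p" if "z \<in> S2" "p \<in> P" for z p
  proof -
    have "p \<in> S2" using that P by blast
    have "g z p * g z p = exp (- (real k / 8) * (D z p)\<^sup>2)" unfolding g_def exp_add[symmetric] by simp
    thus ?thesis using hip_power_le_exp[OF that(1) \<open>p \<in> S2\<close>, of k] unfolding D_def by simp
  qed
  have g1: "0 < g z p" "g z p \<le> 1" for z p unfolding g_def by auto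
  have hg1: "cmod (hip z p) ^ k \<le> g z p" if "z \<in> S2" "p \<in> P" for z p
    using hg[OF that] mult_left_le[OF g1(2)[of z p] less_imp_le[OF g1(1)[of z p]]] by linarith
  show ?thesis
  proof (rule that[of P])
    show "finite P" "P \<subseteq> S2" by fact+
    show "\<exists>p\<in>P. dist (hopf z) (hopf p) < sqrt (320 / k)" if "z \<in> S2" for z
      using P(4)[OF that] unfolding D_def s_def .
    show "(\<Sum>p\<in>P. cmod (hip z p) ^ k) \<le> 9" if "z \<in> S2" for z
      by (rule order_trans[OF sum_mono g9[OF subset_refl, of z]]) (rule hg1[OF that])
    show "(\<Sum>p\<in>P. cmod (hip z p) ^ k * (dist (hopf z) (hopf p))\<^sup>2) \<le> 144 / k" if z: "z \<in> S2" for z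
    proof -
      have "cmod (hip z p) ^ k * (D z p)\<^sup>2 \<le> 16 / k * g z p" if p: "p \<in> P" for p
      proof -
        \<comment> \<open>\<open>x * exp (- x) \<le> 1\<close> trades the factor
          \<open>D\<^sup>2\<close> for \<open>16 / k\<close> at the cost of one of the two Gaussian
          factors.\<close>
        define x where "x = real k / 16 * (D z p)\<^sup>2"
        have "x \<le> exp x" using exp_ge_add_one_self[of x] by linarith
        hence "x * exp (- x) \<le> exp x * exp (- x)" by (intro mult_right_mono) auto
        hence "x * g z p \<le> 1" unfolding g_def x_def exp_minus by (simp add: exp_minus)
        hence "16 / k * (x * g z p) \<le> 16 / k * 1" by (intro mult_left_mono) auto
        hence 1: "(D z p)\<^sup>2 * g z p \<le> 16 / k" unfolding x_def using k by simp
        have "cmod (hip z p) ^ k * (D z p)\<^sup>2 \<le> g z p * g z p * (D z p)\<^sup>2"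
          using hg[OF z p] by (intro mult_right_mono) auto
        also have "\<dots> = ((D z p)\<^sup>2 * g z p) * g z p" by simp
        also have "\<dots> \<le> 16 / k * g z p" using 1 g1(1)[of z p] by (intro mult_right_mono) auto
        finally show ?thesis .
      qed
      hence "(\<Sum>p\<in>P. cmod (hip z p) ^ k * (D z p)\<^sup>2) \<le> (\<Sum>p\<in>P. 16 / k * g z p)" by (rule sum_mono)
      also have "\<dots> = 16 / k * (\<Sum>p\<in>P. g z p)" by (simp add: sum_distrib_left)
      also have "\<dots> \<le> 16 / k * 9" using g9[OF subset_refl, of z] by (intro mult_left_mono) auto
      finally show ?thesis unfolding D_def by simp
    qed
    show "cmod (hip z p) ^ k \<ge> 1/2 \<and> (\<Sum>q\<in>P - {p}. cmod (hip z q) ^ k) \<le> 1/8"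
      if z: "z \<in> S2" and p: "p \<in> P" and c: "z \<in> cap p (sqrt (320 / k) / 12)" for z p
    proof
      have Dz: "D z p < s/12" using c unfolding cap_def D_def s_def by simp
      have pS: "p \<in> S2" using p P by blast
      have "(D z p)\<^sup>2 \<le> (s/12)\<^sup>2" using Dz unfolding D_def by (intro power_mono) auto
      hence D2: "(D z p)\<^sup>2 \<le> 320 / (144 * k)" using s by (simp add: power_divide)
      have h2: "(cmod (hip z p))\<^sup>2 = 1 - (D z p)\<^sup>2 / 4" unfolding D_def by (rule hopf_dist_sq[OF z pS])
      \<comment> \<open>Inside the cap \<open>k * D\<^sup>2 / 4\<close> is at most 80/144 < 3/4, so
        Bernoulli's inequality keeps the squared peak above 1/4; the radius \<open>s/12\<close> is
        small enough for this.\<close>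
      have "1/4 \<le> 1 - real k * ((D z p)\<^sup>2 / 4)"
        using mult_left_mono[OF D2, of "real k / 4"] k by (simp add: field_simps)
      also have "\<dots> \<le> (1 - (D z p)\<^sup>2 / 4) ^ k"
        using Bernoulli_inequality[of "- ((D z p)\<^sup>2 / 4)" k] h2 zero_le_power2[of "cmod (hip z p)"] by simp
      also have "\<dots> = (cmod (hip z p) ^ k)\<^sup>2" unfolding h2[symmetric] by (simp add: power_mult[symmetric] mult.commute)
      finally have "(1/2)\<^sup>2 \<le> (cmod (hip z p) ^ k)\<^sup>2" by (simp add: power2_eq_square)
      thus "1/2 \<le> cmod (hip z p) ^ k" by (rule power2_le_imp_le) simp
      have "cmod (hip z q) ^ k \<le> 1/72 * g z q" if q: "q \<in> P - {p}" for q
      proof -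
        \<comment> \<open>Any other centre is at distance at least \<open>s - s/12\<close> from
          \<open>z\<close>. The weaker \<open>s/2\<close> already gives
          \<open>k/16 * (s/2)\<^sup>2 = 5\<close>.\<close>
        have "s \<le> D p q" using P(3)[of p q] p q by auto
        also have "\<dots> \<le> D z p + D z q" unfolding D_def by (rule dist_triangle3)
        finally have "s / 2 \<le> D z q" using Dz s by linarith
        hence "(s/2)\<^sup>2 \<le> (D z q)\<^sup>2" using s by (intro power_mono) auto
        hence "80 / k \<le> (D z q)\<^sup>2" using s by (simp add: power_divide)
        hence "real k / 16 * (80 / k) \<le> real k / 16 * (D z q)\<^sup>2" by (intro mult_left_mono) auto
        hence "5 \<le> real k / 16 * (D z q)\<^sup>2" using k by simp
        hence "g z q \<le> exp (-5)" unfolding g_def by simp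
        also have "\<dots> \<le> 1/72" using exp_five by (simp add: exp_minus field_simps)
        finally have "g z q * g z q \<le> 1/72 * g z q" using g1(1)[of z q] by (intro mult_right_mono) auto
        thus ?thesis using hg[OF z, of q] q by auto
      qed
      hence "(\<Sum>q\<in>P - {p}. cmod (hip z q) ^ k) \<le> (\<Sum>q\<in>P - {p}. 1/72 * g z q)" by (rule sum_mono)
      also have "\<dots> = 1/72 * (\<Sum>q\<in>P - {p}. g z q)" by (simp add: sum_distrib_left)
      also have "\<dots> \<le> 1/72 * 9" using g9[of "P - {p}" z] by (intro mult_left_mono) auto
      finally show "(\<Sum>q\<in>P - {p}. cmod (hip z q) ^ k) \<le> 1/8" by simp
    qed
    show "p = q" if "p \<in> P" "q \<in> P" "z \<in> cap p (sqrt (320 / k) / 12)" "z \<in> cap q (sqrt (320 / k) / 12)" for p q z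
    proof (rule ccontr)
      assume "p \<noteq> q"
      have "s \<le> D p q" using P(3) that \<open>p \<noteq> q\<close> by blast
      also have "\<dots> \<le> D z p + D z q" unfolding D_def by (rule dist_triangle3)
      also have "\<dots> < s/12 + s/12" using that unfolding cap_def D_def s_def by auto
      finally show False using s by simp
    qed
  qed
qed

end

section \<open>Polynomials with degrees in an LI-set\<close>

context sphere_measure
begin

text \<open>7744 = 4 * 16 * 11^2: the factor 4 from comparing integrals over caps, the squared lower
  bound \<open>\<psi> / 4\<close> on the small caps, and the square of the normalising divisor
  11.\<close>

definition gain :: real where "gain = 1 / (7744 * net_const)"

lemma gain_pos: "gain > 0" using net_const_pos by (simp add: gain_def)

text \<open>The parameter \<open>K0\<close> pushes all degrees beyond those already in use. The
  bound \<open>real k\<close> on the terms comes for free: their size on the sphere is at most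
  \<open>9 * K\<close>, independently of the exponents, and the exponents may start as late as
  desired.\<close>

lemma exists_E_poly:
  fixes \<psi> :: "C2 \<Rightarrow> real"
  assumes cont: "continuous_on S2 \<psi>" and pos: "\<And>z. z \<in> S2 \<Longrightarrow> \<psi> z > 0" and LI: "LI_set E"
  obtains H K1 where "K0 \<le> K1" "\<And>k. homogeneous_poly k (H k)"
    "\<And>k. k \<notin> E \<or> k < K0 \<or> K1 \<le> k \<Longrightarrow> H k = (\<lambda>z. 0)"
    "\<And>k z. z \<in> S2 \<Longrightarrow> cmod (H k z) \<le> real k"
    "\<And>z. z \<in> S2 \<Longrightarrow> cmod (\<Sum>k<K1. H k z) < \<psi> z"
    "gain * (\<integral>z. (\<psi> z)\<^sup>2 \<partial>\<sigma>) \<le> (\<integral>z. (cmod (\<Sum>k<K1. H k z))\<^sup>2 \<partial>\<sigma>)"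
proof -
  have Sne: "S2 \<noteq> {}" by (simp add: sphere_eq_empty)
  obtain zm where zm: "zm \<in> S2" "\<And>z. z \<in> S2 \<Longrightarrow> \<psi> zm \<le> \<psi> z"
    using continuous_attains_inf[OF _ Sne cont] by auto
  define \<mu> where "\<mu> = \<psi> zm"
  have \<mu>: "\<mu> > 0" "\<And>z. z \<in> S2 \<Longrightarrow> \<mu> \<le> \<psi> z" using zm pos by (auto simp: \<mu>_def)
  obtain zM where zM: "zM \<in> S2" "\<And>z. z \<in> S2 \<Longrightarrow> \<psi> z \<le> \<psi> zM"
    using continuous_attains_sup[OF _ Sne cont] by auto
  define B where "B = \<psi> zM"
  have B: "\<bar>\<psi> z\<bar> \<le> B" if "z \<in> S2" for z using zM(2)[OF that] pos[OF that] by (simp add: B_def)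
  \<comment> \<open>288 = 2 * 9 * 16: the peaks sum to at most 9, so the error \<open>2 * e\<close>
    per peak adds up to at most \<open>\<mu> / 16\<close>.\<close>
  define e where "e = \<mu> / 288"
  have e: "e > 0" using \<mu> by (simp add: e_def)
  obtain P where P: "real_polynomial_function P" "\<And>x. x \<in> S2 \<Longrightarrow> \<bar>\<psi> x - P x\<bar> < e"
    by (rule Stone_Weierstrass_real_polynomial_function[OF compact_sphere cont e]) blast
  obtain m n K where pp: "\<forall>\<zeta>\<in>S2. \<exists>p::complex poly. degree p \<le> n \<and> (\<forall>i. cmod (coeff p i) \<le> K) \<and>
      (\<forall>u. cmod u = 1 \<longrightarrow> u ^ m * of_real (P (u *s \<zeta>)) = poly p u)"
    using circle_restriction_poly[OF P(1)] by (elim exE)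
  from bchoice[OF this] obtain pl where pl: "\<And>\<zeta>. \<zeta> \<in> S2 \<Longrightarrow> degree (pl \<zeta>) \<le> n"
    "\<And>\<zeta> i. \<zeta> \<in> S2 \<Longrightarrow> cmod (coeff (pl \<zeta>) i) \<le> K"
    "\<And>\<zeta> u. \<zeta> \<in> S2 \<Longrightarrow> cmod u = 1 \<Longrightarrow> u ^ m * of_real (P (u *s \<zeta>)) = poly (pl \<zeta>) u" by blast
  have K0': "0 \<le> K" using order_trans[OF norm_ge_zero pl(2)[OF zm(1)]] .
  have "uniformly_continuous_on S2 \<psi>" by (rule compact_uniformly_continuous[OF cont]) simp
  from this[unfolded uniformly_continuous_on_def, rule_format, OF e]
  obtain t where t: "t > 0" "\<And>v w. v \<in> S2 \<Longrightarrow> w \<in> S2 \<Longrightarrow> norm (v - w) < t \<Longrightarrow> \<bar>\<psi> v - \<psi> w\<bar> \<le> e"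
    unfolding dist_norm real_norm_def by (metis less_imp_le)
  define K3 where "K3 = K * (real n + 1)\<^sup>2 / 4 + 2 * B / t\<^sup>2"
  \<comment> \<open>Three demands on the exponent: it bounds the terms, whose size is at most
    \<open>9 * K\<close>; it makes the mesh at most \<open>t\<close>; and it brings the quadratic
    errors, \<open>144 * K3 / k\<close> in total, below \<open>\<mu> / 16\<close>.\<close>
  obtain k0 :: nat where k0: "max (max (9 * K) (320 / t\<^sup>2)) (144 * K3 * 16 / \<mu>) \<le> real k0"
    using real_arch_simple by blast
  obtain k where k: "k \<ge> max (max k0 K0) 1" "\<And>i. i \<le> n \<Longrightarrow> k + i \<in> E"
    using LI_set_interval[OF LI] by blast
  have k1: "k \<ge> 1" and kK0: "K0 \<le> k" and kr: "real k0 \<le> real k" using k(1) by auto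
  define s where "s = sqrt (320 / k)"
  have s: "s > 0" using k1 by (simp add: s_def)
  have "320 / t\<^sup>2 \<le> k" using k0 kr by simp
  hence "320 / k \<le> t\<^sup>2" using t k1 by (simp add: field_simps)
  hence st: "s \<le> t" unfolding s_def using t by (intro real_le_lsqrt) auto
  have K3k: "144 * K3 / k \<le> \<mu> / 16"
  proof -
    have "144 * K3 * 16 / \<mu> \<le> k" using k0 kr by simp
    thus ?thesis using \<mu> k1 by (simp add: field_simps)
  qed
  obtain N where N: "finite N" "N \<subseteq> S2" "\<And>z. z \<in> S2 \<Longrightarrow> \<exists>p\<in>N. dist (hopf z) (hopf p) < s"
    "\<And>z. z \<in> S2 \<Longrightarrow> (\<Sum>p\<in>N. cmod (hip z p) ^ k) \<le> 9"
    "\<And>z. z \<in> S2 \<Longrightarrow> (\<Sum>p\<in>N. cmod (hip z p) ^ k * (dist (hopf z) (hopf p))\<^sup>2) \<le> 144 / k"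
    "\<And>z p. z \<in> S2 \<Longrightarrow> p \<in> N \<Longrightarrow> z \<in> cap p (s / 12) \<Longrightarrow>
        cmod (hip z p) ^ k \<ge> 1/2 \<and> (\<Sum>q\<in>N - {p}. cmod (hip z q) ^ k) \<le> 1/8"
    "\<And>p q z. p \<in> N \<Longrightarrow> q \<in> N \<Longrightarrow> z \<in> cap p (s / 12) \<Longrightarrow> z \<in> cap q (s / 12) \<Longrightarrow> p = q"
    unfolding s_def by (rule peak_net[OF k1]) blast
  \<comment> \<open>The degrees run from \<open>k\<close> to \<open>k + n\<close>. The unscaled sum
    has modulus at most 9 times \<open>\<psi>\<close> plus \<open>\<mu> / 8\<close>; division by 11
    brings it below \<open>\<psi>\<close>.\<close>
  define H where "H l z = (if k \<le> l \<and> l \<le> k + n then \<Sum>\<zeta>\<in>N. coeff (pl \<zeta>) (l - k) / 11 * hip z \<zeta> ^ l else 0)" for l z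
  define K1 where "K1 = k + n + 1"
  define F where "F z = (\<Sum>\<zeta>\<in>N. hip z \<zeta> ^ k * poly (pl \<zeta>) (hip z \<zeta>))" for z
  have sumH: "(\<Sum>l<K1. H l z) = F z / 11" for z
  proof -
    have "(\<Sum>l<K1. H l z) = (\<Sum>l\<in>{k..k+n}. \<Sum>\<zeta>\<in>N. coeff (pl \<zeta>) (l - k) / 11 * hip z \<zeta> ^ l)"
      unfolding H_def K1_def by (rule sum.mono_neutral_cong_right) auto
    also have "\<dots> = (\<Sum>i\<le>n. \<Sum>\<zeta>\<in>N. coeff (pl \<zeta>) i / 11 * hip z \<zeta> ^ (k + i))"
      by (rule sum.reindex_bij_witness[of _ "\<lambda>i. k + i" "\<lambda>l. l - k"]) auto
    also have "\<dots> = (\<Sum>\<zeta>\<in>N. \<Sum>i\<le>n. coeff (pl \<zeta>) i / 11 * hip z \<zeta> ^ (k + i))" by (rule sum.swap)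
    also have "\<dots> = (\<Sum>\<zeta>\<in>N. hip z \<zeta> ^ k * poly (pl \<zeta>) (hip z \<zeta>) / 11)"
    proof (rule sum.cong[OF refl])
      fix \<zeta> assume "\<zeta> \<in> N"
      hence "degree (pl \<zeta>) \<le> n" using pl(1) N(2) by blast
      from poly_sum_atMost[OF this, of "hip z \<zeta>"]
      show "(\<Sum>i\<le>n. coeff (pl \<zeta>) i / 11 * hip z \<zeta> ^ (k + i)) = hip z \<zeta> ^ k * poly (pl \<zeta>) (hip z \<zeta>) / 11"
        by (simp add: sum_distrib_left sum_divide_distrib power_add algebra_simps)
    qed
    finally show ?thesis unfolding F_def sum_divide_distrib .
  qed
  have "\<forall>z\<in>S2. \<forall>\<zeta>\<in>N. \<exists>v. cmod v = 1 \<and> cmod (hip z \<zeta> ^ k * poly (pl \<zeta>) (hip z \<zeta>) - of_real (cmod (hip z \<zeta>) ^ k) * v * of_real (\<psi> z))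
      \<le> cmod (hip z \<zeta>) ^ k * (2 * e + K3 * (dist (hopf z) (hopf \<zeta>))\<^sup>2)"
  proof (intro ballI)
    fix z \<zeta> assume z: "z \<in> S2" and "\<zeta> \<in> N"
    hence \<zeta>: "\<zeta> \<in> S2" using N(2) by blast
    obtain v where "cmod v = 1"
      "cmod (hip z \<zeta> ^ k * poly (pl \<zeta>) (hip z \<zeta>) - of_real (cmod (hip z \<zeta>) ^ k) * v * of_real (\<psi> z))
      \<le> cmod (hip z \<zeta>) ^ k * (2 * e + (K * (real n + 1)\<^sup>2 / 4 + 2 * B / t\<^sup>2) * (dist (hopf z) (hopf \<zeta>))\<^sup>2)"
      by (rule peak_approx[OF z \<zeta> pl(1,2,3)[OF \<zeta>] less_imp_le[OF P(2)] t(2) B t(1) less_imp_le[OF e]]) auto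
    thus "\<exists>v. cmod v = 1 \<and> cmod (hip z \<zeta> ^ k * poly (pl \<zeta>) (hip z \<zeta>) - of_real (cmod (hip z \<zeta>) ^ k) * v * of_real (\<psi> z))
      \<le> cmod (hip z \<zeta>) ^ k * (2 * e + K3 * (dist (hopf z) (hopf \<zeta>))\<^sup>2)"
      unfolding K3_def by blast
  qed
  then obtain v where v: "\<And>z \<zeta>. z \<in> S2 \<Longrightarrow> \<zeta> \<in> N \<Longrightarrow> cmod (v z \<zeta>) = 1"
    "\<And>z \<zeta>. z \<in> S2 \<Longrightarrow> \<zeta> \<in> N \<Longrightarrow> cmod (hip z \<zeta> ^ k * poly (pl \<zeta>) (hip z \<zeta>) - of_real (cmod (hip z \<zeta>) ^ k) * v z \<zeta> * of_real (\<psi> z))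
      \<le> cmod (hip z \<zeta>) ^ k * (2 * e + K3 * (dist (hopf z) (hopf \<zeta>))\<^sup>2)" by metis
  \<comment> \<open>The idealised sum: \<open>F\<close> equals \<open>G * \<psi>\<close> up to
    \<open>\<mu> / 8\<close>. The phases \<open>v z \<zeta>\<close> are out of control, so only the
    modulus of \<open>G\<close> is used: at most 9 everywhere, and at least 1/2 - 1/8 on the small
    caps, where one peak dominates.\<close>
  define G where "G z = (\<Sum>\<zeta>\<in>N. of_real (cmod (hip z \<zeta>) ^ k) * v z \<zeta>)" for z
  have FG: "cmod (F z - G z * of_real (\<psi> z)) \<le> \<mu> / 8" if z: "z \<in> S2" for z
  proof -
    have "cmod (F z - G z * of_real (\<psi> z)) \<le> (\<Sum>\<zeta>\<in>N. cmod (hip z \<zeta>) ^ k * (2 * e + K3 * (dist (hopf z) (hopf \<zeta>))\<^sup>2))"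
      unfolding F_def G_def sum_distrib_right sum_subtractf[symmetric]
      by (rule sum_norm_le) (rule v(2)[OF z])
    also have "\<dots> = 2 * e * (\<Sum>\<zeta>\<in>N. cmod (hip z \<zeta>) ^ k) + K3 * (\<Sum>\<zeta>\<in>N. cmod (hip z \<zeta>) ^ k * (dist (hopf z) (hopf \<zeta>))\<^sup>2)"
      by (simp add: sum_distrib_left sum.distrib algebra_simps)
    also have "\<dots> \<le> 2 * e * 9 + K3 * (144 / k)"
    proof -
      have "0 \<le> B" using B[OF zm(1)] by linarith
      hence "0 \<le> K3" using K0' by (simp add: K3_def)
      thus ?thesis using N(4,5)[OF z] e by (intro add_mono mult_left_mono) auto
    qed
    also have "\<dots> \<le> \<mu> / 8"
    proof -
      have "2 * e * 9 = \<mu> / 16" "K3 * (144 / k) = 144 * K3 / k" by (simp_all add: e_def)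
      thus ?thesis using K3k by linarith
    qed
    finally show ?thesis .
  qed
  have G9: "cmod (G z) \<le> 9" if z: "z \<in> S2" for z
  proof -
    have "cmod (G z) \<le> (\<Sum>\<zeta>\<in>N. cmod (hip z \<zeta>) ^ k)"
      unfolding G_def by (rule sum_norm_le) (simp add: norm_mult norm_power v(1)[OF z])
    thus ?thesis using N(4)[OF z] by linarith
  qed
  have Fup: "cmod (F z) < 11 * \<psi> z" if z: "z \<in> S2" for z
  proof -
    have "cmod (F z) \<le> cmod (G z * of_real (\<psi> z)) + cmod (F z - G z * of_real (\<psi> z))" by (rule norm_triangle_sub)
    also have "cmod (G z * of_real (\<psi> z)) \<le> 9 * \<psi> z"
      using G9[OF z] pos[OF z] by (simp add: norm_mult)
    finally show ?thesis using FG[OF z] \<mu>(2)[OF z] pos[OF z] by linarith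
  qed
  have Flow: "\<psi> z / 4 \<le> cmod (F z)" if z: "z \<in> S2" and p: "p \<in> N" and c: "z \<in> cap p (s / 12)" for z p
  proof -
    have G: "G z = of_real (cmod (hip z p) ^ k) * v z p + (\<Sum>q\<in>N - {p}. of_real (cmod (hip z q) ^ k) * v z q)"
      unfolding G_def by (rule sum.remove[OF N(1) p])
    have "cmod (\<Sum>q\<in>N - {p}. of_real (cmod (hip z q) ^ k) * v z q) \<le> (\<Sum>q\<in>N - {p}. cmod (hip z q) ^ k)"
      by (rule sum_norm_le) (simp add: norm_mult norm_power v(1)[OF z])
    moreover have "cmod (of_real (cmod (hip z p) ^ k) * v z p) = cmod (hip z p) ^ k"
      by (simp add: norm_mult norm_power v(1)[OF z p])
    moreover have "cmod (of_real (cmod (hip z p) ^ k) * v z p) \<le> cmod (G z) + cmod (\<Sum>q\<in>N - {p}. of_real (cmod (hip z q) ^ k) * v z q)"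
      unfolding G using norm_triangle_ineq4[of "of_real (cmod (hip z p) ^ k) * v z p + (\<Sum>q\<in>N - {p}. of_real (cmod (hip z q) ^ k) * v z q)"
          "\<Sum>q\<in>N - {p}. of_real (cmod (hip z q) ^ k) * v z q"] by simp
    ultimately have "3/8 \<le> cmod (G z)" using N(6)[OF z p c] by linarith
    hence "3/8 * \<psi> z \<le> cmod (G z) * \<psi> z" using pos[OF z] by (intro mult_right_mono) auto
    also have "\<dots> = cmod (G z * of_real (\<psi> z))" using pos[OF z] by (simp add: norm_mult)
    also have "\<dots> \<le> cmod (F z) + cmod (F z - G z * of_real (\<psi> z))"
      using norm_triangle_sub[of "G z * of_real (\<psi> z)" "F z"] by (simp add: norm_minus_commute)
    finally show ?thesis using FG[OF z] \<mu>(2)[OF z] by linarith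
  qed
  have cF: "continuous_on S2 F" unfolding F_def hip_def by (intro continuous_intros)
  have i2: "integrable \<sigma> (\<lambda>z. (\<psi> z)\<^sup>2)" by (intro integrable_cont continuous_intros cont)
  have int: "integrable \<sigma> (\<lambda>z. (\<psi> z)\<^sup>2 * indicator (cap c (s/12)) z)" for c
    by (rule integrable_real_mult_indicator[OF cap_sets i2])
  have le\<mu>: "\<bar>\<psi> v - \<psi> w\<bar> \<le> \<mu>" if "v \<in> S2" "w \<in> S2" "norm (v - w) < t" for v w
    using t(2)[OF that] \<mu>(1) by (simp add: e_def)
  have le1: "(\<integral>z. (\<psi> z)\<^sup>2 \<partial>\<sigma>) \<le> 4 * net_const * (\<Sum>p\<in>N. \<integral>z. (\<psi> z)\<^sup>2 * indicator (cap p (s/12)) z \<partial>\<sigma>)"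
    by (rule integral_le_caps[OF s st N(1,2,3) cont \<mu>(2,1) le\<mu>])
  have "(\<Sum>p\<in>N. \<integral>z. (\<psi> z)\<^sup>2 * indicator (cap p (s/12)) z \<partial>\<sigma>) = (\<integral>z. (\<Sum>p\<in>N. (\<psi> z)\<^sup>2 * indicator (cap p (s/12)) z) \<partial>\<sigma>)"
    by (rule Bochner_Integration.integral_sum[OF int, symmetric])
  also have "\<dots> \<le> (\<integral>z. 16 * (cmod (F z))\<^sup>2 \<partial>\<sigma>)"
  proof (rule integral_mono')
    show "integrable \<sigma> (\<lambda>z. 16 * (cmod (F z))\<^sup>2)" by (intro integrable_cont continuous_intros cF)
    fix z assume "z \<in> space \<sigma>"
    hence z: "z \<in> S2" by simp
    show "(\<Sum>p\<in>N. (\<psi> z)\<^sup>2 * indicator (cap p (s/12)) z) \<le> 16 * (cmod (F z))\<^sup>2"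
    proof (cases "\<exists>p\<in>N. z \<in> cap p (s/12)")
      case False
      hence "(\<Sum>p\<in>N. (\<psi> z)\<^sup>2 * indicator (cap p (s/12)) z) = 0" by (intro sum.neutral) auto
      thus ?thesis by simp
    next
      case True
      then obtain p where p: "p \<in> N" "z \<in> cap p (s/12)" by blast
      have "(\<Sum>q\<in>N. (\<psi> z)\<^sup>2 * indicator (cap q (s/12)) z) = (\<Sum>q\<in>N. if q = p then (\<psi> z)\<^sup>2 else 0)"
      proof (rule sum.cong[OF refl])
        fix q assume q: "q \<in> N"
        show "(\<psi> z)\<^sup>2 * indicator (cap q (s/12)) z = (if q = p then (\<psi> z)\<^sup>2 else 0)"
          using N(7)[OF q p(1) _ p(2)] p(2) by (cases "z \<in> cap q (s/12)") auto
      qed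
      also have "\<dots> = (\<psi> z)\<^sup>2" using p(1) N(1) by simp
      also have "\<dots> \<le> (4 * cmod (F z))\<^sup>2" using Flow[OF z p] pos[OF z] by (intro power_mono) auto
      finally show ?thesis by (simp add: power_mult_distrib)
    qed
  qed simp
  finally have "4 * net_const * (\<Sum>p\<in>N. \<integral>z. (\<psi> z)\<^sup>2 * indicator (cap p (s/12)) z \<partial>\<sigma>)
      \<le> 4 * net_const * (\<integral>z. 16 * (cmod (F z))\<^sup>2 \<partial>\<sigma>)"
    by (rule mult_left_mono) (use net_const_pos in linarith)
  from order_trans[OF le1 this]
  have "(\<integral>z. (\<psi> z)\<^sup>2 \<partial>\<sigma>) \<le> 4 * net_const * (\<integral>z. 16 * (cmod (F z))\<^sup>2 \<partial>\<sigma>)" .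
  also have "\<dots> = 7744 * net_const * (\<integral>z. (cmod (F z / 11))\<^sup>2 \<partial>\<sigma>)"
    by (simp add: norm_divide power_divide)
  finally have fin: "gain * (\<integral>z. (\<psi> z)\<^sup>2 \<partial>\<sigma>) \<le> (\<integral>z. (cmod (F z / 11))\<^sup>2 \<partial>\<sigma>)"
    using net_const_pos unfolding gain_def by (simp add: field_simps)
  show ?thesis
  proof (rule that[of K1 H])
    show "K0 \<le> K1" using kK0 by (simp add: K1_def)
    show "homogeneous_poly l (H l)" for l
    proof (cases "k \<le> l \<and> l \<le> k + n")
      case True
      hence "H l = (\<lambda>z. \<Sum>\<zeta>\<in>N. coeff (pl \<zeta>) (l - k) / 11 * hip z \<zeta> ^ l)" by (simp add: H_def fun_eq_iff)
      thus ?thesis by (simp only:) (intro homogeneous_poly_sum homogeneous_poly_cmult homogeneous_poly_hip_power)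
    next
      case False
      hence "H l = (\<lambda>z. 0)" by (auto simp: H_def fun_eq_iff)
      thus ?thesis by (simp add: homogeneous_poly_zero)
    qed
    show "H l = (\<lambda>z. 0)" if "l \<notin> E \<or> l < K0 \<or> K1 \<le> l" for l
    proof -
      have "\<not> (k \<le> l \<and> l \<le> k + n)"
      proof
        assume *: "k \<le> l \<and> l \<le> k + n"
        hence "l = k + (l - k)" "l - k \<le> n" by auto
        hence "l \<in> E" using k(2)[of "l - k"] by simp
        thus False using that * kK0 unfolding K1_def by linarith
      qed
      thus ?thesis by (auto simp: H_def fun_eq_iff)
    qed
    show "cmod (H l z) \<le> real l" if z: "z \<in> S2" for l z
    proof (cases "k \<le> l \<and> l \<le> k + n")
      case True
      have "cmod (H l z) \<le> (\<Sum>\<zeta>\<in>N. K * cmod (hip z \<zeta>) ^ k)"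
      proof -
        have "cmod (coeff (pl \<zeta>) (l - k) / 11 * hip z \<zeta> ^ l) \<le> K * cmod (hip z \<zeta>) ^ k" if "\<zeta> \<in> N" for \<zeta>
        proof -
          have \<zeta>: "\<zeta> \<in> S2" using that N(2) by blast
          have "cmod (coeff (pl \<zeta>) (l - k)) / 11 \<le> K" using pl(2)[OF \<zeta>, of "l - k"] K0' by linarith
          moreover have "cmod (hip z \<zeta>) ^ l \<le> cmod (hip z \<zeta>) ^ k"
            using True hip_le_1[OF z \<zeta>] by (intro power_decreasing) auto
          ultimately show ?thesis unfolding norm_mult norm_divide norm_power using K0' by (intro mult_mono) auto
        qed
        thus ?thesis using True unfolding H_def by (simp only: if_True simp_thms) (rule sum_norm_le)
      qed
      also have "\<dots> = K * (\<Sum>\<zeta>\<in>N. cmod (hip z \<zeta>) ^ k)" by (simp add: sum_distrib_left)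
      also have "\<dots> \<le> K * 9" using N(4)[OF z] K0' by (intro mult_left_mono) auto
      also have "\<dots> \<le> real l" using k0 kr True by simp
      finally show ?thesis .
    next
      case False thus ?thesis by (auto simp: H_def)
    qed
    show "cmod (\<Sum>k<K1. H k z) < \<psi> z" if "z \<in> S2" for z
      unfolding sumH using Fup[OF that] by (simp add: norm_divide)
    show "gain * (\<integral>z. (\<psi> z)\<^sup>2 \<partial>\<sigma>) \<le> (\<integral>z. (cmod (\<Sum>k<K1. H k z))\<^sup>2 \<partial>\<sigma>)"
      unfolding sumH by (rule fin)
  qed
qed

end

text \<open>The Lipschitz regularisations \<open>x \<mapsto> inf\<^sub>y \<phi> y + n * dist x y\<close> increase to \<open>\<phi>\<close>.\<close>

lemma lsc_lipschitz_approx: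
  fixes \<phi> :: "'a::metric_space \<Rightarrow> real"
  assumes S: "compact S" "S \<noteq> {}" and lsc: "lower_semicontinuous_on S \<phi>" and pos: "\<And>x. x \<in> S \<Longrightarrow> \<phi> x > 0"
  obtains g :: "nat \<Rightarrow> 'a \<Rightarrow> real" where "\<And>n. continuous_on S (g n)" "\<And>n x. x \<in> S \<Longrightarrow> 0 < g n x"
    "\<And>n x. x \<in> S \<Longrightarrow> g n x \<le> \<phi> x" "\<And>x. x \<in> S \<Longrightarrow> (\<lambda>n. g n x) \<longlonglongrightarrow> \<phi> x"
proof -
  have op: "openin (top_of_set S) {x\<in>S. c < \<phi> x}" for c
    using lsc unfolding lower_semicontinuous_on_def by blast
  have nbhd: "\<exists>d>0. \<forall>y\<in>S. dist x y < d \<longrightarrow> c < \<phi> y" if "x \<in> S" "c < \<phi> x" for x c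
  proof -
    have "\<forall>x\<in>{x\<in>S. c < \<phi> x}. \<exists>d>0. ball x d \<inter> S \<subseteq> {x\<in>S. c < \<phi> x}"
      using op[of c] unfolding openin_contains_ball by (rule conjunct2)
    from bspec[OF this, of x] that
    obtain d where "d > 0" "ball x d \<inter> S \<subseteq> {x\<in>S. c < \<phi> x}" by auto
    thus ?thesis by (intro exI[of _ d]) auto
  qed
  \<comment> \<open>Pointwise positivity is made uniform by a finite cover with balls on which
    \<open>\<phi>\<close> exceeds half its value at the centre. The bound \<open>b\<close> makes the
    infima below finite and the functions \<open>g n\<close> positive.\<close>
  have "\<exists>b>0. \<forall>x\<in>S. b \<le> \<phi> x"
  proof -
    have "\<forall>x\<in>S. \<exists>d>0. \<forall>y\<in>S. dist x y < d \<longrightarrow> \<phi> x / 2 < \<phi> y"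
      by (intro ballI nbhd) (use pos in auto)
    then obtain d where d: "\<And>x. x \<in> S \<Longrightarrow> 0 < d x" "\<And>x y. x \<in> S \<Longrightarrow> y \<in> S \<Longrightarrow> dist x y < d x \<Longrightarrow> \<phi> x / 2 < \<phi> y" by metis
    have "S \<subseteq> (\<Union>x\<in>S. ball x (d x))" using d(1) by force
    then obtain T where T: "T \<subseteq> S" "finite T" "S \<subseteq> (\<Union>x\<in>T. ball x (d x))"
      using compactE_image[OF S(1), of S "\<lambda>x. ball x (d x)"] by auto
    have "T \<noteq> {}" using T(3) S(2) by auto
    define b where "b = Min ((\<lambda>x. \<phi> x / 2) ` T)"
    have "b > 0" unfolding b_def using T pos \<open>T \<noteq> {}\<close> by (subst Min_gr_iff) auto
    moreover have "b \<le> \<phi> y" if "y \<in> S" for y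
    proof -
      have "y \<in> (\<Union>x\<in>T. ball x (d x))" using T(3) that by (rule subsetD)
      then obtain x where x: "x \<in> T" "dist x y < d x" by auto
      have "b \<le> \<phi> x / 2" unfolding b_def using T(2) x(1) by (intro Min_le) auto
      thus ?thesis using d(2)[of x y] x T(1) that by auto
    qed
    ultimately show ?thesis by blast
  qed
  then obtain b where b: "b > 0" "\<And>x. x \<in> S \<Longrightarrow> b \<le> \<phi> x" by blast
  define g where "g n x = (INF y\<in>S. \<phi> y + real n * dist x y)" for n x
  have bdd: "bdd_below ((\<lambda>y. \<phi> y + real n * dist x y) ` S)" for n x
    by (rule bdd_belowI2[of _ b]) (use b(2) in \<open>simp add: add_increasing2\<close>)
  have gb: "b \<le> g n x" for n x unfolding g_def
    by (rule cINF_greatest[OF S(2)]) (use b(2) in \<open>simp add: add_increasing2\<close>)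
  have gle: "g n x \<le> \<phi> y + real n * dist x y" if "y \<in> S" for n x y
    unfolding g_def by (rule cINF_lower[OF bdd that])
  have lip: "g n x \<le> g n x' + real n * dist x x'" for n x x'
  proof -
    have "g n x - real n * dist x x' \<le> g n x'"
      unfolding g_def[of n x']
    proof (rule cINF_greatest[OF S(2)])
      fix y assume "y \<in> S"
      have "real n * dist x y \<le> real n * (dist x x' + dist x' y)" by (intro mult_left_mono dist_triangle) auto
      thus "g n x - real n * dist x x' \<le> \<phi> y + real n * dist x' y" using gle[OF \<open>y \<in> S\<close>, of n x]
        by (simp add: algebra_simps)
    qed
    thus ?thesis by simp
  qed
  have cont: "continuous_on S (g n)" for n
  proof (rule continuous_onI)
    fix x and e :: real assume "x \<in> S" "e > 0"
    show "\<exists>d>0. \<forall>x'\<in>S. dist x' x < d \<longrightarrow> dist (g n x') (g n x) \<le> e"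
    proof (intro exI conjI ballI impI)
      show "e / (real n + 1) > 0" using \<open>e > 0\<close> by simp
      fix x' assume d: "dist x' x < e / (real n + 1)"
      have "\<bar>g n x' - g n x\<bar> \<le> real n * dist x' x"
        using lip[of n x x'] lip[of n x' x] by (simp add: dist_commute)
      also have "\<dots> \<le> (real n + 1) * dist x' x" by (intro mult_right_mono) auto
      also have "\<dots> \<le> e" using d by (simp add: field_simps)
      finally show "dist (g n x') (g n x) \<le> e" by (simp add: dist_real_def)
    qed
  qed
  have up: "g n x \<le> \<phi> x" if "x \<in> S" for n x using gle[OF that, of n x] by simp
  have lim: "(\<lambda>n. g n x) \<longlonglongrightarrow> \<phi> x" if x: "x \<in> S" for x
  proof (rule order_tendstoI)
    fix c assume c: "c > \<phi> x"
    show "\<forall>\<^sub>F n in sequentially. g n x < c" by (rule always_eventually) (use up[OF x] c in \<open>auto intro: le_less_trans\<close>)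
  next
    fix c assume c: "c < \<phi> x"
    define c' where "c' = (c + \<phi> x) / 2"
    have c': "c < c'" "c' < \<phi> x" using c by (auto simp: c'_def)
    obtain d where d: "d > 0" "\<And>y. y \<in> S \<Longrightarrow> dist x y < d \<Longrightarrow> c' < \<phi> y" using nbhd[OF x c'(2)] by blast
    \<comment> \<open>From \<open>n0\<close> on, points at distance at least \<open>d\<close> are
      penalised by at least \<open>c'\<close>, while at closer points \<open>\<phi>\<close> itself
      exceeds \<open>c'\<close>.\<close>
    obtain n0 :: nat where n0: "c' / d \<le> real n0" using real_arch_simple by blast
    have "c < g n x" if "n \<ge> n0" for n
    proof -
      have "c' \<le> g n x" unfolding g_def
      proof (rule cINF_greatest[OF S(2)])
        fix y assume y: "y \<in> S"
        show "c' \<le> \<phi> y + real n * dist x y"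
        proof (cases "dist x y < d")
          case True thus ?thesis using d(2)[OF y True] by (simp add: add_increasing2)
        next
          case False
          have "c' / d \<le> real n" using n0 that by linarith
          hence "c' \<le> real n * d" using d(1) by (simp add: divide_le_eq)
          also have "\<dots> \<le> real n * dist x y" using False by (intro mult_left_mono) auto
          finally show ?thesis using pos[OF y] by linarith
        qed
      qed
      thus ?thesis using c'(1) by linarith
    qed
    thus "\<forall>\<^sub>F n in sequentially. c < g n x" by (auto simp: eventually_sequentially)
  qed
  show ?thesis by (rule that[of g]) (use cont gb b(1) up lim in \<open>auto intro: less_le_trans\<close>)
qed

lemma lsc_diff_continuous:
  fixes \<phi> h :: "'a::metric_space \<Rightarrow> real"
  assumes lsc: "lower_semicontinuous_on S \<phi>" and h: "continuous_on S h"
  shows "lower_semicontinuous_on S (\<lambda>x. \<phi> x - h x)"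
  unfolding lower_semicontinuous_on_def openin_contains_ball
proof (intro allI conjI ballI)
  fix c x assume x: "x \<in> {x \<in> S. c < \<phi> x - h x}"
  define e where "e = (\<phi> x - h x - c) / 2"
  have e: "e > 0" using x by (simp add: e_def)
  obtain d1 where d1: "d1 > 0" "\<And>y. y \<in> S \<Longrightarrow> dist y x < d1 \<Longrightarrow> dist (h y) (h x) < e"
    using h x e unfolding continuous_on_iff by blast
  have "x \<in> {x\<in>S. \<phi> x - e < \<phi> x}" using x e by simp
  moreover have "openin (top_of_set S) {y\<in>S. \<phi> x - e < \<phi> y}" using lsc unfolding lower_semicontinuous_on_def by blast
  ultimately obtain d2 where d2: "d2 > 0" "ball x d2 \<inter> S \<subseteq> {y\<in>S. \<phi> x - e < \<phi> y}"
    unfolding openin_contains_ball by blast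
  show "\<exists>d>0. ball x d \<inter> S \<subseteq> {x \<in> S. c < \<phi> x - h x}"
  proof (intro exI conjI subsetI)
    show "min d1 d2 > 0" using d1 d2 by simp
    fix y assume y: "y \<in> ball x (min d1 d2) \<inter> S"
    have "\<phi> x - e < \<phi> y" using d2(2) y by auto
    moreover have "h y < h x + e" using d1(2)[of y] y by (auto simp: dist_commute dist_real_def)
    ultimately have "c < \<phi> y - h y" unfolding e_def by argo
    thus "y \<in> {x \<in> S. c < \<phi> x - h x}" using y by simp
  qed
qed auto

context sphere_measure
begin

lemma borel_measurable_lsc:
  assumes "lower_semicontinuous_on S2 \<phi>" "\<And>z. z \<in> S2 \<Longrightarrow> \<phi> z > 0"
  shows "\<phi> \<in> borel_measurable \<sigma>"
proof -
  have Sne: "S2 \<noteq> {}" by (simp add: sphere_eq_empty)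
  obtain g :: "nat \<Rightarrow> C2 \<Rightarrow> real" where g: "\<And>n. continuous_on S2 (g n)" "\<And>x. x \<in> S2 \<Longrightarrow> (\<lambda>n. g n x) \<longlonglongrightarrow> \<phi> x"
    using lsc_lipschitz_approx[OF compact_sphere Sne assms] by metis
  show ?thesis
    by (rule borel_measurable_LIMSEQ_real[of _ g]) (use g borel_measurable_cont in auto)
qed

text \<open>The polynomial step needs a continuous target. Dominated convergence with majorant
  \<open>\<phi>\<^sup>2\<close> provides a minorant that keeps at least half of the squared norm;
  this loss is the 2 in the factor \<open>gain / 2\<close> of the iteration.\<close>

lemma exists_continuous_minorant:
  assumes lsc: "lower_semicontinuous_on S2 \<phi>" and pos: "\<And>z. z \<in> S2 \<Longrightarrow> \<phi> z > 0"
    and int: "integrable \<sigma> (\<lambda>z. (\<phi> z)\<^sup>2)"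
  obtains \<psi> where "continuous_on S2 \<psi>" "\<And>z. z \<in> S2 \<Longrightarrow> 0 < \<psi> z \<and> \<psi> z \<le> \<phi> z"
    "(\<integral>z. (\<phi> z)\<^sup>2 \<partial>\<sigma>) \<le> 2 * (\<integral>z. (\<psi> z)\<^sup>2 \<partial>\<sigma>)"
proof -
  have Sne: "S2 \<noteq> {}" by (simp add: sphere_eq_empty)
  obtain g :: "nat \<Rightarrow> C2 \<Rightarrow> real" where g: "\<And>n. continuous_on S2 (g n)" "\<And>n z. z \<in> S2 \<Longrightarrow> 0 < g n z"
    "\<And>n z. z \<in> S2 \<Longrightarrow> g n z \<le> \<phi> z" "\<And>x. x \<in> S2 \<Longrightarrow> (\<lambda>n. g n x) \<longlonglongrightarrow> \<phi> x"
    using lsc_lipschitz_approx[OF compact_sphere Sne lsc pos] by metis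
  have lim: "(\<lambda>n. \<integral>z. (g n z)\<^sup>2 \<partial>\<sigma>) \<longlonglongrightarrow> (\<integral>z. (\<phi> z)\<^sup>2 \<partial>\<sigma>)"
  proof (rule integral_dominated_convergence[OF _ _ int])
    show "(\<lambda>z. (\<phi> z)\<^sup>2) \<in> borel_measurable \<sigma>" using int by simp
    show "(\<lambda>z. (g n z)\<^sup>2) \<in> borel_measurable \<sigma>" for n
      by (intro borel_measurable_power borel_measurable_cont g)
    show "AE z in \<sigma>. (\<lambda>n. (g n z)\<^sup>2) \<longlonglongrightarrow> (\<phi> z)\<^sup>2" by (rule AE_I2) (use g(4) in \<open>auto intro: tendsto_power\<close>)
    show "AE z in \<sigma>. norm ((g n z)\<^sup>2) \<le> (\<phi> z)\<^sup>2" for n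
    proof (rule AE_I2)
      fix z assume "z \<in> space \<sigma>"
      hence "0 < g n z" "g n z \<le> \<phi> z" using g(2,3)[of z n] by auto
      thus "norm ((g n z)\<^sup>2) \<le> (\<phi> z)\<^sup>2" by (simp add: power_mono)
    qed
  qed
  have "\<exists>n. (\<integral>z. (\<phi> z)\<^sup>2 \<partial>\<sigma>) \<le> 2 * (\<integral>z. (g n z)\<^sup>2 \<partial>\<sigma>)"
  proof (cases "(\<integral>z. (\<phi> z)\<^sup>2 \<partial>\<sigma>) = 0")
    case True thus ?thesis by (intro exI[of _ 0]) (simp add: Bochner_Integration.integral_nonneg)
  next
    case False
    moreover have "(\<integral>z. (\<phi> z)\<^sup>2 \<partial>\<sigma>) \<ge> 0" by (rule Bochner_Integration.integral_nonneg) simp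
    ultimately have "(\<integral>z. (\<phi> z)\<^sup>2 \<partial>\<sigma>) / 2 < (\<integral>z. (\<phi> z)\<^sup>2 \<partial>\<sigma>)" by linarith
    from order_tendstoD(1)[OF lim this] obtain n where "(\<integral>z. (\<phi> z)\<^sup>2 \<partial>\<sigma>) / 2 < (\<integral>z. (g n z)\<^sup>2 \<partial>\<sigma>)"
      by (auto simp: eventually_sequentially)
    thus ?thesis by (intro exI[of _ n]) linarith
  qed
  then obtain n where "(\<integral>z. (\<phi> z)\<^sup>2 \<partial>\<sigma>) \<le> 2 * (\<integral>z. (g n z)\<^sup>2 \<partial>\<sigma>)" by blast
  with g show ?thesis by (intro that[of "g n"]) auto
qed

end

section \<open>The series on the sphere\<close>

context sphere_measure
begin

text \<open>The corrections \<open>F\<^sub>n\<close> of different degrees are orthogonal and each recovers a fixed part of the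
  squared norm of \<open>\<phi> - \<bar>s\<^sub>n\<bar>\<close>; as \<open>\<bar>s\<^sub>n\<bar> < \<phi>\<close>, these norms are square summable.\<close>

lemma exists_E_series:
  fixes \<phi> :: "C2 \<Rightarrow> real"
  assumes lsc: "lower_semicontinuous_on S2 \<phi>" and pos: "\<And>z. z \<in> S2 \<Longrightarrow> \<phi> z > 0"
    and int: "integrable \<sigma> (\<lambda>z. (\<phi> z)\<^sup>2)" and LI: "LI_set E"
  obtains G K where "strict_mono (K :: nat \<Rightarrow> nat)" "\<And>k. homogeneous_poly k (G k)"
    "\<And>k. k \<notin> E \<or> k = 0 \<Longrightarrow> G k = (\<lambda>z. 0)"
    "\<And>k z. z \<in> S2 \<Longrightarrow> cmod (G k z) \<le> real k"
    "\<And>n z. z \<in> S2 \<Longrightarrow> cmod (\<Sum>k<K n. G k z) < \<phi> z"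
    "\<And>n. (\<Sum>k<n. \<integral>z. (cmod (G k z))\<^sup>2 \<partial>\<sigma>) \<le> (\<integral>z. (\<phi> z)\<^sup>2 \<partial>\<sigma>)"
    "\<And>n. integrable \<sigma> (\<lambda>z. (\<phi> z - cmod (\<Sum>k<K n. G k z))\<^sup>2)"
    "(\<lambda>n. \<integral>z. (\<phi> z - cmod (\<Sum>k<K n. G k z))\<^sup>2 \<partial>\<sigma>) \<longlonglongrightarrow> 0"
    "\<exists>k. G k \<noteq> (\<lambda>z. 0)"
proof -
  define S where "S = (\<lambda>(H :: nat \<Rightarrow> C2 \<Rightarrow> complex, K) z. \<Sum>k<K. H k z)"
  \<comment> \<open>A state consists of the terms found so far and a strict bound \<open>K\<close>
    on their degrees. Degree 0 stays empty, so that the final sum vanishes at the origin, from which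
    its nonconstancy will follow.\<close>
  define good where "good = (\<lambda>(H, K). (\<forall>k. homogeneous_poly k (H k)) \<and>
      (\<forall>k. k \<notin> E \<or> k = 0 \<or> K \<le> k \<longrightarrow> H k = (\<lambda>z. 0)) \<and> (\<forall>k. \<forall>z\<in>S2. cmod (H k z) \<le> real k) \<and>
      (\<forall>z\<in>S2. cmod (S (H, K) z) < \<phi> z))"
  define step where "step = (\<lambda>(H, K) (H', K'). K < K' \<and> (\<forall>k<K. H' k = H k) \<and>
      gain / 2 * (\<integral>z. (\<phi> z - cmod (S (H, K) z))\<^sup>2 \<partial>\<sigma>) \<le> (\<integral>z. (cmod (\<Sum>k\<in>{K..<K'}. H' k z))\<^sup>2 \<partial>\<sigma>))"
  have \<phi>m: "\<phi> \<in> borel_measurable \<sigma>" by (rule borel_measurable_lsc[OF lsc pos])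
  have contS: "continuous_on S2 (\<lambda>z. \<Sum>k\<in>I. H k z)" if "\<And>k. homogeneous_poly k (H k)" for H and I :: "nat set"
    by (intro continuous_on_sum continuous_on_homogeneous_poly[OF that])
  have intd: "integrable \<sigma> (\<lambda>z. (\<phi> z - cmod (S (H, K) z))\<^sup>2)" if g: "good (H, K)" for H K
  proof (rule Bochner_Integration.integrable_bound[OF int])
    have "continuous_on S2 (S (H, K))" using contS[of H "{..<K}"] g by (auto simp: S_def good_def)
    hence "S (H, K) \<in> borel_measurable \<sigma>" by (rule borel_measurable_cont)
    thus "(\<lambda>z. (\<phi> z - cmod (S (H, K) z))\<^sup>2) \<in> borel_measurable \<sigma>" using \<phi>m by measurable
    show "AE z in \<sigma>. norm ((\<phi> z - cmod (S (H, K) z))\<^sup>2) \<le> norm ((\<phi> z)\<^sup>2)"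
    proof (rule AE_I2)
      fix z assume "z \<in> space \<sigma>"
      hence "cmod (S (H, K) z) < \<phi> z" using g by (auto simp: good_def)
      thus "norm ((\<phi> z - cmod (S (H, K) z))\<^sup>2) \<le> norm ((\<phi> z)\<^sup>2)" by (simp add: power_mono)
    qed
  qed
  have next_exists: "\<exists>y. good y \<and> step x y" if gx: "good x" for x
  proof -
    obtain H K where x: "x = (H, K)" by (cases x)
    have g: "\<And>k. homogeneous_poly k (H k)" "\<And>k. k \<notin> E \<or> k = 0 \<or> K \<le> k \<Longrightarrow> H k = (\<lambda>z. 0)"
      "\<And>k z. z \<in> S2 \<Longrightarrow> cmod (H k z) \<le> real k" "\<And>z. z \<in> S2 \<Longrightarrow> cmod (S (H, K) z) < \<phi> z"
      using gx unfolding x good_def by auto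
    have cS: "continuous_on S2 (\<lambda>z. cmod (S (H, K) z))"
      unfolding S_def split_conv by (intro continuous_on_norm contS g)
    have lsc': "lower_semicontinuous_on S2 (\<lambda>z. \<phi> z - cmod (S (H, K) z))"
      by (rule lsc_diff_continuous[OF lsc cS])
    obtain \<psi> where \<psi>: "continuous_on S2 \<psi>" "\<And>z. z \<in> S2 \<Longrightarrow> 0 < \<psi> z \<and> \<psi> z \<le> \<phi> z - cmod (S (H, K) z)"
      "(\<integral>z. (\<phi> z - cmod (S (H, K) z))\<^sup>2 \<partial>\<sigma>) \<le> 2 * (\<integral>z. (\<psi> z)\<^sup>2 \<partial>\<sigma>)"
      by (rule exists_continuous_minorant[OF lsc' _ intd]) (use g(4) gx x in auto)
    obtain L K1 where L: "K + 1 \<le> K1" "\<And>k. homogeneous_poly k (L k)"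
      "\<And>k. k \<notin> E \<or> k < K + 1 \<or> K1 \<le> k \<Longrightarrow> L k = (\<lambda>z. 0)" "\<And>k z. z \<in> S2 \<Longrightarrow> cmod (L k z) \<le> real k"
      "\<And>z. z \<in> S2 \<Longrightarrow> cmod (\<Sum>k<K1. L k z) < \<psi> z"
      "gain * (\<integral>z. (\<psi> z)\<^sup>2 \<partial>\<sigma>) \<le> (\<integral>z. (cmod (\<Sum>k<K1. L k z))\<^sup>2 \<partial>\<sigma>)"
      by (rule exists_E_poly[OF \<psi>(1) _ LI, of "K + 1"]) (use \<psi>(2) in auto)
    define H' where "H' k = (if k < K then H k else L k)" for k
    have KK1: "K < K1" using L(1) by simp
    have "(\<Sum>k<K1. L k z) = (\<Sum>k\<in>{K..<K1}. L k z)" for z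
      by (rule sum.mono_neutral_right) (auto simp: L(3))
    also have "(\<Sum>k\<in>{K..<K1}. L k z) = (\<Sum>k\<in>{K..<K1}. H' k z)" for z
      by (rule sum.cong) (auto simp: H'_def)
    finally have sumL: "(\<Sum>k<K1. L k z) = (\<Sum>k\<in>{K..<K1}. H' k z)" for z .
    have sumH': "S (H', K1) z = S (H, K) z + (\<Sum>k<K1. L k z)" for z
    proof -
      have "(\<Sum>k<K1. H' k z) = (\<Sum>k<K. H' k z) + (\<Sum>k\<in>{K..<K1}. H' k z)"
        using sum.atLeastLessThan_concat[of 0 K K1 "\<lambda>k. H' k z"] KK1 by (simp add: atLeast0LessThan)
      thus ?thesis unfolding S_def split_conv sumL by (simp add: H'_def)
    qed
    have "good (H', K1)" unfolding good_def split_conv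
    proof (intro conjI allI ballI impI)
      show "homogeneous_poly k (H' k)" for k using g(1) L(2) by (simp add: H'_def)
      show "H' k = (\<lambda>z. 0)" if "k \<notin> E \<or> k = 0 \<or> K1 \<le> k" for k
        using that g(2)[of k] L(3)[of k] KK1 by (auto simp: H'_def)
      show "cmod (H' k z) \<le> real k" if "z \<in> S2" for k z using g(3) L(4) that by (simp add: H'_def)
      show "cmod (S (H', K1) z) < \<phi> z" if "z \<in> S2" for z
        using norm_triangle_ineq[of "S (H, K) z" "\<Sum>k<K1. L k z"] L(5)[OF that] \<psi>(2)[OF that]
        unfolding sumH' by linarith
    qed
    moreover have "step (H, K) (H', K1)" unfolding step_def split_conv
    proof (intro conjI allI impI)
      have "gain / 2 * (\<integral>z. (\<phi> z - cmod (S (H, K) z))\<^sup>2 \<partial>\<sigma>) \<le> gain / 2 * (2 * (\<integral>z. (\<psi> z)\<^sup>2 \<partial>\<sigma>))"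
        using gain_pos \<psi>(3) by (intro mult_left_mono) auto
      also have "\<dots> \<le> (\<integral>z. (cmod (\<Sum>k<K1. L k z))\<^sup>2 \<partial>\<sigma>)" using L(6) by simp
      finally show "gain / 2 * (\<integral>z. (\<phi> z - cmod (S (H, K) z))\<^sup>2 \<partial>\<sigma>) \<le> (\<integral>z. (cmod (\<Sum>k\<in>{K..<K1}. H' k z))\<^sup>2 \<partial>\<sigma>)"
        unfolding sumL .
    qed (use KK1 in \<open>auto simp: H'_def\<close>)
    ultimately show ?thesis unfolding x by blast
  qed
  have "good (\<lambda>k z. 0, 1)" unfolding good_def by (auto simp: S_def homogeneous_poly_zero pos)
  hence "\<exists>x. good x" by (rule exI)
  hence "\<exists>f. \<forall>n. good (f n) \<and> step (f n) (f (Suc n))"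
    by (rule dependent_nat_choice[of "\<lambda>n. good" "\<lambda>n. step"]) (rule next_exists)
  then obtain f where f: "\<And>n. good (f n)" "\<And>n. step (f n) (f (Suc n))" by blast
  define H where "H n = fst (f n)" for n
  define K where "K n = snd (f n)" for n
  have fHK: "f n = (H n, K n)" for n by (simp add: H_def K_def)
  have st: "K n < K (Suc n)" "\<And>k. k < K n \<Longrightarrow> H (Suc n) k = H n k"
    "gain / 2 * (\<integral>z. (\<phi> z - cmod (S (H n, K n) z))\<^sup>2 \<partial>\<sigma>) \<le> (\<integral>z. (cmod (\<Sum>k\<in>{K n..<K (Suc n)}. H (Suc n) k z))\<^sup>2 \<partial>\<sigma>)" for n
    using f(2)[of n] unfolding fHK step_def by auto
  have gd: "homogeneous_poly k (H n k)" "k \<notin> E \<or> k = 0 \<or> K n \<le> k \<Longrightarrow> H n k = (\<lambda>z. 0)"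
      "z \<in> S2 \<Longrightarrow> cmod (H n k z) \<le> real k" "z \<in> S2 \<Longrightarrow> cmod (S (H n, K n) z) < \<phi> z" for n k z
    using f(1)[of n] unfolding fHK good_def by auto
  have smK: "strict_mono K" using st(1) by (simp add: strict_mono_Suc_iff)
  have stable: "H n k = H m k" if "n \<le> m" "k < K n" for n m k
    using that(1)
  proof (induction m rule: dec_induct)
    case (step m)
    have "K n \<le> K m" using step(1) smK by (simp add: strict_mono_less_eq)
    thus ?case using step st(2)[of k m] that(2) by simp
  qed simp
  \<comment> \<open>Degree \<open>k\<close> is settled by stage \<open>Suc k\<close>, because
    \<open>K (Suc k) > k\<close>, and later stages leave it unchanged.\<close>
  define G where "G k = H (Suc k) k" for k
  have kK: "k < K (Suc k)" for k using seq_suble[OF smK, of "Suc k"] by linarith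
  have GH: "G k = H n k" if "k < K n" for k n
  proof (cases "n \<le> Suc k")
    case True from stable[OF this that] show ?thesis by (simp add: G_def)
  next
    case False
    hence "Suc k \<le> n" by simp
    from stable[OF this kK] show ?thesis by (simp add: G_def)
  qed
  have SG: "S (H n, K n) z = (\<Sum>k<K n. G k z)" for n z
    unfolding S_def split_conv by (rule sum.cong) (auto simp: GH)
  have hG: "homogeneous_poly k (G k)" for k unfolding G_def by (rule gd)
  have lt: "cmod (\<Sum>k<K n. G k z) < \<phi> z" if "z \<in> S2" for n z using gd(4)[OF that, of n] unfolding SG .
  define a where "a k = (\<integral>z. (cmod (G k z))\<^sup>2 \<partial>\<sigma>)" for k
  have a0: "a k \<ge> 0" for k unfolding a_def by (rule Bochner_Integration.integral_nonneg) simp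
  have sum_a: "(\<integral>z. (cmod (\<Sum>k\<in>I. G k z))\<^sup>2 \<partial>\<sigma>) = (\<Sum>k\<in>I. a k)" if "finite I" for I
    unfolding a_def by (rule integral_sum_homogeneous[OF that hG])
  have boundK: "(\<Sum>k<K n. a k) \<le> (\<integral>z. (\<phi> z)\<^sup>2 \<partial>\<sigma>)" for n
  proof -
    have "(\<Sum>k<K n. a k) = (\<integral>z. (cmod (\<Sum>k<K n. G k z))\<^sup>2 \<partial>\<sigma>)" by (rule sum_a[symmetric]) simp
    also have "\<dots> \<le> (\<integral>z. (\<phi> z)\<^sup>2 \<partial>\<sigma>)"
      by (rule integral_mono'[OF int]) (use lt less_imp_le in \<open>auto intro!: power_mono\<close>)
    finally show ?thesis .
  qed
  have bound: "(\<Sum>k<n. a k) \<le> (\<integral>z. (\<phi> z)\<^sup>2 \<partial>\<sigma>)" for n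
  proof -
    have "n \<le> K n" by (rule seq_suble[OF smK])
    hence "(\<Sum>k<n. a k) \<le> (\<Sum>k<K n. a k)" by (intro sum_mono2) (auto simp: a0)
    thus ?thesis using boundK[of n] by linarith
  qed
  define d where "d n = (\<integral>z. (\<phi> z - cmod (\<Sum>k<K n. G k z))\<^sup>2 \<partial>\<sigma>)" for n
  have gd': "gain / 2 * d n \<le> (\<Sum>k\<in>{K n..<K (Suc n)}. a k)" for n
  proof -
    have "(\<Sum>k\<in>{K n..<K (Suc n)}. H (Suc n) k z) = (\<Sum>k\<in>{K n..<K (Suc n)}. G k z)" for z
      by (rule sum.cong) (auto simp: GH)
    thus ?thesis using st(3)[of n] unfolding SG d_def by (simp add: sum_a)
  qed
  have d0: "d n \<ge> 0" for n unfolding d_def by (rule Bochner_Integration.integral_nonneg) simp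
  have "summable a"
    by (rule summableI_nonneg_bounded[OF a0 bound])
  hence "(\<lambda>n. \<Sum>k<n. a k) \<longlonglongrightarrow> suminf a" by (rule summable_LIMSEQ)
  hence lim: "(\<lambda>n. \<Sum>k<K n. a k) \<longlonglongrightarrow> suminf a"
    using LIMSEQ_subseq_LIMSEQ[OF _ smK] by (force simp: comp_def)
  have "(\<lambda>n. (\<Sum>k<K (Suc n). a k) - (\<Sum>k<K n. a k)) \<longlonglongrightarrow> suminf a - suminf a"
    by (intro tendsto_diff lim LIMSEQ_Suc[OF lim])
  moreover have "(\<Sum>k<K (Suc n). a k) - (\<Sum>k<K n. a k) = (\<Sum>k\<in>{K n..<K (Suc n)}. a k)" for n
    using sum.atLeastLessThan_concat[of 0 "K n" "K (Suc n)" a] st(1)[of n] by (simp add: atLeast0LessThan)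
  ultimately have "(\<lambda>n. \<Sum>k\<in>{K n..<K (Suc n)}. a k) \<longlonglongrightarrow> 0" by simp
  hence "(\<lambda>n. gain / 2 * d n) \<longlonglongrightarrow> 0"
    by (rule tendsto_sandwich[OF always_eventually always_eventually tendsto_const, rotated 2])
      (use gd' d0 gain_pos in auto)
  from tendsto_mult_left[OF this, of "2 / gain"] have dlim: "d \<longlonglongrightarrow> 0" using gain_pos by simp
  have nz: "\<exists>k. G k \<noteq> (\<lambda>z. 0)"
  proof (rule ccontr)
    assume "\<not> ?thesis"
    hence G0: "G k z = 0" for k z by simp
    have "d = (\<lambda>n. \<integral>z. (\<phi> z)\<^sup>2 \<partial>\<sigma>)" by (simp add: d_def[abs_def] G0)
    hence "(\<integral>z. (\<phi> z)\<^sup>2 \<partial>\<sigma>) = 0" using dlim by (simp only: LIMSEQ_const_iff)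
    hence "AE z in \<sigma>. (\<phi> z)\<^sup>2 = 0" using integral_nonneg_eq_0_iff_AE[OF int] by simp
    moreover have "AE z in \<sigma>. (\<phi> z)\<^sup>2 \<noteq> 0"
      by (rule AE_I2) (use pos in \<open>auto simp: less_imp_neq[symmetric]\<close>)
    ultimately have "AE z in \<sigma>. False" by eventually_elim simp
    thus False by simp
  qed
  show ?thesis
  proof (rule that[of K G])
    show "G k = (\<lambda>z. 0)" if "k \<notin> E \<or> k = 0" for k using gd(2) that unfolding G_def by blast
    show "cmod (G k z) \<le> real k" if "z \<in> S2" for k z unfolding G_def by (rule gd(3)[OF that])
    show "integrable \<sigma> (\<lambda>z. (\<phi> z - cmod (\<Sum>k<K n. G k z))\<^sup>2)" for n
      using intd[of "H n" "K n"] f(1)[of n] unfolding fHK SG by blast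
    show "(\<lambda>n. \<integral>z. (\<phi> z - cmod (\<Sum>k<K n. G k z))\<^sup>2 \<partial>\<sigma>) \<longlonglongrightarrow> 0" using dlim unfolding d_def[abs_def] .
    show "(\<Sum>k<n. \<integral>z. (cmod (G k z))\<^sup>2 \<partial>\<sigma>) \<le> (\<integral>z. (\<phi> z)\<^sup>2 \<partial>\<sigma>)" for n using bound[of n] unfolding a_def .
  qed (fact smK hG lt nz)+
qed

end

section \<open>Maximum principle on zero sets and openness\<close>

text \<open>Cauchy's formula on the circle of radius \<open>t\<close> writes the derivative as an
  integral over a compact interval whose integrand is jointly continuous in the point and the
  parameter; such integrals are continuous. The gap between \<open>t\<close> and \<open>s\<close>
  keeps the circle inside the domain.\<close>

lemma continuous_on_deriv_param:
  fixes K :: "'a::metric_space \<Rightarrow> complex \<Rightarrow> complex"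
  assumes cont: "continuous_on (A \<times> ball b s) (\<lambda>(x,y). K x y)"
    and hol: "\<And>x. x \<in> A \<Longrightarrow> K x holomorphic_on ball b s"
    and "0 < t" "t < s"
  shows "continuous_on (A \<times> ball b t) (\<lambda>(x,y). deriv (K x) y)"
proof -
  have sub: "cball b t \<subseteq> ball b s" using assms by auto
  define p where "p u = b + of_real t * exp (2 * of_real pi * \<i> * of_real u)" for u :: real
  define G where "G z u = K (fst z) (p u) / (p u - snd z)\<^sup>2 * (2 * of_real pi * \<i> * of_real t * exp (2 * of_real pi * \<i> * of_real u)) / (2 * of_real pi * \<i>)"
    for z :: "'a \<times> complex" and u
  have np: "cmod (p u - b) = t" for u unfolding p_def using \<open>0 < t\<close> by (simp add: norm_mult)
  have pb: "p u \<in> ball b s" for u using np[of u] \<open>t < s\<close> by (simp add: dist_norm norm_minus_commute)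
  have pne: "p u - y \<noteq> 0" if "y \<in> ball b t" for u y
    using that np[of u] by (auto simp: dist_norm norm_minus_commute)
  have cK: "continuous_on ((A \<times> ball b t) \<times> cbox 0 1) (\<lambda>z. K (fst (fst z)) (p (snd z)))"
  proof -
    have "continuous_on ((A \<times> ball b t) \<times> cbox 0 1) (\<lambda>z. (\<lambda>(x,y). K x y) (fst (fst z), p (snd z)))"
      by (rule continuous_on_compose2[OF cont]) (use pb in \<open>auto simp: p_def intro!: continuous_intros\<close>)
    thus ?thesis by simp
  qed
  have "continuous_on ((A \<times> ball b t) \<times> cbox 0 1) (\<lambda>(z,u). G z u)"
    unfolding G_def split_beta
    by (intro continuous_intros cK) (use pne in \<open>auto simp: p_def intro!: continuous_intros\<close>)
  hence c: "continuous_on (A \<times> ball b t) (\<lambda>z. integral (cbox 0 1) (G z))"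
    by (rule integral_continuous_on_param)
  have vd: "vector_derivative (circlepath b t) (at u within {0..1}) =
      2 * of_real pi * \<i> * of_real t * exp (2 * of_real pi * \<i> * of_real u)" if "u \<in> {0..1}" for u
    using vector_derivative_circlepath01[of u b t] that by simp
  have eq: "integral (cbox 0 1) (G (x,y)) = deriv (K x) y" if xy: "x \<in> A" "y \<in> ball b t" for x y
  proof -
    have h: "K x holomorphic_on ball b t" "continuous_on (cball b t) (K x)"
      using holomorphic_on_subset[OF hol[OF xy(1)]] sub
        holomorphic_on_imp_continuous_on[OF holomorphic_on_subset[OF hol[OF xy(1)] sub]]
      by (blast intro: ball_subset_cball[THEN subsetD])+
    have "((\<lambda>u. K x u / (u - y)\<^sup>2) has_contour_integral 2 * of_real pi * \<i> * deriv (K x) y) (circlepath b t)"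
    proof -
      note C = Cauchy_derivative_integral_circlepath[OF h(2,1) xy(2)]
      have "contour_integral (circlepath b t) (\<lambda>u. K x u / (u - y)\<^sup>2) = 2 * of_real pi * \<i> * deriv (K x) y"
        using DERIV_imp_deriv[OF C(2)] by simp
      thus ?thesis using has_contour_integral_integral[OF C(1)] by simp
    qed
    hence "((\<lambda>u. K x (circlepath b t u) / (circlepath b t u - y)\<^sup>2 * vector_derivative (circlepath b t) (at u within {0..1}))
        has_integral 2 * of_real pi * \<i> * deriv (K x) y) {0..1}"
      unfolding has_contour_integral_def .
    hence "((\<lambda>u. K x (circlepath b t u) / (circlepath b t u - y)\<^sup>2 * vector_derivative (circlepath b t) (at u within {0..1}) / (2 * of_real pi * \<i>))
        has_integral 2 * of_real pi * \<i> * deriv (K x) y / (2 * of_real pi * \<i>)) {0..1}"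
      by (rule has_integral_divide)
    hence "(G (x,y) has_integral deriv (K x) y) {0..1}"
      by (rule has_integral_eq_rhs[OF has_integral_eq, rotated])
        (auto simp: G_def p_def vd, simp_all add: circlepath)
    thus ?thesis by (simp add: integral_unique)
  qed
  show ?thesis
    using c by (rule continuous_on_eq) (auto simp: eq[unfolded cbox_interval])
qed

text \<open>Differentiation under the integral sign requires a jointly continuous derivative of the
  integrand, which is available on strictly smaller balls. Holomorphy is local, so these exhaust the
  whole ball.\<close>

lemma holomorphic_contour_integral_param:
  fixes K :: "complex \<Rightarrow> complex \<Rightarrow> complex"
  assumes cont: "continuous_on (sphere a r \<times> ball b s) (\<lambda>(x,y). K x y)"
    and hol: "\<And>x. x \<in> sphere a r \<Longrightarrow> K x holomorphic_on ball b s" and "0 \<le> r"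
  shows "(\<lambda>y. contour_integral (circlepath a r) (\<lambda>x. K x y)) holomorphic_on ball b s"
proof -
  define p where "p u = a + of_real r * exp (2 * of_real pi * \<i> * of_real u)" for u :: real
  define p' where "p' u = 2 * of_real pi * \<i> * of_real r * exp (2 * of_real pi * \<i> * of_real u)" for u :: real
  have np: "p u \<in> sphere a r" for u unfolding p_def using \<open>0 \<le> r\<close> by (simp add: dist_norm norm_mult)
  have eq: "contour_integral (circlepath a r) (\<lambda>x. K x y) = integral (cbox 0 1) (\<lambda>u. K (p u) y * p' u)" for y
    unfolding contour_integral_integral cbox_interval
    by (intro integral_cong) (simp only: vector_derivative_circlepath, simp add: p_def p'_def circlepath)
  have cp: "continuous_on X p" "continuous_on X p'" for X unfolding p_def p'_def by (intro continuous_intros)+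
  have part: "(\<lambda>y. integral (cbox 0 1) (\<lambda>u. K (p u) y * p' u)) holomorphic_on ball b t" if t: "0 < t" "t < s" for t
  proof (rule leibniz_rule_holomorphic[where fx = "\<lambda>y u. deriv (K (p u)) y * p' u"])
    fix y and u :: real assume y: "y \<in> ball b t"
    have "(K (p u) has_field_derivative deriv (K (p u)) y) (at y)"
      using y t by (intro holomorphic_derivI[OF hol[OF np]]) auto
    thus "((\<lambda>y. K (p u) y * p' u) has_field_derivative deriv (K (p u)) y * p' u) (at y within ball b t)"
      by (rule has_field_derivative_at_within[OF DERIV_cmult_right])
  next
    fix y assume y: "y \<in> ball b t"
    have "continuous_on (cbox 0 1) (\<lambda>u. (\<lambda>(x,y). K x y) (p u, y))"
      by (rule continuous_on_compose2[OF cont]) (use np y t in \<open>auto intro!: continuous_intros cp\<close>)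
    hence "continuous_on (cbox 0 1) (\<lambda>u. K (p u) y)" by simp
    thus "(\<lambda>u. K (p u) y * p' u) integrable_on cbox 0 1"
      by (intro integrable_continuous continuous_intros cp)
  next
    have cp2: "continuous_on X (\<lambda>z. p (snd z))" "continuous_on X (\<lambda>z. p' (snd z))" for X :: "(complex \<times> real) set"
      unfolding p_def p'_def by (intro continuous_intros)+
    have "continuous_on (ball b t \<times> cbox 0 1) (\<lambda>z. (\<lambda>(x,y). deriv (K x) y) (p (snd z), fst z))"
      by (rule continuous_on_compose2[OF continuous_on_deriv_param[OF cont hol t]])
        (use np in \<open>auto intro!: continuous_intros cp2\<close>)
    hence cd: "continuous_on (ball b t \<times> cbox 0 1) (\<lambda>z. deriv (K (p (snd z))) (fst z))" by simp
    show "continuous_on (ball b t \<times> cbox 0 1) (\<lambda>(y, u). deriv (K (p u)) y * p' u)"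
      unfolding split_beta by (intro continuous_on_mult cd cp2)
  qed simp
  show ?thesis unfolding eq holomorphic_on_open[OF open_ball]
  proof
    fix y assume y: "y \<in> ball b s"
    define t where "t = (dist b y + s) / 2"
    have "0 < t" "t < s" "y \<in> ball b t" using y zero_le_dist[of b y] by (auto simp: t_def simp del: zero_le_dist)
    with part[of t] show "\<exists>f'. ((\<lambda>y. integral (cbox 0 1) (\<lambda>u. K (p u) y * p' u)) has_field_derivative f') (at y)"
      unfolding holomorphic_on_open[OF open_ball] by blast
  qed
qed

text \<open>A maximum principle on the curve h = 0, which may be singular at the maximum. For y near
  b the curve has finitely many points above y in a small disc around a, and the sum
  \<open>\<Psi> y\<close> of H - 1 over them, with multiplicities, is holomorphic in y. Its real
  part is nonpositive and vanishes at b, so \<open>exp \<Psi>\<close> attains its maximal modulus 1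
  at b and is constant. Hence each summand has real part 0, and H = 1 at every such point. The
  conclusion records a point to the right of b, in order to contradict an extremal choice of
  b.\<close>

lemma zero_set_max_local:
  fixes h H :: "complex \<Rightarrow> complex \<Rightarrow> complex"
  assumes r: "0 < r"
    and ch: "continuous_on (ball a r \<times> ball b r) (\<lambda>(x,y). h x y)"
    and cH: "continuous_on (ball a r \<times> ball b r) (\<lambda>(x,y). H x y)"
    and h1: "\<And>y. y \<in> ball b r \<Longrightarrow> (\<lambda>x. h x y) holomorphic_on ball a r"
    and h2: "\<And>x. x \<in> ball a r \<Longrightarrow> h x holomorphic_on ball b r"
    and H1: "\<And>y. y \<in> ball b r \<Longrightarrow> (\<lambda>x. H x y) holomorphic_on ball a r"
    and H2: "\<And>x. x \<in> ball a r \<Longrightarrow> H x holomorphic_on ball b r"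
    and hab: "h a b = 0" and Hab: "H a b = 1"
    and le: "\<And>x y. x \<in> ball a r \<Longrightarrow> y \<in> ball b r \<Longrightarrow> h x y = 0 \<Longrightarrow> cmod (H x y) \<le> 1"
    and x0: "x0 \<in> ball a r" "h x0 b \<noteq> 0"
  obtains x y where "x \<in> ball a r" "y \<in> ball b r" "Re b < Re y" "h x y = 0" "H x y = 1"
proof -
  obtain r' where r': "0 < r'" "ball a r' \<subseteq> ball a r" and iso: "\<And>z. z \<in> ball a r' - {a} \<Longrightarrow> h z b \<noteq> 0"
  proof (rule isolated_zeros[OF h1, of b a x0])
  qed (use r hab x0 in auto)
  have r'r: "r' \<le> r" using r'(1,2) by (simp add: ball_subset_ball_iff)
  \<comment> \<open>Zeros are summed inside radius \<open>r1\<close>. The disc of radius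
    \<open>r3\<close> is the domain for the argument principle, and its boundary is the circle for
    Cauchy's derivative formula.\<close>
  define r1 where "r1 = r' / 2"
  define r3 where "r3 = 3 * r' / 4"
  have r1: "0 < r1" "r1 < r3" "r3 < r" "r1 < r'" using r'(1) r'r by (auto simp: r1_def r3_def)
  have sub1: "cball a r1 \<subseteq> ball a r" "sphere a r1 \<subseteq> ball a r" "ball a r3 \<subseteq> ball a r" "cball a r3 \<subseteq> ball a r"
    using r1 by auto
  have hb0: "h x b \<noteq> 0" if "x \<in> sphere a r1" for x
    using that r1 by (intro iso) auto
  have contx: "continuous_on X (\<lambda>x. h x y)" if "X \<subseteq> ball a r" "y \<in> ball b r" for X y
    using holomorphic_on_imp_continuous_on[OF holomorphic_on_subset[OF h1[OF that(2)] that(1)]] .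
  have "continuous_on (sphere a r1) (\<lambda>x. cmod (h x b))"
    using r by (intro continuous_on_norm contx sub1) auto
  then obtain \<kappa>x where kx: "\<kappa>x \<in> sphere a r1" "\<And>x. x \<in> sphere a r1 \<Longrightarrow> cmod (h \<kappa>x b) \<le> cmod (h x b)"
    using continuous_attains_inf[of "sphere a r1" "\<lambda>x. cmod (h x b)"] r1 by (auto simp: sphere_eq_empty)
  define \<kappa> where "\<kappa> = cmod (h \<kappa>x b)"
  have \<kappa>: "\<kappa> > 0" "\<And>x. x \<in> sphere a r1 \<Longrightarrow> \<kappa> \<le> cmod (h x b)" using hb0 kx by (auto simp: \<kappa>_def)
  have "uniformly_continuous_on (cball a r1 \<times> cball b (r/2)) (\<lambda>(x,y). h x y)"
    by (intro compact_uniformly_continuous continuous_on_subset[OF ch] compact_Times compact_cball)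
      (use sub1 r in \<open>auto simp: subset_iff\<close>)
  from this[unfolded uniformly_continuous_on_def, rule_format, OF half_gt_zero[OF \<kappa>(1)]]
  obtain d where d: "d > 0" "\<And>z z'. z \<in> cball a r1 \<times> cball b (r/2) \<Longrightarrow> z' \<in> cball a r1 \<times> cball b (r/2) \<Longrightarrow>
      dist z' z < d \<Longrightarrow> dist (case_prod h z') (case_prod h z) < \<kappa>/2" by blast
  define s where "s = min d (r/2)"
  have s: "0 < s" "s \<le> d" "s < r" using d r by (auto simp: s_def)
  have sb: "ball b s \<subseteq> ball b r" using s by auto
  have close: "dist (h x y) (h x b) < \<kappa>/2" if "x \<in> cball a r1" "y \<in> ball b s" for x y
    using d(2)[of "(x,b)" "(x,y)"] that r s by (auto simp: s_def dist_Pair_Pair dist_commute)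
  have big: "\<kappa>/2 < cmod (h x y)" if "x \<in> sphere a r1" "y \<in> ball b s" for x y
  proof -
    have "cmod (h x b) - cmod (h x y) \<le> dist (h x y) (h x b)"
      by (simp add: dist_norm norm_minus_commute norm_triangle_ineq2)
    thus ?thesis using \<kappa>(2)[OF that(1)] close[of x y] that by auto
  qed
  have hne: "h x y \<noteq> 0" if "x \<in> sphere a r1" "y \<in> ball b s" for x y
    using big[OF that] \<kappa>(1) by auto
  \<comment> \<open>Zeros persist: without one, the maximum principle for \<open>1 / h\<close> would
    give \<open>\<kappa>/2 \<le> cmod (h a y)\<close>, although \<open>h a y\<close> is close to
    \<open>h a b = 0\<close>.\<close>
  have ex: "\<exists>x\<in>ball a r1. h x y = 0" if y: "y \<in> ball b s" for y
  proof (rule ccontr)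
    assume no: "\<not> (\<exists>x\<in>ball a r1. h x y = 0)"
    hence nz: "h x y \<noteq> 0" if "x \<in> cball a r1" for x
      using that hne[OF _ y, of x] by (cases "dist a x = r1") auto
    have yr: "y \<in> ball b r" using y sb by blast
    have "cmod (inverse (h a y)) \<le> inverse (\<kappa>/2)"
    proof (rule maximum_modulus_frontier[of "\<lambda>x. inverse (h x y)" "ball a r1"])
      show "(\<lambda>x. inverse (h x y)) holomorphic_on interior (ball a r1)"
        using nz holomorphic_on_subset[OF h1[OF yr] subset_trans[OF ball_subset_cball sub1(1)]]
        by (intro holomorphic_intros) auto
      show "continuous_on (closure (ball a r1)) (\<lambda>x. inverse (h x y))"
        using r1 nz sub1 yr by (intro continuous_on_inverse contx) auto
      show "cmod (inverse (h z y)) \<le> inverse (\<kappa>/2)" if "z \<in> frontier (ball a r1)" for z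
      proof -
        have "z \<in> sphere a r1" using that r1 by (simp add: frontier_ball)
        from less_imp_le[OF big[OF this y]] show ?thesis
          unfolding norm_inverse using \<kappa>(1) by (intro le_imp_inverse_le) auto
      qed
    qed (use r1 in auto)
    moreover have "cmod (h a y) < \<kappa>/2" using close[of a y] y r1 hab by (simp add: dist_norm)
    moreover have "h a y \<noteq> 0" using nz[of a] r1 by simp
    ultimately show False using less_imp_inverse_less[of "cmod (h a y)" "\<kappa>/2"] by (simp add: norm_inverse)
  qed
  \<comment> \<open>The logarithmic derivative of \<open>h\<close> in \<open>x\<close>, weighted
    with \<open>H - 1\<close>; by the argument principle its contour integral is the weighted sum
    over the zeros.\<close>
  define I where "I x y = deriv (\<lambda>u. h u y) x * (H x y - 1) / h x y" for x y
  define \<Psi> where "\<Psi> y = contour_integral (circlepath a r1) (\<lambda>x. I x y) / (2 * of_real pi * \<i>)" for y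
  have "continuous_on (ball b r \<times> ball a r3) (\<lambda>(y,x). deriv (\<lambda>u. h u y) x)"
  proof (rule continuous_on_deriv_param[of _ _ _ "\<lambda>y u. h u y"])
    have "continuous_on (ball b r \<times> ball a r) (\<lambda>z. (\<lambda>(x,y). h x y) (snd z, fst z))"
      by (rule continuous_on_compose2[OF ch]) (auto intro!: continuous_intros)
    thus "continuous_on (ball b r \<times> ball a r) (\<lambda>(y,u). h u y)" by (simp add: split_beta)
  qed (use h1 r1 in auto)
  hence "continuous_on (sphere a r1 \<times> ball b s) (\<lambda>z. (\<lambda>(y,x). deriv (\<lambda>u. h u y) x) (snd z, fst z))"
    by (rule continuous_on_compose2) (use r1 sb in \<open>auto intro!: continuous_intros\<close>)
  hence cd: "continuous_on (sphere a r1 \<times> ball b s) (\<lambda>z. deriv (\<lambda>u. h u (snd z)) (fst z))" by simp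
  have subp: "sphere a r1 \<times> ball b s \<subseteq> ball a r \<times> ball b r" using sub1 sb by auto
  have cI: "continuous_on (sphere a r1 \<times> ball b s) (\<lambda>(x,y). I x y)"
    unfolding I_def split_beta
    using continuous_on_subset[OF ch subp] continuous_on_subset[OF cH subp] hne
    by (intro continuous_on_divide continuous_on_mult continuous_on_diff cd continuous_on_const)
      (auto simp: split_beta)
  \<comment> \<open>The derivative in \<open>x\<close> depends holomorphically on \<open>y\<close>
    because it is itself a contour integral, over the circle of radius \<open>r3\<close>, of
    functions holomorphic in \<open>y\<close>.\<close>
  have holD: "(\<lambda>y. deriv (\<lambda>u. h u y) x) holomorphic_on ball b s" if x: "x \<in> sphere a r1" for x
  proof -
    have x3: "x \<in> ball a r3" using x r1 by auto
    have "deriv (\<lambda>u. h u y) x = contour_integral (circlepath a r3) (\<lambda>u. h u y / (u - x)\<^sup>2) / (2 * of_real pi * \<i>)"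
      if "y \<in> ball b s" for y
    proof -
      have yr: "y \<in> ball b r" using that sb by blast
      show ?thesis
        using DERIV_imp_deriv[OF Cauchy_derivative_integral_circlepath(2)[OF contx[OF sub1(4) yr]
              holomorphic_on_subset[OF h1[OF yr] sub1(3)] x3]] by simp
    qed
    note D = this
    have "(\<lambda>y. contour_integral (circlepath a r3) (\<lambda>u. h u y / (u - x)\<^sup>2)) holomorphic_on ball b s"
    proof (rule holomorphic_contour_integral_param)
      have ne: "u - x \<noteq> 0" if "u \<in> sphere a r3" for u using that x3 by auto
      have "sphere a r3 \<times> ball b s \<subseteq> ball a r \<times> ball b r" using r1 sb by auto
      from continuous_on_subset[OF ch this]
      show "continuous_on (sphere a r3 \<times> ball b s) (\<lambda>(u, y). h u y / (u - x)\<^sup>2)"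
        using ne unfolding split_beta by (intro continuous_intros) auto
      show "(\<lambda>y. h u y / (u - x)\<^sup>2) holomorphic_on ball b s" if "u \<in> sphere a r3" for u
        using ne[OF that] that r1 holomorphic_on_subset[OF h2 sb, of u] by (intro holomorphic_intros) auto
    qed (use r1 in auto)
    hence "(\<lambda>y. contour_integral (circlepath a r3) (\<lambda>u. h u y / (u - x)\<^sup>2) / (2 * of_real pi * \<i>)) holomorphic_on ball b s"
      by (rule holomorphic_on_divide[OF _ holomorphic_on_const]) simp
    thus ?thesis by (rule holomorphic_transform) (simp add: D)
  qed
  have hol\<Psi>: "\<Psi> holomorphic_on ball b s"
    unfolding \<Psi>_def
  proof (intro holomorphic_intros holomorphic_contour_integral_param cI)
    show "I x holomorphic_on ball b s" if x: "x \<in> sphere a r1" for x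
    proof -
      have xr: "x \<in> ball a r" using x sub1 by blast
      show ?thesis unfolding I_def using hne[OF x] holomorphic_on_subset[OF h2[OF xr] sb]
          holomorphic_on_subset[OF H2[OF xr] sb]
        by (intro holomorphic_on_divide holomorphic_on_mult holomorphic_on_diff holD[OF x] holomorphic_on_const) auto
    qed
  qed (use r1 in auto)
  define Z where "Z y = {w \<in> ball a r3. h w y = 0}" for y
  define n where "n y w = zorder (\<lambda>x. h x y) w" for y w
  have main: "finite (Z y) \<and> (\<forall>w\<in>Z y. n y w > 0) \<and>
      Re (\<Psi> y) = (\<Sum>w\<in>{w \<in> Z y. w \<in> ball a r1}. (Re (H w y) - 1) * of_int (n y w))" if y: "y \<in> ball b s" for y
  proof -
    have yr: "y \<in> ball b r" using y sb by blast
    have ne: "h (a + of_real r1) y \<noteq> 0" using hne[OF _ y] r1 by (simp add: dist_norm)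
    have in3: "a + of_real r1 \<in> ball a r3" "a + of_real r1 \<in> ball a r" using r1 by (auto simp: dist_norm)
    have "\<not> (\<lambda>x. h x y) constant_on ball a r"
    proof
      assume "(\<lambda>x. h x y) constant_on ball a r"
      moreover obtain x where "x \<in> ball a r1" "h x y = 0" using ex[OF y] by blast
      ultimately show False using ne in3 sub1 r1 unfolding constant_on_def by (metis ball_subset_cball subsetD)
    qed
    from holomorphic_compact_finite_zeros[OF h1[OF yr] open_ball _ compact_cball sub1(4) this]
    have "finite {w \<in> cball a r3. h w y = 0}" by simp
    moreover have "Z y \<subseteq> {w \<in> cball a r3. h w y = 0}" unfolding Z_def by auto
    ultimately have fin: "finite (Z y)" by (rule rev_finite_subset)
    have pos: "n y w > 0" if "w \<in> Z y" for w
    proof -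
      have "w \<in> ball a r3" "h w y = 0" using that by (auto simp: Z_def)
      thus ?thesis
        using zorder_exist_zero[of "\<lambda>x. h x y" "ball a r3" w] holomorphic_on_subset[OF h1[OF yr] sub1(3)] ne in3
        unfolding n_def by (metis open_ball connected_ball)
    qed
    have pz: "{w \<in> ball a r3. h w y = 0 \<or> w \<in> {}} = Z y" unfolding Z_def by simp
    have disj: "sphere a r1 \<inter> Z y = {}" using hne[OF _ y] unfolding Z_def by auto
    have "contour_integral (circlepath a r1) (\<lambda>x. I x y) = 2 * pi * \<i> *
        (\<Sum>p\<in>Z y. winding_number (circlepath a r1) p * (H p y - 1) * of_int (zorder (\<lambda>x. h x y) p))"
      unfolding I_def
    proof (rule argument_principle[of "ball a r3" "\<lambda>x. h x y" "{}" "\<lambda>x. H x y - 1" "circlepath a r1", unfolded pz])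
      show "(\<lambda>x. h x y) holomorphic_on ball a r3 - {}" using holomorphic_on_subset[OF h1[OF yr] sub1(3)] by simp
      show "(\<lambda>x. H x y - 1) holomorphic_on ball a r3"
        using holomorphic_on_subset[OF H1[OF yr] sub1(3)] by (intro holomorphic_intros)
      show "path_image (circlepath a r1) \<subseteq> ball a r3 - Z y" using disj r1 by auto
      show "\<forall>z. z \<notin> ball a r3 \<longrightarrow> winding_number (circlepath a r1) z = 0"
      proof (intro allI impI)
        fix z assume "z \<notin> ball a r3"
        thus "winding_number (circlepath a r1) z = 0"
          using r1 by (intro winding_number_zero_outside[where s = "cball a r1"]) auto
      qed
    qed (use fin in auto)
    hence "\<Psi> y = (\<Sum>p\<in>Z y. winding_number (circlepath a r1) p * (H p y - 1) * of_int (n y p))"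
      unfolding \<Psi>_def n_def by simp
    also have "\<dots> = (\<Sum>p\<in>Z y. if p \<in> ball a r1 then (H p y - 1) * of_int (n y p) else 0)"
    proof (rule sum.cong[OF refl])
      fix p assume p: "p \<in> Z y"
      show "winding_number (circlepath a r1) p * (H p y - 1) * of_int (n y p) =
          (if p \<in> ball a r1 then (H p y - 1) * of_int (n y p) else 0)"
      proof (cases "p \<in> ball a r1")
        case True thus ?thesis by (simp add: winding_number_circlepath dist_norm norm_minus_commute)
      next
        case False
        hence "p \<notin> cball a r1" using disj p by auto
        hence "winding_number (circlepath a r1) p = 0"
          using r1 by (intro winding_number_zero_outside[where s = "cball a r1"]) auto
        thus ?thesis using False by simp
      qed
    qed
    also have "\<dots> = (\<Sum>p\<in>{w \<in> Z y. w \<in> ball a r1}. (H p y - 1) * of_int (n y p))"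
      using fin by (simp add: sum.inter_filter)
    finally have "Re (\<Psi> y) = (\<Sum>w\<in>{w \<in> Z y. w \<in> ball a r1}. (Re (H w y) - 1) * of_int (n y w))"
      by simp
    thus ?thesis using fin pos by blast
  qed
  have termle: "(Re (H w y) - 1) * of_int (n y w) \<le> 0" if y: "y \<in> ball b s" and w: "w \<in> Z y" for w y
  proof -
    have "w \<in> ball a r" "y \<in> ball b r" "h w y = 0" using w y sub1 sb unfolding Z_def by blast+
    hence "Re (H w y) \<le> 1" using le[of w y] complex_Re_le_cmod[of "H w y"] by linarith
    moreover have "n y w > 0" using main[OF y] w by blast
    ultimately show ?thesis by (simp add: mult_nonpos_nonneg)
  qed
  have Re_le: "Re (\<Psi> y) \<le> 0" if y: "y \<in> ball b s" for y
  proof -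
    have "Re (\<Psi> y) = (\<Sum>w\<in>{w \<in> Z y. w \<in> ball a r1}. (Re (H w y) - 1) * of_int (n y w))" using main[OF y] by blast
    also have "\<dots> \<le> 0" by (rule sum_nonpos) (use termle[OF y] in blast)
    finally show ?thesis .
  qed
  have bs: "b \<in> ball b s" using s by simp
  have "w = a" if "w \<in> {w \<in> Z b. w \<in> ball a r1}" for w
  proof (rule ccontr)
    assume "w \<noteq> a"
    hence "w \<in> ball a r' - {a}" using that r1 by auto
    from iso[OF this] show False using that by (simp add: Z_def)
  qed
  note only = this
  \<comment> \<open>Above \<open>b\<close> the point \<open>a\<close> is the only zero in the disc,
    since \<open>r1 < r'\<close>, and \<open>H a b = 1\<close> kills its term.\<close>
  have "(\<Sum>w\<in>{w \<in> Z b. w \<in> ball a r1}. (Re (H w b) - 1) * of_int (n b w)) = 0"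
  proof (rule sum.neutral, rule ballI)
    fix w assume "w \<in> {w \<in> Z b. w \<in> ball a r1}"
    from only[OF this] show "(Re (H w b) - 1) * of_int (n b w) = 0" using Hab by simp
  qed
  hence "Re (\<Psi> b) = 0" using main[OF bs] by linarith
  hence "cmod (exp (\<Psi> b)) = 1" by simp
  hence "(\<lambda>y. exp (\<Psi> y)) constant_on ball b s"
    by (intro maximum_modulus_principle[of _ _ "ball b s" b]) (use hol\<Psi> Re_le bs in \<open>auto intro: holomorphic_intros\<close>)
  define y where "y = b + of_real (s/2)"
  have y: "y \<in> ball b s" "Re b < Re y" using s by (auto simp: y_def dist_norm)
  have "cmod (exp (\<Psi> y)) = 1"
    using \<open>(\<lambda>y. exp (\<Psi> y)) constant_on ball b s\<close> \<open>cmod (exp (\<Psi> b)) = 1\<close> y(1) bs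
    unfolding constant_on_def by metis
  hence Re0: "Re (\<Psi> y) = 0" by simp
  obtain x where x: "x \<in> ball a r1" "h x y = 0" using ex[OF y(1)] by blast
  have xZ: "x \<in> {w \<in> Z y. w \<in> ball a r1}" using x r1 unfolding Z_def by auto
  define t where "t w = (Re (H w y) - 1) * of_int (n y w)" for w
  have "0 = sum t {w \<in> Z y. w \<in> ball a r1}" using main[OF y(1)] Re0 unfolding t_def by linarith
  also have "\<dots> = t x + sum t ({w \<in> Z y. w \<in> ball a r1} - {x})"
    using main[OF y(1)] xZ by (intro sum.remove) auto
  also have "sum t ({w \<in> Z y. w \<in> ball a r1} - {x}) \<le> 0"
    by (rule sum_nonpos) (use termle[OF y(1)] in \<open>auto simp: t_def\<close>)
  finally have "t x = 0" using termle[OF y(1), of x] xZ unfolding t_def by auto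
  moreover have "n y x > 0" using main[OF y(1)] xZ by blast
  ultimately have R1: "Re (H x y) = 1" by (simp add: t_def)
  have xr: "x \<in> ball a r" "y \<in> ball b r" using x y sub1 sb r1 by auto
  have "(Re (H x y))\<^sup>2 + (Im (H x y))\<^sup>2 \<le> 1"
    using le[OF xr x(2)] by (simp add: cmod_power2[symmetric] abs_square_le_1)
  hence "H x y = 1" using R1 by (simp add: complex_eq_iff)
  with xr y x show ?thesis using that by blast
qed

section \<open>Complex lines, minima on zero sets, openness\<close>

definition pt :: "complex \<Rightarrow> complex \<Rightarrow> C2" where "pt x y = (\<chi> i. if i = 1 then x else y)"

lemma pt_nth [simp]: "pt x y $ 1 = x" "pt x y $ 2 = y" by (simp_all add: pt_def)

lemma pt_collapse [simp]: "pt (z $ 1) (z $ 2) = z" by (simp add: vec_eq_iff forall_2)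

lemma pt_sum: "pt x y = x *s axis 1 1 + y *s axis 2 1"
  by (simp add: vec_eq_iff forall_2 axis_def)

lemma dist_pt: "dist (pt x y) (pt x' y') \<le> dist x x' + dist y y'"
proof -
  have "norm (pt x y - pt x' y') \<le> (\<Sum>i\<in>UNIV. norm ((pt x y - pt x' y') $ i))"
    unfolding norm_vec_def by (rule L2_set_le_sum) simp
  thus ?thesis by (simp add: dist_norm sum_2)
qed

lemma continuous_on_pt: "continuous_on A (\<lambda>z. pt (fst z) (snd z))"
  unfolding pt_def
proof (rule continuous_on_vec_lambda)
  fix i :: 2
  show "continuous_on A (\<lambda>z. if i = 1 then fst z else snd z)"
    by (cases "i = 1") (auto intro!: continuous_intros)
qed

text \<open>Restriction to complex lines is the gateway to one-variable theory; complex linearity of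
  \<open>D\<close> turns the real derivative into a complex one.\<close>

lemma has_field_derivative_line:
  fixes F :: "C2 \<Rightarrow> complex"
  assumes D: "(F has_derivative D) (at (z + t *s v))" "\<And>c v. D (c *s v) = c * D v"
  shows "((\<lambda>t. F (z + t *s v)) has_field_derivative D v) (at t)"
proof -
  have "linear (\<lambda>t::complex. t *s v)"
    by (rule linearI) (simp_all add: vec_eq_iff forall_2 algebra_simps)
  hence "((\<lambda>t. t *s v) has_derivative (\<lambda>t. t *s v)) (at t)"
    by (intro bounded_linear_imp_has_derivative) (simp add: linear_conv_bounded_linear)
  hence "((\<lambda>t. z + t *s v) has_derivative (\<lambda>t. 0 + t *s v)) (at t)"
    by (intro has_derivative_add has_derivative_const)
  from has_derivative_compose[OF this D(1)]
  have "((\<lambda>t. F (z + t *s v)) has_derivative (\<lambda>t. t * D v)) (at t)"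
    by (simp add: D(2))
  moreover have "(\<lambda>t. t * D v) = (*) (D v)" by (simp add: fun_eq_iff mult.commute)
  ultimately show ?thesis unfolding has_field_derivative_def by simp
qed

lemma holo_on_line:
  assumes "holo_on F U" "z + t *s v \<in> U"
  obtains D where "((\<lambda>t. F (z + t *s v)) has_field_derivative D) (at t)"
  using assms has_field_derivative_line[of F _ z t v] that unfolding holo_on_def by blast

lemma holo_on_holomorphic_line:
  assumes "holo_on F U" "open A" "\<And>t. t \<in> A \<Longrightarrow> z + t *s v \<in> U"
  shows "(\<lambda>t. F (z + t *s v)) holomorphic_on A"
  unfolding holomorphic_on_open[OF assms(2)]
  using holo_on_line[OF assms(1) assms(3)] by metis

lemma holo_on_continuous: "holo_on F U \<Longrightarrow> continuous_on U F"
  unfolding holo_on_def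
  by (intro continuous_at_imp_continuous_on) (blast intro: has_derivative_continuous)

text \<open>A minimum principle for |g - s| on the zero set of h. Minimisers may fill a whole piece
  of that set, so an extremal one is taken: largest real part of the second coordinate, then of the
  first. At an interior minimiser q the quotient \<open>c / (g - s)\<close> has on the zero set
  maximal modulus 1. If h vanishes on the disc through q in the first coordinate direction, the
  ordinary maximum principle yields a minimiser with larger first coordinate; otherwise
  \<open>zero_set_max_local\<close> yields one with larger second coordinate. Either contradicts the
  choice of q.\<close>

lemma zero_set_min_frontier:
  assumes h: "holo_on h UNIV" and g: "holo_on g UNIV"
    and W: "open W" "bounded W" and w0: "w0 \<in> W" "h w0 = 0"
    and ns: "\<And>w. w \<in> closure W \<Longrightarrow> h w = 0 \<Longrightarrow> g w \<noteq> s"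
  obtains q where "q \<in> frontier W" "h q = 0" "cmod (g q - s) \<le> cmod (g w0 - s)"
proof -
  have ch: "continuous_on X h" and cg: "continuous_on X g" for X
    using holo_on_continuous[OF h] holo_on_continuous[OF g] continuous_on_subset by blast+
  define A where "A = closure W \<inter> h -` {0}"
  have "closed A" unfolding A_def
    by (intro closed_Int closed_closure continuous_closed_vimage) (use ch[of UNIV] in \<open>auto simp: continuous_on_eq_continuous_at\<close>)
  moreover have "bounded A" using W(2) unfolding A_def by (meson bounded_Int bounded_closure)
  ultimately have cA: "compact A" using compact_eq_bounded_closed by blast
  have w0A: "w0 \<in> A" unfolding A_def using w0 closure_subset by auto
  have "continuous_on A (\<lambda>w. cmod (g w - s))" by (intro continuous_intros cg)
  then obtain p where p: "p \<in> A" "\<And>w. w \<in> A \<Longrightarrow> cmod (g p - s) \<le> cmod (g w - s)"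
    using continuous_attains_inf[OF cA] w0A by blast
  define m where "m = cmod (g p - s)"
  define Q where "Q = A \<inter> {w. cmod (g w - s) = m}"
  have comp_max: "\<exists>q\<in>X. \<forall>w\<in>X. Re (w $ i) \<le> Re (q $ i)" if "compact X" "X \<noteq> {}" for X :: "C2 set" and i
  proof -
    have "continuous_on X (\<lambda>w. Re (w $ i))" by (intro continuous_intros)
    thus ?thesis using continuous_attains_sup[OF that] by blast
  qed
  have "closed {w. cmod (g w - s) = m}" by (intro closed_Collect_eq continuous_intros cg)
  hence cQ: "compact Q" unfolding Q_def by (intro compact_Int_closed cA)
  have "p \<in> Q" using p by (simp add: Q_def m_def)
  then obtain q2 where q2: "q2 \<in> Q" "\<And>w. w \<in> Q \<Longrightarrow> Re (w $ 2) \<le> Re (q2 $ 2)"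
    using comp_max[OF cQ, of 2] by blast
  define Q' where "Q' = Q \<inter> {w. Re (w $ 2) = Re (q2 $ 2)}"
  have "closed {w::C2. Re (w $ 2) = Re (q2 $ 2)}" by (intro closed_Collect_eq continuous_intros)
  hence "compact Q'" unfolding Q'_def by (intro compact_Int_closed cQ)
  moreover have "q2 \<in> Q'" using q2 by (simp add: Q'_def)
  ultimately obtain q where q: "q \<in> Q'" "\<And>w. w \<in> Q' \<Longrightarrow> Re (w $ 1) \<le> Re (q $ 1)"
    using comp_max[of Q' 1] by blast
  have qQ: "q \<in> Q" "\<And>w. w \<in> Q \<Longrightarrow> Re (w $ 2) \<le> Re (q $ 2)" using q q2 by (auto simp: Q'_def)
  have qA: "q \<in> A" "h q = 0" "cmod (g q - s) = m" using qQ(1) by (auto simp: Q_def A_def)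
  show ?thesis
  proof (cases "q \<in> frontier W")
    case True
    thus ?thesis using that qA p(2)[OF w0A] unfolding m_def by auto
  next
    case False
    hence "q \<in> W" using qA(1) W(1) unfolding A_def frontier_def by (auto simp: interior_open)
    define c where "c = g q - s"
    have c: "c \<noteq> 0" "cmod c = m" using ns[of q] qA unfolding c_def A_def by auto
    have "open (W \<inter> {w. g w \<noteq> s})"
      by (intro open_Int W(1) open_Collect_neq cg continuous_on_const)
    moreover have "q \<in> W \<inter> {w. g w \<noteq> s}" using \<open>q \<in> W\<close> c by (auto simp: c_def)
    ultimately obtain e where e: "e > 0" "ball q e \<subseteq> W \<inter> {w. g w \<noteq> s}"
      unfolding open_contains_ball by blast
    define r where "r = e / 2"
    define a where "a = q $ 1"
    define b where "b = q $ 2"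
    have r: "r > 0" using e by (simp add: r_def)
    have qab: "pt a b = q" by (simp add: a_def b_def)
    have inW: "pt x y \<in> W" "g (pt x y) \<noteq> s" if "x \<in> ball a r" "y \<in> ball b r" for x y
    proof -
      have "dist q (pt x y) < e"
        using dist_pt[of a b x y] that unfolding qab r_def by simp
      thus "pt x y \<in> W" "g (pt x y) \<noteq> s" using e(2) by auto
    qed
    define hh where "hh x y = h (pt x y)" for x y
    define HH where "HH x y = c / (g (pt x y) - s)" for x y
    have contpt: "continuous_on X (\<lambda>(x,y). F (pt x y))" if "\<And>Y. continuous_on Y F" for F :: "C2 \<Rightarrow> complex" and X
    proof -
      have "continuous_on X (\<lambda>z. F (pt (fst z) (snd z)))"
        by (rule continuous_on_compose2[OF that continuous_on_pt]) auto
      thus ?thesis by (simp add: split_beta)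
    qed
    have lines: "(\<lambda>x. F (pt x y)) holomorphic_on X" "(\<lambda>y. F (pt x y)) holomorphic_on X"
      if "holo_on F UNIV" for F X x y
    proof -
      have "(\<lambda>t. F (pt 0 y + t *s axis 1 1)) holomorphic_on UNIV" "(\<lambda>t. F (pt x 0 + t *s axis 2 1)) holomorphic_on UNIV"
        by (rule holo_on_holomorphic_line[OF that]; simp)+
      moreover have "pt 0 y + t *s axis 1 1 = pt t y" "pt x 0 + t *s axis 2 1 = pt x t" for t
        by (simp_all add: vec_eq_iff forall_2 axis_def)
      ultimately have "(\<lambda>x. F (pt x y)) holomorphic_on UNIV" "(\<lambda>y. F (pt x y)) holomorphic_on UNIV" by simp_all
      thus "(\<lambda>x. F (pt x y)) holomorphic_on X" "(\<lambda>y. F (pt x y)) holomorphic_on X"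
        using holomorphic_on_subset subset_UNIV by blast+
    qed
    have HH1: "(\<lambda>x. HH x y) holomorphic_on ball a r" if "y \<in> ball b r" for y
      unfolding HH_def using inW(2)[OF _ that]
      by (intro holomorphic_on_divide holomorphic_on_diff holomorphic_on_const lines[OF g]) auto
    have HHab: "HH a b = 1" using c by (simp add: HH_def qab c_def)
    have HHle: "cmod (HH x y) \<le> 1" and HHQ: "HH x y = 1 \<Longrightarrow> pt x y \<in> Q"
      if "x \<in> ball a r" "y \<in> ball b r" "hh x y = 0" for x y
    proof -
      have "pt x y \<in> A" using inW(1)[OF that(1,2)] that(3) closure_subset unfolding A_def hh_def by auto
      moreover have "m \<le> cmod (g (pt x y) - s)" using p(2)[OF \<open>pt x y \<in> A\<close>] by (simp add: m_def)
      ultimately show "cmod (HH x y) \<le> 1" "HH x y = 1 \<Longrightarrow> pt x y \<in> Q"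
        using c inW(2)[OF that(1,2)] unfolding HH_def Q_def
        by (auto simp: norm_divide divide_le_eq_1)
    qed
    have False
    proof (cases "\<forall>x\<in>ball a r. hh x b = 0")
      case True
      have br: "b \<in> ball b r" "a \<in> ball a r" using r by auto
      have "(\<lambda>x. HH x b) constant_on ball a r"
        by (rule maximum_modulus_principle[of _ _ "ball a r" a])
          (use HH1[OF br(1)] HHle[OF _ br(1)] True br HHab in auto)
      moreover have ar: "a + of_real (r/2) \<in> ball a r" using r by (simp add: dist_norm)
      ultimately have "HH (a + of_real (r/2)) b = 1" using HHab br(2) unfolding constant_on_def by metis
      hence "pt (a + of_real (r/2)) b \<in> Q" using HHQ[OF ar br(1)] True ar by blast
      hence "pt (a + of_real (r/2)) b \<in> Q'" using q(1) by (simp add: Q'_def b_def)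
      from q(2)[OF this] show False using r by (simp add: a_def)
    next
      case False
      then obtain x0 where x0: "x0 \<in> ball a r" "hh x0 b \<noteq> 0" by blast
      obtain x y where xy: "x \<in> ball a r" "y \<in> ball b r" "Re b < Re y" "hh x y = 0" "HH x y = 1"
      proof (rule zero_set_max_local[of r a b hh HH x0])
        show "continuous_on (ball a r \<times> ball b r) (\<lambda>(x, y). hh x y)" unfolding hh_def by (rule contpt[OF ch])
        show "continuous_on (ball a r \<times> ball b r) (\<lambda>(x, y). HH x y)"
          unfolding HH_def split_beta using inW(2)
          by (intro continuous_on_divide continuous_on_diff continuous_on_const contpt[OF cg, unfolded split_beta]) auto
        show "HH x holomorphic_on ball b r" if "x \<in> ball a r" for x
          unfolding HH_def using inW(2)[OF that]
          by (intro holomorphic_on_divide holomorphic_on_diff holomorphic_on_const lines[OF g]) auto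
        show "hh x holomorphic_on ball b r" for x unfolding hh_def by (rule lines[OF h])
        show "(\<lambda>x. hh x y) holomorphic_on ball a r" for y unfolding hh_def by (rule lines[OF h])
        show "hh a b = 0" using qA by (simp add: hh_def qab)
      qed (use r HH1 HHab HHle x0 in auto)
      from qQ(2)[OF HHQ[OF xy(1,2,4,5)]] show False using xy(3) by (simp add: b_def)
    qed
    thus ?thesis ..
  qed
qed

text \<open>To solve f w = y put v = y - f w0. The function \<open>h\<close> vanishes exactly where
  f w - f w0 is a multiple of v, and there the multiple is \<open>g / s\<close>, so the equation
  becomes g = s on the zero set of \<open>h\<close>. If it had no solution in the closure of
  \<open>W\<close>, some frontier point in the zero set would satisfy |g - s| \<le> |s|, the value
  at w0, so f would be within 2 |v| < c of f w0 there, against the choice of c.\<close>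

lemma open_at_isolated_preimage:
  assumes f: "holo_map_on f UNIV" and W: "open W" "bounded W"
    and w0: "w0 \<in> W" and iso: "\<And>w. w \<in> frontier W \<Longrightarrow> f w \<noteq> f w0"
  obtains c where "c > 0" "ball (f w0) c \<subseteq> f ` W"
proof -
  have fi: "holo_on (\<lambda>z. f z $ i) UNIV" for i using f unfolding holo_map_on_def by blast
  have cf: "continuous_on X f" for X
  proof -
    have "continuous_on X (\<lambda>z. \<chi> i. f z $ i)"
      using continuous_on_subset[OF holo_on_continuous[OF fi]] by (intro continuous_on_vec_lambda) blast
    thus ?thesis by simp
  qed
  have hl: "holo_on (\<lambda>w. \<alpha> * (f w $ 1 - y1) + \<beta> * (f w $ 2 - y2)) UNIV" for \<alpha> \<beta> y1 y2
    unfolding holo_on_def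
  proof
    fix z
    obtain D1 D2 where D: "((\<lambda>z. f z $ 1) has_derivative D1) (at z)" "\<And>c v. D1 (c *s v) = c * D1 v"
      "((\<lambda>z. f z $ 2) has_derivative D2) (at z)" "\<And>c v. D2 (c *s v) = c * D2 v"
      using fi unfolding holo_on_def by blast
    show "\<exists>D. ((\<lambda>w. \<alpha> * (f w $ 1 - y1) + \<beta> * (f w $ 2 - y2)) has_derivative D) (at z) \<and> (\<forall>c v. D (c *s v) = c * D v)"
      by (rule exI[of _ "\<lambda>v. \<alpha> * D1 v + \<beta> * D2 v"])
        (auto simp: D(2,4) algebra_simps intro!: derivative_eq_intros D(1,3))
  qed
  obtain c where c: "c > 0" "\<And>w. w \<in> frontier W \<Longrightarrow> c \<le> norm (f w - f w0)"
  proof (cases "frontier W = {}")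
    case True thus ?thesis using that[of 1] by simp
  next
    case False
    have cF: "compact (frontier W)" using W by (simp add: compact_frontier_bounded)
    have "continuous_on (frontier W) (\<lambda>w. norm (f w - f w0))" by (intro continuous_intros cf)
    then obtain p where "p \<in> frontier W" "\<And>w. w \<in> frontier W \<Longrightarrow> norm (f p - f w0) \<le> norm (f w - f w0)"
      using continuous_attains_inf[OF cF False] by blast
    thus ?thesis using that[of "norm (f p - f w0)"] iso by simp
  qed
  have "y \<in> f ` W" if y: "y \<in> ball (f w0) (c/2)" for y
  proof (cases "y = f w0")
    case True thus ?thesis using w0 by blast
  next
    case False
    define v where "v = y - f w0"
    have v: "v \<noteq> 0" "norm v < c/2" using False y by (auto simp: v_def dist_norm norm_minus_commute)
    define h where "h w = v$2 * (f w $ 1 - f w0 $ 1) + (- v$1) * (f w $ 2 - f w0 $ 2)" for w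
    define g where "g w = cnj (v$1) * (f w $ 1 - f w0 $ 1) + cnj (v$2) * (f w $ 2 - f w0 $ 2)" for w
    define s where "s = complex_of_real ((norm v)\<^sup>2)"
    have s: "s = v$1 * cnj (v$1) + v$2 * cnj (v$2)"
      unfolding s_def C2_norm_sq of_real_add complex_norm_square ..
    have s0: "s \<noteq> 0" using v by (simp add: s_def)
    have par: "f w - f w0 = (g w / s) *s v" if "h w = 0" for w
    proof -
      have "s * (f w $ 1 - f w0 $ 1) = g w * v$1 + cnj (v$2) * h w"
        "s * (f w $ 2 - f w0 $ 2) = g w * v$2 - cnj (v$1) * h w"
        unfolding s g_def h_def by (simp_all add: algebra_simps)
      thus ?thesis using that s0 by (simp add: vec_eq_iff forall_2 field_simps)
    qed
    have "\<exists>w\<in>closure W. h w = 0 \<and> g w = s"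
    proof (rule ccontr)
      assume "\<not> ?thesis"
      hence ns: "\<And>w. w \<in> closure W \<Longrightarrow> h w = 0 \<Longrightarrow> g w \<noteq> s" by blast
      obtain q where q: "q \<in> frontier W" "h q = 0" "cmod (g q - s) \<le> cmod (g w0 - s)"
        by (rule zero_set_min_frontier[OF hl hl W w0, of "v$2" "f w0 $ 1" "- v$1" "f w0 $ 2" "cnj (v$1)" "f w0 $ 1" "cnj (v$2)" "f w0 $ 2" s])
          (use ns in \<open>auto simp: h_def g_def\<close>)
      have "g w0 = 0" by (simp add: g_def)
      hence "cmod (g q) \<le> 2 * cmod s" using q(3) norm_triangle_ineq2[of "g q" s] by simp
      hence "cmod (g q / s) \<le> 2" using s0 by (simp add: norm_divide divide_le_eq)
      have "norm (f q - f w0) = cmod (g q / s) * norm v"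
        unfolding par[OF q(2)] norm_vector_smult ..
      also have "\<dots> \<le> 2 * norm v" using \<open>cmod (g q / s) \<le> 2\<close> by (intro mult_right_mono) auto
      also have "\<dots> < c" using v by simp
      finally show False using c(2)[OF q(1)] by simp
    qed
    then obtain w where w: "w \<in> closure W" "h w = 0" "g w = s" by blast
    have fw: "f w - f w0 = v" using par[OF w(2)] s0 by (simp add: w(3))
    have "w \<notin> frontier W" using c(2)[of w] v c(1) unfolding fw by fastforce
    hence "w \<in> W" using w(1) W(1) by (auto simp: frontier_def interior_open)
    thus ?thesis using fw unfolding v_def by (metis diff_add_cancel image_eqI)
  qed
  thus ?thesis using c(1) by (intro that[of "c/2"]) auto
qed

section \<open>Maximal inequality and radial limits\<close>

text \<open>The Hardy-Littlewood weak type bound. Vitali's lemma selects disjoint intervals whose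
  fivefold enlargements cover \<open>E\<close>. An enlargement has length 10 t, which is 5/l times 2
  t l and so less than 5/l times the integral over the selected interval. The result is a Borel
  superset \<open>U\<close> with small measure, so that measurability of \<open>E\<close> is not at
  issue.\<close>

lemma maximal_inequality_line:
  fixes h :: "real \<Rightarrow> real"
  assumes cont: "continuous_on UNIV h" and nn: "\<And>x. 0 \<le> h x" and l: "l > 0" and R: "R > 0"
    and E: "\<And>x. x \<in> E \<Longrightarrow> x \<in> {a..b} \<and> (\<exists>t\<in>{0<..R}. 2 * t * l < integral {x-t..x+t} h)"
  obtains U where "E \<subseteq> U" "U \<in> sets borel" "emeasure lborel U \<le> ennreal (5 / l * integral {a-R..b+R} h)"
proof -
  obtain t where t: "\<And>x. x \<in> E \<Longrightarrow> t x \<in> {0<..R} \<and> 2 * t x * l < integral {x - t x..x + t x} h"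
    using E by metis
  have ih: "h integrable_on {c..d}" for c d
    by (intro integrable_continuous_interval continuous_on_subset[OF cont]) auto
  have "E \<subseteq> (\<Union>x\<in>E. cball x (t x))" using t by force
  from Vitali_covering_lemma_cballs[OF this, of R]
  obtain C where C: "countable C" "C \<subseteq> E" "pairwise (\<lambda>i j. disjnt (cball i (t i)) (cball j (t j))) C"
    "E \<subseteq> (\<Union>i\<in>C. cball i (5 * t i))" using t by auto
  define U where "U = (\<Union>i\<in>C. cball i (5 * t i))"
  have emc: "emeasure lborel (cball x r) = ennreal (2 * r)" if "r \<ge> 0" for x r :: real
    using that by (simp add: cball_eq_atLeastAtMost)
  have Uset: "U \<in> sets borel" unfolding U_def using C(1) by (intro sets.countable_UN') auto
  have fin: "(\<Sum>i\<in>F. 10 * t i) \<le> 5 / l * integral {a-R..b+R} h" if F: "finite F" "F \<subseteq> C" for F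
  proof -
    have tF: "0 < t i" "t i \<le> R" "2 * t i * l < integral {i - t i..i + t i} h" "i \<in> {a..b}" if "i \<in> F" for i
      using t[of i] E[of i] that F C(2) by auto
    have disj: "pairwise (\<lambda>i j. negligible ({i - t i..i + t i} \<inter> {j - t j..j + t j})) F"
    proof (rule pairwiseI)
      fix i j assume "i \<in> F" "j \<in> F" "i \<noteq> j"
      hence "disjnt (cball i (t i)) (cball j (t j))" using C(3) F(2) unfolding pairwise_def by blast
      thus "negligible ({i - t i..i + t i} \<inter> {j - t j..j + t j})"
        by (simp add: disjnt_def cball_eq_atLeastAtMost)
    qed
    have hi: "(h has_integral (\<Sum>i\<in>F. integral {i - t i..i + t i} h)) (\<Union>i\<in>F. {i - t i..i + t i})"
      by (rule has_integral_UN[OF F(1) integrable_integral[OF ih] disj])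
    have "(\<Sum>i\<in>F. 2 * t i * l) \<le> (\<Sum>i\<in>F. integral {i - t i..i + t i} h)"
      by (intro sum_mono less_imp_le tF)
    also have "\<dots> = integral (\<Union>i\<in>F. {i - t i..i + t i}) h" using integral_unique[OF hi] by simp
    also have "\<dots> \<le> integral {a-R..b+R} h"
    proof (rule integral_subset_le)
      show "(\<Union>i\<in>F. {i - t i..i + t i}) \<subseteq> {a - R..b + R}" using tF(2,4) by fastforce
      show "h integrable_on (\<Union>i\<in>F. {i - t i..i + t i})" using hi by blast
    qed (use ih nn in auto)
    finally have "2 * l * (\<Sum>i\<in>F. t i) \<le> integral {a-R..b+R} h"
      by (simp add: sum_distrib_left sum_distrib_right mult_ac)
    hence "5 / l * (2 * l * (\<Sum>i\<in>F. t i)) \<le> 5 / l * integral {a-R..b+R} h" using l by (intro mult_left_mono) auto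
    thus ?thesis using l by (simp add: sum_distrib_left)
  qed
  have "emeasure lborel U \<le> ennreal (5 / l * integral {a-R..b+R} h)"
  proof (cases "C = {}")
    case True thus ?thesis by (simp add: U_def)
  next
    case False
    define f where "f = from_nat_into C"
    define V where "V n = (\<Union>i\<in>f ` {..<n}. cball i (5 * t i))" for n :: nat
    have fC: "f ` {..<n} \<subseteq> C" for n using from_nat_into[OF False] by (auto simp: f_def)
    have "U = (\<Union>n. V n)"
    proof -
      have "C = range f" using False C(1) by (simp add: f_def range_from_nat_into)
      thus ?thesis unfolding U_def V_def by force
    qed
    moreover have "incseq V" unfolding V_def incseq_def by fastforce
    moreover have Vs: "range V \<subseteq> sets lborel" unfolding V_def by auto
    ultimately have "emeasure lborel U = (SUP n. emeasure lborel (V n))"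
      using SUP_emeasure_incseq[of V lborel] by simp
    also have "\<dots> \<le> ennreal (5 / l * integral {a-R..b+R} h)"
    proof (rule SUP_least)
      fix n
      have pos: "t i > 0" if "i \<in> f ` {..<n}" for i using t[of i] fC[of n] C(2) that by auto
      have "emeasure lborel (V n) \<le> (\<Sum>i\<in>f ` {..<n}. emeasure lborel (cball i (5 * t i)))"
        unfolding V_def by (rule emeasure_subadditive_finite) auto
      also have "\<dots> = (\<Sum>i\<in>f ` {..<n}. ennreal (10 * t i))"
        by (intro sum.cong refl) (use emc pos in \<open>auto simp: less_imp_le\<close>)
      also have "\<dots> = ennreal (\<Sum>i\<in>f ` {..<n}. 10 * t i)"
        using pos by (intro sum_ennreal) (auto intro: less_imp_le)
      also have "\<dots> \<le> ennreal (5 / l * integral {a-R..b+R} h)"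
        by (intro ennreal_leI fin fC) simp
      finally show "emeasure lborel (V n) \<le> ennreal (5 / l * integral {a-R..b+R} h)" .
    qed
    finally show ?thesis .
  qed
  thus ?thesis using C(4) Uset by (intro that[of U]) (auto simp: U_def)
qed

text \<open>Poisson's formula: \<open>P r t\<close> is the real part of \<open>e\<^sup>i\<^sup>t / (e\<^sup>i\<^sup>t - r) + r e\<^sup>i\<^sup>t / (1 - r e\<^sup>i\<^sup>t)\<close>; the first
  summand reproduces the value at \<open>r\<close>, the second one integrates to zero.\<close>

definition poisson :: "real \<Rightarrow> real \<Rightarrow> real" where
  "poisson r t = (1 - r\<^sup>2) / (1 - 2 * r * cos t + r\<^sup>2)"

lemma poisson_denom_pos:
  fixes r t :: real
  assumes "0 \<le> r" "r < 1"
  shows "1 - 2 * r * cos t + r\<^sup>2 > 0"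
proof -
  have "r * cos t \<le> r * 1" using assms(1) cos_le_one by (rule mult_left_mono[rotated])
  moreover have "(1 - r)\<^sup>2 > 0" using assms by (simp add: zero_less_power2)
  moreover have "(1 - r)\<^sup>2 = 1 - 2 * r + r\<^sup>2" by (simp add: power2_eq_square algebra_simps)
  ultimately show ?thesis by linarith
qed

lemma poisson_complex:
  assumes "0 \<le> r" "r < 1"
  shows "of_real (poisson r t) = cis t / (cis t - of_real r) + of_real r * cis t / (1 - of_real r * cis t)"
proof -
  have 1: "cis t - of_real r \<noteq> 0"
  proof
    assume "cis t - of_real r = 0"
    hence "cmod (cis t) = r" using assms by simp
    thus False using assms by simp
  qed
  have 2: "1 - of_real r * cis t \<noteq> 0"
  proof
    assume "1 - of_real r * cis t = 0"
    hence "cmod (of_real r * cis t) = 1" by simp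
    thus False using assms by (simp add: norm_mult)
  qed
  have cc: "cis t * cis (- t) = 1" by (simp add: cis_mult)
  have "(cis t - of_real r) * (1 - of_real r * cis t) = cis t * (1 - of_real r * (cis t + cis (- t)) + (of_real r)\<^sup>2)"
    using cc by (simp add: algebra_simps power2_eq_square)
  also have "cis t + cis (- t) = of_real (2 * cos t)" by (simp add: complex_eq_iff)
  finally have den: "(cis t - of_real r) * (1 - of_real r * cis t) = cis t * of_real (1 - 2 * r * cos t + r\<^sup>2)"
    by (simp add: algebra_simps)
  have "cis t / (cis t - of_real r) + of_real r * cis t / (1 - of_real r * cis t)
      = (cis t * (1 - of_real r * cis t) + of_real r * cis t * (cis t - of_real r)) / ((cis t - of_real r) * (1 - of_real r * cis t))"
    by (rule add_frac_eq[OF 1 2])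
  also have "cis t * (1 - of_real r * cis t) + of_real r * cis t * (cis t - of_real r) = cis t * of_real (1 - r\<^sup>2)"
    by (simp add: algebra_simps power2_eq_square)
  also have "\<dots> / ((cis t - of_real r) * (1 - of_real r * cis t)) = of_real (poisson r t)"
    unfolding den poisson_def of_real_divide by simp
  finally show ?thesis ..
qed

lemma poisson_formula:
  assumes p: "p holomorphic_on UNIV" and r: "0 \<le> r" "r < 1"
  shows "((\<lambda>t. of_real (poisson r t) * p (cis t)) has_integral 2 * of_real pi * p (of_real r)) {0..2 * pi}"
proof -
  have holp: "p holomorphic_on X" for X using p holomorphic_on_subset by blast
  have "((\<lambda>w. p w / (w - of_real r)) has_contour_integral 2 * of_real pi * \<i> * p (of_real r)) (circlepath 0 1)"
    using r by (intro Cauchy_integral_circlepath_simple holp) simp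
  moreover have "((\<lambda>w. of_real r * p w / (1 - of_real r * w)) has_contour_integral 0) (circlepath 0 1)"
  proof (rule Cauchy_theorem_convex_simple)
    have "1 - of_real r * w \<noteq> 0" if "w \<in> cball 0 1" for w :: complex
    proof
      assume "1 - of_real r * w = 0"
      hence "cmod (of_real r * w) = 1" by simp
      moreover have "r * cmod w \<le> r * 1" using that r by (intro mult_left_mono) auto
      ultimately show False using r by (simp add: norm_mult)
    qed
    thus "(\<lambda>w. of_real r * p w / (1 - of_real r * w)) holomorphic_on cball 0 1"
      by (intro holomorphic_intros holp) auto
  qed auto
  ultimately have "((\<lambda>w. p w / (w - of_real r) + of_real r * p w / (1 - of_real r * w)) has_contour_integral
      2 * of_real pi * \<i> * p (of_real r) + 0) (part_circlepath 0 1 0 (2 * pi))"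
    unfolding circlepath_def by (rule has_contour_integral_add)
  hence "((\<lambda>t. (p (0 + of_real 1 * cis t) / (0 + of_real 1 * cis t - of_real r) + of_real r * p (0 + of_real 1 * cis t) / (1 - of_real r * (0 + of_real 1 * cis t)))
      * of_real 1 * \<i> * cis t) has_integral (2 * of_real pi * \<i> * p (of_real r) + 0)) {0..2 * pi}"
    by (subst (asm) has_contour_integral_part_circlepath_iff) auto
  \<comment> \<open>On the unit circle dw is \<open>\<i> * cis t\<close> dt; the factor
    \<open>- \<i>\<close> removes the \<open>\<i>\<close>.\<close>
  from has_integral_mult_right[OF this, of "- \<i>"]
  have "((\<lambda>t. - \<i> * ((p (cis t) / (cis t - of_real r) + of_real r * p (cis t) / (1 - of_real r * cis t)) * \<i> * cis t))
      has_integral 2 * of_real pi * p (of_real r)) {0..2 * pi}" by (simp add: algebra_simps)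
  moreover have "- \<i> * ((p (cis t) / (cis t - of_real r) + of_real r * p (cis t) / (1 - of_real r * cis t)) * \<i> * cis t)
      = of_real (poisson r t) * p (cis t)" for t
    unfolding poisson_complex[OF r] by (simp add: algebra_simps add_divide_distrib)
  ultimately show ?thesis by simp
qed

lemma poisson_symmetric: "poisson r (- t) = poisson r t" "poisson r (t + 2 * pi) = poisson r t"
  by (simp_all add: poisson_def)

lemma continuous_on_poisson:
  assumes "0 \<le> r" "r < 1"
  shows "continuous_on X (poisson r)"
  unfolding poisson_def using poisson_denom_pos[OF assms] by (intro continuous_intros) (auto simp: less_imp_neq[symmetric])

lemma poisson_nonneg:
  assumes "0 \<le> r" "r < 1"
  shows "poisson r t \<ge> 0"
  unfolding poisson_def using poisson_denom_pos[OF assms, of t] assms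
  by (intro divide_nonneg_pos) (auto simp: abs_square_le_1)

definition poisson_deriv :: "real \<Rightarrow> real \<Rightarrow> real" where
  "poisson_deriv r t = - ((1 - r\<^sup>2) * (2 * r * sin t)) / (1 - 2 * r * cos t + r\<^sup>2)\<^sup>2"

lemma poisson_has_deriv:
  assumes "0 \<le> r" "r < 1"
  shows "(poisson r has_real_derivative poisson_deriv r t) (at t within X)"
  unfolding poisson_def poisson_deriv_def using poisson_denom_pos[OF assms, of t]
  by (auto intro!: derivative_eq_intros simp: power2_eq_square)

text \<open>Evenness and periodicity fold the circle onto [0, pi], the interval on which the kernel
  is decreasing.\<close>

lemma integral_poisson_fold:
  assumes h: "continuous_on UNIV h" and per: "\<And>t. h (t + 2 * pi) = h t" and r: "0 \<le> r" "r < 1"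
  shows "integral {0..2 * pi} (\<lambda>t. poisson r t * h t) = integral {0..pi} (\<lambda>t. poisson r t * (h t + h (- t)))"
proof -
  define g where "g t = poisson r t * h t" for t
  have cg: "continuous_on UNIV g" unfolding g_def by (intro continuous_intros continuous_on_poisson r h)
  have ig: "g integrable_on {a..b}" for a b
    by (intro integrable_continuous_interval continuous_on_subset[OF cg]) auto
  have cg': "continuous_on UNIV (\<lambda>t. g (- t))"
    by (rule continuous_on_compose2[OF cg]) (auto intro!: continuous_intros)
  have ig': "(\<lambda>t. g (- t)) integrable_on {a..b}" for a b
    by (intro integrable_continuous_interval continuous_on_subset[OF cg']) auto
  have "integral {pi..2*pi} g = integral {pi - 2*pi..2*pi - 2*pi} (\<lambda>t. g (t + 2*pi))"
    by (rule integral_shift_real_ivl[symmetric])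
  also have "(\<lambda>t. g (t + 2*pi)) = (\<lambda>t. g (- (- t)))" by (simp add: g_def per poisson_symmetric)
  also have "integral {pi - 2*pi..2*pi - 2*pi} (\<lambda>t. g (- (- t))) = integral {0..pi} (\<lambda>t. g (- t))"
    using Henstock_Kurzweil_Integration.integral_reflect_real[of pi 0 "\<lambda>t. g (- t)"] by simp
  finally have "integral {0..2*pi} g = integral {0..pi} g + integral {0..pi} (\<lambda>t. g (- t))"
    using Henstock_Kurzweil_Integration.integral_combine[of 0 pi "2*pi" g] ig by simp
  also have "\<dots> = integral {0..pi} (\<lambda>t. g t + g (- t))"
    by (rule Henstock_Kurzweil_Integration.integral_add[symmetric, OF ig ig'])
  finally show ?thesis unfolding g_def poisson_symmetric distrib_left .
qed

text \<open>Since the kernel decreases on [0, pi], its integral against |p| is controlled by means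
  over symmetric intervals. The argument is an integration by parts: \<open>\<Gamma>\<close> is the
  integral of the folded modulus and \<open>W\<close> the boundary term. The derivative of
  \<open>W\<close> is at most \<open>poisson r x * (2 * l - G x)\<close>, because the derivative of
  the kernel is nonpositive and multiplies \<open>2 * x * l - \<Gamma> x\<close>, which is
  nonnegative. Finally \<open>W 0 = 0 \<le> W pi\<close>, and the kernel has total mass 2
  pi.\<close>

lemma radial_le_maximal:
  assumes p: "p holomorphic_on UNIV" and r: "0 \<le> r" "r < 1"
    and M: "\<And>a. 0 < a \<Longrightarrow> a \<le> pi \<Longrightarrow> integral {-a..a} (\<lambda>t. cmod (p (cis t))) \<le> 2 * a * l"
  shows "cmod (p (of_real r)) \<le> l"
proof -
  define h where "h t = cmod (p (cis t))" for t
  have cp: "continuous_on UNIV p" using p by (rule holomorphic_on_imp_continuous_on)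
  have ccis: "continuous_on UNIV cis" unfolding cis_conv_exp by (intro continuous_intros)
  have ch: "continuous_on UNIV h" unfolding h_def
    by (intro continuous_on_norm continuous_on_compose2[OF cp ccis]) auto
  have cisp: "cis (t + 2 * pi) = cis t" for t by (simp add: complex_eq_iff)
  have per: "h (t + 2 * pi) = h t" for t unfolding h_def cisp ..
  define G where "G t = h t + h (- t)" for t
  have ch': "continuous_on UNIV (\<lambda>t. h (- t))" by (rule continuous_on_compose2[OF ch]) (auto intro!: continuous_intros)
  have cG: "continuous_on X G" for X unfolding G_def
    using continuous_on_subset[OF ch] continuous_on_subset[OF ch'] by (intro continuous_on_add) auto
  define \<Gamma> where "\<Gamma> x = integral {0..x} G" for x
  have ih: "h integrable_on {a..b}" for a b by (intro integrable_continuous_interval continuous_on_subset[OF ch]) auto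
  have ih': "(\<lambda>t. h (- t)) integrable_on {a..b}" for a b by (intro integrable_continuous_interval continuous_on_subset[OF ch']) auto
  have \<Gamma>: "\<Gamma> x \<le> 2 * x * l" if x: "x \<in> {0..pi}" for x
  proof (cases "x = 0")
    case True thus ?thesis by (simp add: \<Gamma>_def)
  next
    case False
    have "\<Gamma> x = integral {0..x} h + integral {0..x} (\<lambda>t. h (- t))"
      unfolding \<Gamma>_def G_def by (rule Henstock_Kurzweil_Integration.integral_add[OF ih ih'])
    also have "integral {0..x} (\<lambda>t. h (- t)) = integral {-x..0} h"
      using Henstock_Kurzweil_Integration.integral_reflect_real[of x 0 "\<lambda>t. h (- t)"] by simp
    also have "integral {0..x} h + integral {-x..0} h = integral {-x..x} h"
      using Henstock_Kurzweil_Integration.integral_combine[of "-x" 0 x h] ih x by simp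
    finally show ?thesis using M[of x] x False unfolding h_def by simp
  qed
  define W where "W x = poisson r x * (2 * x * l - \<Gamma> x)" for x
  have "(\<Gamma> has_real_derivative G x) (at x within {0..pi})" if "x \<in> {0..pi}" for x
    unfolding \<Gamma>_def has_real_derivative_iff_has_vector_derivative
    by (rule integral_has_vector_derivative[OF cG that])
  hence dW: "(W has_vector_derivative (poisson_deriv r x * (2 * x * l - \<Gamma> x) + poisson r x * (2 * l - G x))) (at x within {0..pi})"
    if "x \<in> {0..pi}" for x
    unfolding W_def has_real_derivative_iff_has_vector_derivative[symmetric]
    using that by (auto intro!: derivative_eq_intros poisson_has_deriv r)
  have I1: "((\<lambda>x. poisson_deriv r x * (2 * x * l - \<Gamma> x) + poisson r x * (2 * l - G x)) has_integral (W pi - W 0)) {0..pi}"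
    by (rule fundamental_theorem_of_calculus[OF pi_ge_zero dW])
  have iP: "(\<lambda>x. poisson r x * F x) integrable_on {0..pi}" if "continuous_on {0..pi} F" for F
    by (intro integrable_continuous_interval continuous_on_mult continuous_on_poisson r that)
  have I2: "((\<lambda>x. poisson r x * (2 * l - G x)) has_integral integral {0..pi} (\<lambda>x. poisson r x * (2 * l - G x))) {0..pi}"
    by (intro integrable_integral iP continuous_intros cG)
  have "W pi - W 0 \<le> integral {0..pi} (\<lambda>x. poisson r x * (2 * l - G x))"
  proof (rule has_integral_le[OF I1 I2])
    fix x assume x: "x \<in> {0..pi}"
    have "poisson_deriv r x \<le> 0"
    proof -
      have "0 \<le> (1 - r\<^sup>2) * (2 * r * sin x)" using x r sin_ge_zero[of x] by (auto simp: abs_square_le_1)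
      thus ?thesis unfolding poisson_deriv_def by (simp add: divide_nonneg_nonneg)
    qed
    hence "poisson_deriv r x * (2 * x * l - \<Gamma> x) \<le> 0" using \<Gamma>[OF x] by (simp add: mult_nonpos_nonneg)
    thus "poisson_deriv r x * (2 * x * l - \<Gamma> x) + poisson r x * (2 * l - G x) \<le> poisson r x * (2 * l - G x)" by simp
  qed
  moreover have "W 0 = 0" by (simp add: W_def \<Gamma>_def)
  moreover have "W pi \<ge> 0" unfolding W_def using \<Gamma>[of pi] poisson_nonneg[OF r, of pi] by simp
  ultimately have "0 \<le> integral {0..pi} (\<lambda>x. poisson r x * (2 * l - G x))" by linarith
  also have "\<dots> = integral {0..pi} (\<lambda>x. poisson r x * (2 * l)) - integral {0..pi} (\<lambda>x. poisson r x * G x)"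
    unfolding right_diff_distrib by (intro Henstock_Kurzweil_Integration.integral_diff iP cG continuous_on_const)
  finally have le: "integral {0..pi} (\<lambda>x. poisson r x * G x) \<le> integral {0..pi} (\<lambda>x. poisson r x * (l + l))" by simp
  have one: "integral {0..2 * pi} (\<lambda>t. poisson r t * c) = 2 * pi * c" for c
  proof -
    have "((\<lambda>t. of_real (poisson r t) * of_real c) has_integral 2 * of_real pi * complex_of_real c) {0..2 * pi}"
      by (rule poisson_formula[OF _ r]) (rule holomorphic_on_const)
    hence "((\<lambda>t. complex_of_real (poisson r t * c)) has_integral of_real (2 * pi * c)) {0..2 * pi}" by simp
    hence "((\<lambda>t. poisson r t * c) has_integral (2 * pi * c)) {0..2 * pi}"
      using has_integral_Re[of "\<lambda>t. complex_of_real (poisson r t * c)" "of_real (2 * pi * c)"] by simp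
    thus ?thesis by (rule integral_unique)
  qed
  have f: "((\<lambda>t. of_real (poisson r t) * p (cis t)) has_integral 2 * of_real pi * p (of_real r)) {0..2*pi}"
    by (rule poisson_formula[OF p r])
  have "2 * pi * cmod (p (of_real r)) = cmod (integral {0..2*pi} (\<lambda>t. of_real (poisson r t) * p (cis t)))"
    using integral_unique[OF f] by (simp add: norm_mult)
  also have "\<dots> \<le> integral {0..2*pi} (\<lambda>t. poisson r t * h t)"
  proof (rule integral_norm_bound_integral)
    show "(\<lambda>t. poisson r t * h t) integrable_on {0..2*pi}"
      by (intro integrable_continuous_interval continuous_on_mult continuous_on_poisson r continuous_on_subset[OF ch]) auto
    show "cmod (of_real (poisson r t) * p (cis t)) \<le> poisson r t * h t" for t
      using poisson_nonneg[OF r, of t] by (simp add: norm_mult h_def)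
  qed (use f in blast)
  also have "\<dots> = integral {0..pi} (\<lambda>t. poisson r t * G t)"
    unfolding G_def by (rule integral_poisson_fold[OF ch per r])
  also note le
  also have "integral {0..pi} (\<lambda>t. poisson r t * (l + l)) = 2 * pi * l"
  proof -
    have "integral {0..2*pi} (\<lambda>t. poisson r t * l) = integral {0..pi} (\<lambda>t. poisson r t * (l + l))"
      by (rule integral_poisson_fold[OF continuous_on_const _ r]) simp
    thus ?thesis unfolding one ..
  qed
  finally show ?thesis by simp
qed

text \<open>Composing \<open>p\<close> with multiplication by \<open>cis x\<close> moves the radius
  at angle \<open>x\<close> to the real axis. The resulting intervals have centre in [0, 2 pi] and
  radius at most pi, whence the integral from -pi to 3 pi, which runs through the circle
  twice.\<close>

lemma circle_maximal:
  assumes p: "p holomorphic_on UNIV" and l: "l > 0"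
  obtains U where "{x \<in> {0..2*pi}. \<exists>r\<in>{0..<1}. l < cmod (p (of_real r * cis x))} \<subseteq> U" "U \<in> sets borel"
    "emeasure lborel U \<le> ennreal (5 / l * integral {0-pi..2*pi+pi} (\<lambda>t. cmod (p (cis t))))"
proof -
  define h where "h t = cmod (p (cis t))" for t
  have cp: "continuous_on UNIV p" using p by (rule holomorphic_on_imp_continuous_on)
  have ccis: "continuous_on UNIV cis" unfolding cis_conv_exp by (intro continuous_intros)
  have ch: "continuous_on UNIV h" unfolding h_def
    by (intro continuous_on_norm continuous_on_compose2[OF cp ccis]) auto
  define E where "E = {x \<in> {0..2*pi}. \<exists>r\<in>{0..<1}. l < cmod (p (of_real r * cis x))}"
  have E: "x \<in> {0..2*pi} \<and> (\<exists>t\<in>{0<..pi}. 2 * t * l < integral {x-t..x+t} h)" if x: "x \<in> E" for x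
  proof -
    obtain r where r: "0 \<le> r" "r < 1" "l < cmod (p (of_real r * cis x))" using x unfolding E_def by auto
    define P where "P w = p (w * cis x)" for w
    have "(p \<circ> (\<lambda>w. w * cis x)) holomorphic_on UNIV"
      by (rule holomorphic_on_compose_gen[OF _ p]) (auto intro!: holomorphic_intros)
    hence P: "P holomorphic_on UNIV" by (simp add: P_def[abs_def] comp_def)
    have "\<exists>t. 0 < t \<and> t \<le> pi \<and> 2 * t * l < integral {-t..t} (\<lambda>s. cmod (P (cis s)))"
      using radial_le_maximal[OF P r(1,2), of l] r(3) unfolding P_def by force
    then obtain t where t: "0 < t" "t \<le> pi" "2 * t * l < integral {-t..t} (\<lambda>s. cmod (P (cis s)))" by blast
    have "(\<lambda>s. cmod (P (cis s))) = (\<lambda>s. h (s + x))" by (simp add: P_def h_def cis_mult)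
    hence "integral {-t..t} (\<lambda>s. cmod (P (cis s))) = integral {x-t..x+t} h"
      using integral_shift_real_ivl[of "x-t" x "x+t" h] by simp
    thus ?thesis using t x unfolding E_def by auto
  qed
  obtain U where "E \<subseteq> U" "U \<in> sets borel" "emeasure lborel U \<le> ennreal (5 / l * integral {0-pi..2*pi+pi} h)"
    by (rule maximal_inequality_line[OF ch _ l pi_gt_zero E]) (auto simp: h_def)
  thus ?thesis using that unfolding E_def h_def by blast
qed

lemma nn_integral_Icc_lborel:
  fixes f :: "real \<Rightarrow> real"
  assumes f: "continuous_on UNIV f" and nn: "\<And>x. 0 \<le> f x"
  shows "(\<integral>\<^sup>+x. ennreal (f x) * indicator {a..b} x \<partial>lborel) = ennreal (integral {a..b} f)"
proof -
  have "f integrable_on {a..b}" by (intro integrable_continuous_interval continuous_on_subset[OF f]) auto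
  hence "(f has_integral integral {a..b} f) {a..b}" by (rule integrable_integral)
  hence "((\<lambda>x. if x \<in> {a..b} then f x else 0) has_integral integral {a..b} f) UNIV"
    by (simp only: has_integral_restrict_UNIV)
  moreover have "(\<lambda>x. if x \<in> {a..b} then f x else 0) \<in> borel_measurable borel"
    using borel_measurable_continuous_onI[OF f] by (intro measurable_If_set) auto
  ultimately have "(\<integral>\<^sup>+x. ennreal (if x \<in> {a..b} then f x else 0) \<partial>lborel) = ennreal (integral {a..b} f)"
    using nn by (intro nn_integral_has_integral_lborel) auto
  moreover have "ennreal (if x \<in> {a..b} then f x else 0) = ennreal (f x) * indicator {a..b} x" for x
    by (simp add: indicator_def)
  ultimately show ?thesis by simp
qed

section \<open>Slicing the sphere by circles\<close>

context sphere_measure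
begin

lemma measurable_rotation_flow:
  assumes "F \<in> borel_measurable borel"
  shows "(\<lambda>(z, t). F (cis t *s z)) \<in> borel_measurable (\<sigma> \<Otimes>\<^sub>M lborel)"
proof -
  have id: "(\<lambda>z. z) \<in> measurable \<sigma> borel" by (rule borel_measurable_cont) (rule continuous_on_id)
  have "(\<lambda>w. (fst w, snd w)) \<in> measurable (\<sigma> \<Otimes>\<^sub>M lborel) (borel \<Otimes>\<^sub>M borel)"
    using measurable_compose[OF measurable_fst id] by (intro measurable_Pair) auto
  moreover have "(\<lambda>w :: C2 \<times> real. cis (snd w) *s fst w) \<in> borel_measurable borel"
    unfolding cis_conv_exp vector_scalar_mult_def
    by (intro borel_measurable_continuous_onI continuous_on_vec_lambda continuous_intros)
  hence "(\<lambda>w :: C2 \<times> real. cis (snd w) *s fst w) \<in> borel_measurable (borel \<Otimes>\<^sub>M borel)" by (simp only: borel_prod)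
  ultimately have "(\<lambda>w. cis (snd (fst w, snd w)) *s fst (fst w, snd w)) \<in> borel_measurable (\<sigma> \<Otimes>\<^sub>M lborel)"
    by (rule measurable_compose)
  from measurable_compose[OF this assms] show ?thesis by (simp add: split_beta)
qed

text \<open>A substitute for disintegrating \<open>\<sigma>\<close> along circles: the function is
  averaged over the flow \<open>z \<mapsto> cis t *s z\<close>, which preserves
  \<open>\<sigma>\<close>, and Fubini's theorem exchanges the two integrals.\<close>

lemma nn_integral_flow:
  fixes F :: "C2 \<Rightarrow> ennreal" and a b :: real
  assumes "F \<in> borel_measurable borel" "a \<le> b"
  shows "(\<integral>\<^sup>+z. (\<integral>\<^sup>+t. F (cis t *s z) * indicator {a..b} t \<partial>lborel) \<partial>\<sigma>) = ennreal (b - a) * (\<integral>\<^sup>+z. F z \<partial>\<sigma>)"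
proof -
  interpret pair_sigma_finite \<sigma> lborel ..
  have meas: "(\<lambda>(z, t). F (cis t *s z) * indicator {a..b} t) \<in> borel_measurable (\<sigma> \<Otimes>\<^sub>M lborel)"
    using measurable_rotation_flow[of F] assms unfolding split_beta by measurable
  have Fm: "F \<in> borel_measurable \<sigma>"
    using measurable_compose[OF borel_measurable_cont[OF continuous_on_id] assms(1)] by simp
  have "(\<integral>\<^sup>+z. (\<integral>\<^sup>+t. F (cis t *s z) * indicator {a..b} t \<partial>lborel) \<partial>\<sigma>)
      = (\<integral>\<^sup>+t. (\<integral>\<^sup>+z. F (cis t *s z) * indicator {a..b} t \<partial>\<sigma>) \<partial>lborel)"
    using Fubini'[OF meas] by simp
  also have "\<dots> = (\<integral>\<^sup>+t. (\<integral>\<^sup>+z. F z \<partial>\<sigma>) * indicator {a..b} t \<partial>lborel)"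
  proof (rule nn_integral_cong)
    fix t
    have "(\<lambda>z. F (cis t *s z)) \<in> borel_measurable \<sigma>"
      by (rule measurable_compose[OF distr_orth(1)[OF orth_smult] Fm]) simp
    hence "(\<integral>\<^sup>+z. F (cis t *s z) * indicator {a..b} t \<partial>\<sigma>) = (\<integral>\<^sup>+z. F (cis t *s z) \<partial>\<sigma>) * indicator {a..b} t"
      by (rule nn_integral_multc)
    also have "(\<integral>\<^sup>+z. F (cis t *s z) \<partial>\<sigma>) = (\<integral>\<^sup>+z. F z \<partial>\<sigma>)"
      by (rule nn_integral_orth[OF orth_smult Fm]) simp
    finally show "(\<integral>\<^sup>+z. F (cis t *s z) * indicator {a..b} t \<partial>\<sigma>) = (\<integral>\<^sup>+z. F z \<partial>\<sigma>) * indicator {a..b} t" .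
  qed
  also have "\<dots> = ennreal (b - a) * (\<integral>\<^sup>+z. F z \<partial>\<sigma>)"
    using assms(2) by (simp add: nn_integral_cmult mult.commute)
  finally show ?thesis .
qed

text \<open>Along each circle \<open>q\<close> is a polynomial in one variable, to which the circle
  estimate applies. Averaging over the flow gives 2 pi times the measure of \<open>A\<close> on one
  side and 5/l times 4 pi times the integral of |q| on the other, hence the factor 10.\<close>

lemma sphere_maximal:
  assumes hom: "\<And>k. k \<in> I \<Longrightarrow> homogeneous_poly k (H k)" and I: "finite I" and l: "l > 0"
  defines "q \<equiv> (\<lambda>z. \<Sum>k\<in>I. H k z)"
  defines "A \<equiv> {z \<in> S2. \<exists>r\<in>{0..<1}. l < cmod (q (of_real r *s z))}"
  shows "A \<in> sets \<sigma>" "measure \<sigma> A \<le> 10 / l * (\<integral>z. cmod (q z) \<partial>\<sigma>)"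
proof -
  have cq: "continuous_on X q" for X
    unfolding q_def by (intro continuous_on_sum continuous_on_homogeneous_poly[OF hom])
  have cqr: "continuous_on UNIV (\<lambda>z. cmod (q (c *s z)))" for c
    by (intro continuous_on_norm continuous_on_compose2[OF cq])
      (auto intro!: continuous_intros simp: vector_scalar_mult_def)
  \<comment> \<open>The union runs over uncountably many radii, but its members are open; this
    settles the measurability of \<open>A\<close>.\<close>
  define A' where "A' = (\<Union>r\<in>{0..<1}. {z. l < cmod (q (of_real r *s z))})"
  have A': "open A'" unfolding A'_def by (intro open_UN ballI open_Collect_less cqr continuous_on_const)
  have AA': "A = S2 \<inter> A'" unfolding A_def A'_def by blast
  show Aset: "A \<in> sets \<sigma>" unfolding AA' in_sets_sigma using A' by auto
  have hol: "(\<lambda>w. q (w *s z)) holomorphic_on UNIV" for z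
  proof -
    have "(\<lambda>w. q (w *s z)) = (\<lambda>w. \<Sum>k\<in>I. w ^ k * H k z)"
      unfolding q_def by (intro ext sum.cong refl homogeneous_poly_smult hom)
    thus ?thesis by (simp only:) (intro holomorphic_intros)
  qed
  define J where "J z = (\<integral>\<^sup>+t. ennreal (cmod (q (cis t *s z))) * indicator {-pi..3*pi} t \<partial>lborel)" for z
  have slice: "(\<integral>\<^sup>+t. indicator A (cis t *s z) * indicator {0..2*pi} t \<partial>lborel) \<le> ennreal (5 / l) * J z" if z: "z \<in> S2" for z
  proof -
    obtain U where U: "{x \<in> {0..2*pi}. \<exists>r\<in>{0..<1}. l < cmod (q ((of_real r * cis x) *s z))} \<subseteq> U" "U \<in> sets borel"
      "emeasure lborel U \<le> ennreal (5 / l * integral {0-pi..2*pi+pi} (\<lambda>t. cmod (q (cis t *s z))))"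
      by (rule circle_maximal[OF hol l, of z])
    have "indicator A (cis t *s z) * indicator {0..2*pi} t \<le> (indicator U t :: ennreal)" for t
    proof -
      have "t \<in> U" if "cis t *s z \<in> A" "t \<in> {0..2*pi}"
      proof -
        have "of_real r *s (cis t *s z) = (of_real r * cis t) *s z" for r
          by (simp add: vec_eq_iff)
        thus ?thesis using that U(1) unfolding A_def by auto
      qed
      thus ?thesis by (auto simp: indicator_def)
    qed
    hence "(\<integral>\<^sup>+t. indicator A (cis t *s z) * indicator {0..2*pi} t \<partial>lborel) \<le> (\<integral>\<^sup>+t. indicator U t \<partial>lborel)"
      by (rule nn_integral_mono)
    also have "\<dots> = emeasure lborel U" using U(2) by simp
    also note U(3)
    also have "ennreal (5 / l * integral {0-pi..2*pi+pi} (\<lambda>t. cmod (q (cis t *s z)))) = ennreal (5 / l) * J z"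
    proof -
      have ccis: "continuous_on UNIV (\<lambda>t. cmod (q (cis t *s z)))"
        unfolding cis_conv_exp vector_scalar_mult_def
        by (intro continuous_on_norm continuous_on_compose2[OF cq] continuous_on_vec_lambda continuous_intros) auto
      have "J z = ennreal (integral {-pi..3*pi} (\<lambda>t. cmod (q (cis t *s z))))"
        unfolding J_def by (rule nn_integral_Icc_lborel[OF ccis]) simp
      moreover have "0 - pi = - pi" "2 * pi + pi = 3 * pi" by simp_all
      ultimately show ?thesis using l by (simp only:) (rule ennreal_mult', simp)
    qed
    finally show ?thesis .
  qed
  have Am: "(indicator A :: C2 \<Rightarrow> ennreal) \<in> borel_measurable borel"
    using Aset unfolding in_sets_sigma by (intro borel_measurable_indicator) auto
  have qm: "(\<lambda>z. ennreal (cmod (q z))) \<in> borel_measurable borel"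
    using borel_measurable_continuous_onI[OF cq] by measurable
  have "ennreal (2 * pi) * emeasure \<sigma> A = ennreal (2 * pi - 0) * (\<integral>\<^sup>+z. indicator A z \<partial>\<sigma>)" using Aset by simp
  also have "\<dots> = (\<integral>\<^sup>+z. (\<integral>\<^sup>+t. indicator A (cis t *s z) * indicator {0..2*pi} t \<partial>lborel) \<partial>\<sigma>)"
    by (rule nn_integral_flow[OF Am, symmetric]) simp
  also have "\<dots> \<le> (\<integral>\<^sup>+z. ennreal (5 / l) * J z \<partial>\<sigma>)"
    by (rule nn_integral_mono) (use slice in simp)
  also have "\<dots> = ennreal (5 / l) * (\<integral>\<^sup>+z. J z \<partial>\<sigma>)"
  proof (rule nn_integral_cmult)
    have "(\<lambda>(z, t). ennreal (cmod (q (cis t *s z))) * indicator {-pi..3*pi} t) \<in> borel_measurable (\<sigma> \<Otimes>\<^sub>M lborel)"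
      using measurable_rotation_flow[OF qm] unfolding split_beta by measurable
    thus "J \<in> borel_measurable \<sigma>" unfolding J_def[abs_def]
      by (intro lborel.borel_measurable_nn_integral)
  qed
  also have "(\<integral>\<^sup>+z. J z \<partial>\<sigma>) = ennreal (3 * pi - - pi) * (\<integral>\<^sup>+z. ennreal (cmod (q z)) \<partial>\<sigma>)"
    unfolding J_def by (rule nn_integral_flow[OF qm]) simp
  also have "(\<integral>\<^sup>+z. ennreal (cmod (q z)) \<partial>\<sigma>) = ennreal (\<integral>z. cmod (q z) \<partial>\<sigma>)"
    by (intro nn_integral_eq_integral integrable_cont continuous_on_norm cq) auto
  also have "emeasure \<sigma> A = ennreal (measure \<sigma> A)" by (rule emeasure_eq_measure)
  also have "ennreal (2 * pi) * ennreal (measure \<sigma> A) = ennreal (2 * pi * measure \<sigma> A)"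
    by (rule ennreal_mult'[symmetric]) simp
  also have "ennreal (3 * pi - - pi) * ennreal (\<integral>z. cmod (q z) \<partial>\<sigma>) = ennreal (4 * pi * (\<integral>z. cmod (q z) \<partial>\<sigma>))"
    by (subst ennreal_mult'[symmetric]) simp_all
  also have "ennreal (5 / l) * \<dots> = ennreal (5 / l * (4 * pi * (\<integral>z. cmod (q z) \<partial>\<sigma>)))"
    by (rule ennreal_mult'[symmetric]) (use l in simp)
  finally have "ennreal (2 * pi * measure \<sigma> A) \<le> ennreal (5 / l * (4 * pi * (\<integral>z. cmod (q z) \<partial>\<sigma>)))" .
  hence "2 * pi * measure \<sigma> A \<le> 5 / l * (4 * pi * (\<integral>z. cmod (q z) \<partial>\<sigma>))"
    using l by (subst (asm) ennreal_le_iff) (auto intro!: mult_nonneg_nonneg Bochner_Integration.integral_nonneg)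
  hence "(2 * pi) * measure \<sigma> A \<le> (2 * pi) * (10 / l * (\<integral>z. cmod (q z) \<partial>\<sigma>))" by simp
  thus "measure \<sigma> A \<le> 10 / l * (\<integral>z. cmod (q z) \<partial>\<sigma>)" by (rule mult_left_le_imp_le) simp
qed

end

section \<open>Algebra of holomorphic functions of two variables\<close>

lemma holo_on_const: "holo_on (\<lambda>z. c) U"
  unfolding holo_on_def by (intro ballI exI[of _ "\<lambda>v. 0"]) simp

lemma holo_on_coord: "holo_on (\<lambda>z. z $ i) U"
  unfolding holo_on_def
  by (intro ballI exI[of _ "\<lambda>v. v $ i"] conjI bounded_linear_imp_has_derivative bounded_linear_vec_nth) simp

lemma holo_on_add:
  assumes "holo_on f U" "holo_on g U"
  shows "holo_on (\<lambda>z. f z + g z) U"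
  unfolding holo_on_def
proof
  fix z assume z: "z \<in> U"
  obtain D where D: "(f has_derivative D) (at z)" "\<And>c v. D (c *s v) = c * D v"
    using assms(1) z unfolding holo_on_def by blast
  obtain D' where D': "(g has_derivative D') (at z)" "\<And>c v. D' (c *s v) = c * D' v"
    using assms(2) z unfolding holo_on_def by blast
  show "\<exists>D. ((\<lambda>z. f z + g z) has_derivative D) (at z) \<and> (\<forall>c v. D (c *s v) = c * D v)"
    by (intro exI[of _ "\<lambda>v. D v + D' v"] conjI has_derivative_add D(1) D'(1)) (simp add: D(2) D'(2) distrib_left)
qed

lemma holo_on_mult:
  assumes "holo_on f U" "holo_on g U"
  shows "holo_on (\<lambda>z. f z * g z) U"
  unfolding holo_on_def
proof
  fix z assume z: "z \<in> U"
  obtain D where D: "(f has_derivative D) (at z)" "\<And>c v. D (c *s v) = c * D v"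
    using assms(1) z unfolding holo_on_def by blast
  obtain D' where D': "(g has_derivative D') (at z)" "\<And>c v. D' (c *s v) = c * D' v"
    using assms(2) z unfolding holo_on_def by blast
  show "\<exists>D. ((\<lambda>z. f z * g z) has_derivative D) (at z) \<and> (\<forall>c v. D (c *s v) = c * D v)"
    by (intro exI[of _ "\<lambda>v. f z * D' v + D v * g z"] conjI has_derivative_mult D(1) D'(1))
      (simp add: D(2) D'(2) algebra_simps)
qed

lemma holo_on_power: "holo_on f U \<Longrightarrow> holo_on (\<lambda>z. f z ^ n) U"
  by (induction n) (auto intro: holo_on_const holo_on_mult)

lemma holo_on_sum:
  assumes "\<And>i. i \<in> I \<Longrightarrow> holo_on (f i) U"
  shows "holo_on (\<lambda>z. \<Sum>i\<in>I. f i z) U"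
  using assms by (induction I rule: infinite_finite_induct) (auto intro: holo_on_const holo_on_add)

lemma holo_on_homogeneous_poly:
  assumes "homogeneous_poly k p"
  shows "holo_on p U"
proof -
  obtain b where p: "p = (\<lambda>z. \<Sum>j\<le>k. b j * (z $ 1) ^ j * (z $ 2) ^ (k - j))"
    using assms unfolding homogeneous_poly_def by blast
  show ?thesis unfolding p
    by (intro holo_on_sum holo_on_mult holo_on_power holo_on_const holo_on_coord)
qed

section \<open>Series of homogeneous polynomials in the ball\<close>

locale poly_series =
  fixes G :: "nat \<Rightarrow> C2 \<Rightarrow> complex"
  assumes hom: "\<And>k. homogeneous_poly k (G k)"
    and growth: "\<And>k z. z \<in> S2 \<Longrightarrow> cmod (G k z) \<le> real k"
begin

definition S :: "C2 \<Rightarrow> complex" where "S z = (\<Sum>k. G k z)"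

lemma polar:
  obtains u where "u \<in> S2" "z = of_real (norm z) *s u"
proof (cases "z = 0")
  case True
  have "axis 1 1 \<in> S2" by (simp add: norm_axis_1)
  thus ?thesis using that[of "axis 1 1"] True by simp
next
  case False
  define u where "u = of_real (1 / norm z) *s z"
  have "norm u = 1" unfolding u_def norm_vector_smult using False by (simp add: norm_divide)
  moreover have "z = of_real (norm z) *s u" unfolding u_def using False by (simp add: vec_eq_iff)
  ultimately show ?thesis using that by auto
qed

lemma bound: "cmod (G k z) \<le> real k * norm z ^ k"
proof -
  obtain u where u: "u \<in> S2" "z = of_real (norm z) *s u" by (rule polar)
  have "G k z = of_real (norm z) ^ k * G k u" by (subst u(2)) (rule homogeneous_poly_smult[OF hom])
  hence "cmod (G k z) = norm z ^ k * cmod (G k u)" by (simp add: norm_mult norm_power)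
  also have "\<dots> \<le> norm z ^ k * real k" by (intro mult_left_mono growth u) auto
  finally show ?thesis by (simp add: mult.commute)
qed

lemma summable_bound:
  assumes "0 \<le> \<rho>" "\<rho> < 1"
  shows "summable (\<lambda>k. real k * \<rho> ^ k)"
proof -
  have "summable (\<lambda>k. diffs (\<lambda>k. 1::real) k * \<rho> ^ k)"
    by (rule termdiff_converges[where K = 1]) (use assms in \<open>auto intro: summable_geometric\<close>)
  hence "summable (\<lambda>k. \<rho> * (real (Suc k) * \<rho> ^ k))" by (intro summable_mult) (simp add: diffs_def)
  hence "summable (\<lambda>k. real (Suc k) * \<rho> ^ Suc k)" by (simp add: algebra_simps)
  thus ?thesis by (subst (asm) summable_Suc_iff)
qed

lemma sums_S:
  assumes "norm z < 1"
  shows "(\<lambda>k. G k z) sums S z"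
  unfolding S_def using summable_comparison_test'[OF summable_bound[of "norm z"] bound] assms by (intro summable_sums) auto

lemma uniform_limit_S:
  assumes "compact K" "K \<subseteq> B2"
  shows "uniform_limit K (\<lambda>n z. \<Sum>k<n. G k z) S sequentially"
proof (cases "K = {}")
  case True thus ?thesis by (simp add: uniform_limit_iff)
next
  case False
  have "continuous_on K (norm :: C2 \<Rightarrow> real)" by (intro continuous_intros)
  from continuous_attains_sup[OF assms(1) False this]
  obtain m where m: "m \<in> K" "\<And>z. z \<in> K \<Longrightarrow> norm z \<le> norm m" by blast
  have "norm m < 1" using m(1) assms(2) by auto
  show ?thesis unfolding S_def[abs_def]
  proof (rule Weierstrass_m_test)
    show "summable (\<lambda>k. real k * norm m ^ k)" using \<open>norm m < 1\<close> by (intro summable_bound) auto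
    fix k z assume "z \<in> K"
    have "real k * norm z ^ k \<le> real k * norm m ^ k" by (intro mult_left_mono power_mono m(2) \<open>z \<in> K\<close>) auto
    thus "cmod (G k z) \<le> real k * norm m ^ k" using bound[of k z] by linarith
  qed
qed

text \<open>Cauchy's estimate on the complex line through \<open>z\<close> in direction
  \<open>v\<close>: on the circle of radius \<open>s / norm v\<close> in the parameter the argument
  stays within \<open>\<rho> + s\<close>. The bound is linear in \<open>norm v\<close>, the form
  that termwise differentiation demands.\<close>

lemma derivative_bound:
  assumes D: "(G k has_derivative D) (at z)" "\<And>c v. D (c *s v) = c * D v"
    and z: "norm z \<le> \<rho>" and s: "s > 0"
  shows "cmod (D v) \<le> real k * (\<rho> + s) ^ k / s * norm v"
proof (cases "v = 0")
  case True
  have "D (0 *s v) = 0 * D v" by (rule D(2))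
  thus ?thesis using True by simp
next
  case False
  define g where "g t = G k (z + t *s v)" for t
  have "(g has_field_derivative D v) (at 0)"
    unfolding g_def by (rule has_field_derivative_line) (use D in simp_all)
  hence d: "deriv g 0 = D v" by (rule DERIV_imp_deriv)
  have hg: "g holomorphic_on A" if "open A" for A
    unfolding g_def by (rule holo_on_holomorphic_line[OF holo_on_homogeneous_poly[OF hom]]) (use that in auto)
  have "norm ((deriv ^^ 1) g 0) \<le> fact 1 * (real k * (\<rho> + s) ^ k) / (s / norm v) ^ 1"
  proof (rule Cauchy_inequality)
    show "g holomorphic_on ball 0 (s / norm v)" by (rule hg) simp
    show "continuous_on (cball 0 (s / norm v)) g"
      using holomorphic_on_imp_continuous_on[OF hg[OF open_UNIV]] continuous_on_subset by blast
    show "0 < s / norm v" using s False by simp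
    fix t assume t: "cmod (0 - t) = s / norm v"
    have "norm (z + t *s v) \<le> norm z + norm (t *s v)" by (rule norm_triangle_ineq)
    also have "norm (t *s v) = s" using t False by (simp add: norm_vector_smult)
    finally have "norm (z + t *s v) \<le> \<rho> + s" using z by simp
    hence "real k * norm (z + t *s v) ^ k \<le> real k * (\<rho> + s) ^ k" by (intro mult_left_mono power_mono) auto
    thus "cmod (g t) \<le> real k * (\<rho> + s) ^ k" using bound[of k "z + t *s v"] unfolding g_def by linarith
  qed
  thus ?thesis using d by simp
qed

text \<open>Termwise differentiation on the ball of radius \<open>\<rho>\<close>, which leaves room
  for \<open>s\<close> with \<open>\<rho> + s < 1\<close>; the derivatives of the terms then have
  the summable majorant \<open>b\<close>, and complex linearity passes to the sum.\<close>

lemma holo_on_S: "holo_on S B2"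
  unfolding holo_on_def
proof
  fix z :: C2 assume z: "z \<in> B2"
  have "\<forall>k. \<forall>w. \<exists>D. (G k has_derivative D) (at w) \<and> (\<forall>c v. D (c *s v) = c * D v)"
    using holo_on_homogeneous_poly[OF hom, of _ UNIV] unfolding holo_on_def by blast
  then obtain D where D: "\<And>k w. (G k has_derivative D k w) (at w)" "\<And>k w c v. D k w (c *s v) = c * D k w v" by metis
  define \<rho> where "\<rho> = (norm z + 1) / 2"
  define s where "s = (1 - \<rho>) / 2"
  have \<rho>: "norm z < \<rho>" "\<rho> < 1" "0 \<le> \<rho>" using z by (auto simp: \<rho>_def)
  have s: "s > 0" "\<rho> + s < 1" using \<rho> by (auto simp: s_def field_simps)
  define b where "b k = real k * (\<rho> + s) ^ k / s" for k
  have sb: "summable b" unfolding b_def by (intro summable_divide summable_bound) (use \<rho> s in auto)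
  have Db: "cmod (D k w v) \<le> b k * norm v" if "norm w \<le> \<rho>" for k w v
    unfolding b_def by (rule derivative_bound[OF D that s(1)])
  have sD: "summable (\<lambda>k. D k w v)" if "norm w \<le> \<rho>" for w v
    by (rule summable_comparison_test'[OF summable_mult2[OF sb] Db[OF that]])
  define D' where "D' w v = (\<Sum>k. D k w v)" for w v
  have "\<exists>g. \<forall>x\<in>ball 0 \<rho>. (\<lambda>k. G k x) sums g x \<and> (g has_derivative D' x) (at x within ball 0 \<rho>)"
  proof (rule has_derivative_series[where f' = D])
    show "convex (ball (0::C2) \<rho>)" by simp
    show "(G k has_derivative D k x) (at x within ball 0 \<rho>)" for k x
      using D(1) has_derivative_at_withinI by blast
    show "\<forall>\<^sub>F n in sequentially. \<forall>x\<in>ball 0 \<rho>. \<forall>h. norm ((\<Sum>i<n. D i x h) - D' x h) \<le> e * norm h" if e: "e > 0" for e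
    proof -
      obtain N where N: "\<And>n. n \<ge> N \<Longrightarrow> norm (\<Sum>i. b (i + n)) < e"
        using suminf_exist_split[OF e sb] by blast
      have "norm ((\<Sum>i<n. D i x h) - D' x h) \<le> e * norm h" if n: "n \<ge> N" and x: "x \<in> ball 0 \<rho>" for n x h
      proof -
        have xr: "norm x \<le> \<rho>" using x by simp
        have "D' x h = (\<Sum>i. D (i + n) x h) + (\<Sum>i<n. D i x h)"
          unfolding D'_def by (rule suminf_split_initial_segment[OF sD[OF xr]])
        hence "norm ((\<Sum>i<n. D i x h) - D' x h) = norm (\<Sum>i. D (i + n) x h)" by (simp add: norm_minus_commute)
        also have "\<dots> \<le> (\<Sum>i. b (i + n) * norm h)"
        proof (rule norm_suminf_le)
          show "norm (D (i + n) x h) \<le> b (i + n) * norm h" for i by (rule Db[OF xr])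
          show "summable (\<lambda>i. b (i + n) * norm h)" by (intro summable_mult2 summable_ignore_initial_segment sb)
        qed
        also have "\<dots> = (\<Sum>i. b (i + n)) * norm h"
          by (rule suminf_mult2[symmetric]) (intro summable_ignore_initial_segment sb)
        also have "\<dots> \<le> e * norm h" using N[OF n] by (intro mult_right_mono) auto
        finally show ?thesis .
      qed
      thus ?thesis unfolding eventually_sequentially by blast
    qed
    show "0 \<in> ball (0::C2) \<rho>" using \<rho> z by (simp add: \<rho>_def add_nonneg_pos)
    show "(\<lambda>k. G k 0) sums S 0" by (rule sums_S) simp
  qed
  then obtain g where g: "\<And>x. x \<in> ball 0 \<rho> \<Longrightarrow> (\<lambda>k. G k x) sums g x"
    "\<And>x. x \<in> ball 0 \<rho> \<Longrightarrow> (g has_derivative D' x) (at x within ball 0 \<rho>)" by blast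
  have zb: "z \<in> ball 0 \<rho>" using \<rho> by simp
  have gS: "g x = S x" if "x \<in> ball 0 \<rho>" for x
  proof -
    have "norm x < 1" using that \<rho>(2) by simp
    from sums_unique2[OF g(1)[OF that] sums_S[OF this]] show ?thesis .
  qed
  have "(g has_derivative D' z) (at z)"
    using g(2)[OF zb] unfolding at_within_open[OF zb open_ball] .
  hence "(S has_derivative D' z) (at z)"
    by (rule has_derivative_transform_within_open[OF _ open_ball zb]) (rule gS)
  moreover have "D' z (c *s v) = c * D' z v" for c v
    unfolding D'_def D(2) using sD[of z v] \<rho> by (intro suminf_mult) auto
  ultimately show "\<exists>D. (S has_derivative D) (at z) \<and> (\<forall>c v. D (c *s v) = c * D v)" by blast
qed

text \<open>On the line through a point \<open>u\<close> with \<open>G k u \<noteq> 0\<close> the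
  sum is a power series in one variable with a nonzero coefficient of positive degree and value 0 at
  the origin; its zero there is isolated.\<close>

lemma not_constant_S:
  assumes "G 0 = (\<lambda>z. 0)" "\<exists>k. G k \<noteq> (\<lambda>z. 0)"
  shows "\<not> S constant_on B2"
proof
  assume "S constant_on B2"
  then obtain c where c: "\<And>z. z \<in> B2 \<Longrightarrow> S z = c" unfolding constant_on_def by blast
  have G0: "G k 0 = 0" for k using bound[of k 0] assms(1) by (cases "k = 0") (auto simp: zero_power)
  have "S 0 = 0" unfolding S_def by (simp add: G0)
  hence c0: "c = 0" using c[of 0] by simp
  obtain k z where kz: "G k z \<noteq> 0" using assms(2) by (auto simp: fun_eq_iff)
  obtain u where u: "u \<in> S2" "z = of_real (norm z) *s u" by (rule polar)
  have "G k z = of_real (norm z) ^ k * G k u" by (subst u(2)) (rule homogeneous_poly_smult[OF hom])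
  hence ku: "G k u \<noteq> 0" using kz by auto
  have "k > 0" using kz assms(1) by (cases k) auto
  obtain s where s: "0 < s" "\<And>t. t \<in> cball 0 s - {0} \<Longrightarrow> S (t *s u) \<noteq> 0"
  proof (rule powser_0_nonzero[of 1 0 "\<lambda>k. G k u" "\<lambda>t. S (t *s u)" k])
    fix t :: complex assume "cmod (t - 0) < 1"
    hence "norm (t *s u) < 1" using u(1) by (simp add: norm_vector_smult)
    from sums_S[OF this] show "(\<lambda>n. G n u * (t - 0) ^ n) sums S (t *s u)"
      by (simp add: homogeneous_poly_smult[OF hom] mult.commute)
  next
    show "S (0 *s u) = 0" using \<open>S 0 = 0\<close> by simp
  qed (use ku \<open>k > 0\<close> in auto)
  define t where "t = complex_of_real (min s (1/2))"
  have "t \<in> cball 0 s - {0}" using s(1) by (auto simp: t_def)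
  from s(2)[OF this] have "S (t *s u) \<noteq> 0" .
  moreover have "t *s u \<in> B2" using u(1) s(1) by (auto simp: t_def norm_vector_smult)
  ultimately show False using c c0 by simp
qed

end

lemma exists_strict_mono_choice:
  assumes "\<And>i::nat. \<forall>\<^sub>F n in sequentially. P i n"
  obtains \<nu> :: "nat \<Rightarrow> nat" where "strict_mono \<nu>" "\<And>i. P i (\<nu> i)"
proof -
  have ex: "\<exists>n>m. P i n" for m i
    using eventually_conj[OF assms[of i] eventually_gt_at_top[of m]] eventually_happens' sequentially_bot by force
  have "\<exists>\<nu>. \<forall>i. P i (\<nu> i) \<and> \<nu> i < \<nu> (Suc i)"
    by (rule dependent_nat_choice) (use ex in blast)+
  then obtain \<nu> where "\<And>i. P i (\<nu> i)" "\<And>i. \<nu> i < \<nu> (Suc i)" by blast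
  thus ?thesis using that[of \<nu>] by (simp add: strict_mono_Suc_iff)
qed

section \<open>Radial limits and the theorem on the ball\<close>

context sphere_measure
begin

text \<open>Markov's inequality bounds the exceptional sets by (1/4)^i / (1/2)^i, a summable
  sequence, and the Borel-Cantelli lemma applies.\<close>

lemma AE_eventually_less:
  fixes u :: "nat \<Rightarrow> C2 \<Rightarrow> real"
  assumes "\<And>i. integrable \<sigma> (u i)" "\<And>i z. 0 \<le> u i z" "\<And>i. (\<integral>z. u i z \<partial>\<sigma>) \<le> (1/4) ^ i"
  shows "AE z in \<sigma>. \<forall>\<^sub>F i in sequentially. u i z < (1/2) ^ i"
proof -
  define A where "A i = {z \<in> space \<sigma>. (1/2) ^ i \<le> u i z}" for i
  have [measurable]: "u i \<in> borel_measurable \<sigma>" for i using assms(1) by auto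
  have A: "A i \<in> sets \<sigma>" for i unfolding A_def by measurable
  have "measure \<sigma> (A i) \<le> (1/2) ^ i" for i
  proof -
    have "measure \<sigma> (A i) \<le> (\<integral>z. u i z \<partial>\<sigma>) / (1/2) ^ i" unfolding A_def
      by (rule integral_Markov_inequality_measure[OF assms(1) A]) (use assms(2) in auto)
    also have "\<dots> \<le> (1/4) ^ i / (1/2) ^ i" by (intro divide_right_mono assms(3)) auto
    also have "\<dots> = (1/2 :: real) ^ i" by (simp add: power_divide[symmetric])
    finally show ?thesis .
  qed
  hence "summable (\<lambda>i. measure \<sigma> (A i))"
    by (intro summable_comparison_test'[OF summable_geometric[of "1/2 :: real"]]) auto
  hence "AE z in \<sigma>. \<forall>\<^sub>F i in sequentially. z \<in> space \<sigma> - A i"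
    by (intro borel_cantelli_AE1 A) (simp_all add: emeasure_eq_measure)
  thus ?thesis
  proof eventually_elim
    case (elim z)
    thus ?case by (rule eventually_mono) (auto simp: A_def)
  qed
qed

text \<open>The Cauchy-Schwarz inequality on a probability space, obtained from the pointwise bound
  2 c |q| \<le> c^2 + |q|^2.\<close>

lemma integral_cmod_le:
  fixes q :: "C2 \<Rightarrow> complex"
  assumes q: "continuous_on S2 q" and c: "c > 0" and le: "(\<integral>z. (cmod (q z))\<^sup>2 \<partial>\<sigma>) \<le> c\<^sup>2"
  shows "(\<integral>z. cmod (q z) \<partial>\<sigma>) \<le> c"
proof -
  have i2: "integrable \<sigma> (\<lambda>z. (cmod (q z))\<^sup>2)" by (intro integrable_cont continuous_intros q)
  have "(\<integral>z. cmod (q z) \<partial>\<sigma>) \<le> (\<integral>z. c / 2 + (cmod (q z))\<^sup>2 / (2 * c) \<partial>\<sigma>)"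
  proof (rule integral_mono)
    show "integrable \<sigma> (\<lambda>z. cmod (q z))" by (intro integrable_cont continuous_intros q)
    show "integrable \<sigma> (\<lambda>z. c / 2 + (cmod (q z))\<^sup>2 / (2 * c))"
      by (intro integrable_cont continuous_intros q) (use c in auto)
    fix z
    have "0 \<le> (cmod (q z) - c)\<^sup>2" by simp
    hence "2 * c * cmod (q z) \<le> c\<^sup>2 + (cmod (q z))\<^sup>2" by (simp add: power2_eq_square algebra_simps)
    thus "cmod (q z) \<le> c / 2 + (cmod (q z))\<^sup>2 / (2 * c)" using c by (simp add: field_simps power2_eq_square)
  qed
  also have "\<dots> = c / 2 + (\<integral>z. (cmod (q z))\<^sup>2 \<partial>\<sigma>) / (2 * c)"
  proof -
    have "prob S2 = 1" using prob_space by simp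
    thus ?thesis using i2 by simp
  qed
  also have "\<dots> \<le> c / 2 + c\<^sup>2 / (2 * c)" using le c by (intro add_left_mono divide_right_mono) auto
  also have "\<dots> = c" using c by (simp add: power2_eq_square)
  finally show ?thesis .
qed

text \<open>The series is cut into blocks \<open>Q i\<close> so small in the quadratic mean that,
  for almost every boundary point, their maximal functions along the radius are eventually at most
  (1/2)^i. The blocks then converge uniformly on the closed radius, so the radial limit exists and
  is the limit of the partial sums \<open>s i\<close> at the boundary point itself, where their
  moduli tend to \<open>\<phi>\<close>.\<close>

theorem exists_E_function_ball:
  fixes \<phi> :: "C2 \<Rightarrow> real"
  assumes lsc: "lower_semicontinuous_on S2 \<phi>" and pos: "\<And>z. z \<in> S2 \<Longrightarrow> \<phi> z > 0"
    and int: "integrable \<sigma> (\<lambda>z. (\<phi> z)\<^sup>2)" and LI: "LI_set E"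
  obtains G F where "\<And>k. homogeneous_poly k (G k)" "\<And>k. k \<notin> E \<Longrightarrow> G k = (\<lambda>z. 0)"
    "holo_on F B2" "\<not> F constant_on B2"
    "\<And>K. compact K \<Longrightarrow> K \<subseteq> B2 \<Longrightarrow> uniform_limit K (\<lambda>n z. \<Sum>k<n. G k z) F sequentially"
    "\<And>r. 0 < r \<Longrightarrow> r < 1 \<Longrightarrow> (\<integral>\<^sup>+z. ennreal ((cmod (F (r *\<^sub>R z)))\<^sup>2) \<partial>\<sigma>) \<le> ennreal (\<integral>z. (\<phi> z)\<^sup>2 \<partial>\<sigma>)"
    "AE z in \<sigma>. \<exists>L. ((\<lambda>r. F (r *\<^sub>R z)) \<longlongrightarrow> L) (at_left 1) \<and> cmod L = \<phi> z"
proof -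
  obtain G and K :: "nat \<Rightarrow> nat" where K: "strict_mono K" and hom: "\<And>k. homogeneous_poly k (G k)" and
    GE: "\<And>k. k \<notin> E \<or> k = 0 \<Longrightarrow> G k = (\<lambda>z. 0)" and
    growth: "\<And>k z. z \<in> S2 \<Longrightarrow> cmod (G k z) \<le> real k" and
    lt: "\<And>n z. z \<in> S2 \<Longrightarrow> cmod (\<Sum>k<K n. G k z) < \<phi> z" and
    bd: "\<And>n. (\<Sum>k<n. \<integral>z. (cmod (G k z))\<^sup>2 \<partial>\<sigma>) \<le> (\<integral>z. (\<phi> z)\<^sup>2 \<partial>\<sigma>)" and
    di: "\<And>n. integrable \<sigma> (\<lambda>z. (\<phi> z - cmod (\<Sum>k<K n. G k z))\<^sup>2)" and
    dlim: "(\<lambda>n. \<integral>z. (\<phi> z - cmod (\<Sum>k<K n. G k z))\<^sup>2 \<partial>\<sigma>) \<longlonglongrightarrow> 0" and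
    nz: "\<exists>k. G k \<noteq> (\<lambda>z. 0)"
    by (rule exists_E_series[OF lsc pos int LI]) (assumption, rule that, assumption+)
  interpret poly_series G by (unfold_locales) (rule hom, rule growth)
  define a where "a k = (\<integral>z. (cmod (G k z))\<^sup>2 \<partial>\<sigma>)" for k
  have a0: "a k \<ge> 0" for k unfolding a_def by (rule Bochner_Integration.integral_nonneg) simp
  have sa: "summable a" by (rule summableI_nonneg_bounded[OF a0 bd[folded a_def]])
  have cG: "continuous_on X (G k)" for X k by (rule continuous_on_homogeneous_poly[OF hom])
  have rsm: "r *\<^sub>R z = of_real r *s z" for r and z :: C2
    by (simp add: vec_eq_iff) (simp add: scaleR_conv_of_real)
  have Gr: "G k (r *\<^sub>R z) = of_real (r ^ k) * G k z" for k r z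
    unfolding rsm homogeneous_poly_smult[OF hom] by simp
  \<comment> \<open>Fatou's lemma for the partial sums, whose terms at radius \<open>r\<close>
    remain orthogonal and shrink by the factors \<open>r ^ k \<le> 1\<close>.\<close>
  have h2: "(\<integral>\<^sup>+z. ennreal ((cmod (S (r *\<^sub>R z)))\<^sup>2) \<partial>\<sigma>) \<le> ennreal (\<integral>z. (\<phi> z)\<^sup>2 \<partial>\<sigma>)" if r: "0 < r" "r < 1" for r
  proof -
    define u where "u n z = ennreal ((cmod (\<Sum>k<n. G k (r *\<^sub>R z)))\<^sup>2)" for n z
    have cs: "continuous_on X (\<lambda>z. \<Sum>k<n. G k (r *\<^sub>R z))" for X n
      unfolding Gr by (intro continuous_on_sum continuous_on_mult continuous_on_const cG)
    have um: "u n \<in> borel_measurable \<sigma>" for n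
      unfolding u_def[abs_def] using borel_measurable_cont[OF cs] by measurable
    have "(\<integral>\<^sup>+z. ennreal ((cmod (S (r *\<^sub>R z)))\<^sup>2) \<partial>\<sigma>) = (\<integral>\<^sup>+z. liminf (\<lambda>n. u n z) \<partial>\<sigma>)"
    proof (rule nn_integral_cong)
      fix z assume "z \<in> space \<sigma>"
      hence "norm (r *\<^sub>R z) < 1" using r by simp
      from sums_S[OF this] have "(\<lambda>n. \<Sum>k<n. G k (r *\<^sub>R z)) \<longlonglongrightarrow> S (r *\<^sub>R z)" unfolding sums_def .
      hence "(\<lambda>n. u n z) \<longlonglongrightarrow> ennreal ((cmod (S (r *\<^sub>R z)))\<^sup>2)"
        unfolding u_def by (intro tendsto_ennrealI tendsto_power tendsto_norm)
      thus "ennreal ((cmod (S (r *\<^sub>R z)))\<^sup>2) = liminf (\<lambda>n. u n z)" by (simp add: lim_imp_Liminf)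
    qed
    also have "\<dots> \<le> liminf (\<lambda>n. \<integral>\<^sup>+z. u n z \<partial>\<sigma>)" by (rule nn_integral_liminf[OF um])
    also have "\<dots> \<le> ennreal (\<integral>z. (\<phi> z)\<^sup>2 \<partial>\<sigma>)"
    proof (rule Liminf_le)
      show "\<forall>\<^sub>F n in sequentially. (\<integral>\<^sup>+z. u n z \<partial>\<sigma>) \<le> ennreal (\<integral>z. (\<phi> z)\<^sup>2 \<partial>\<sigma>)"
      proof (rule always_eventually, rule allI)
        fix n
        have "(\<integral>\<^sup>+z. u n z \<partial>\<sigma>) = ennreal (\<integral>z. (cmod (\<Sum>k<n. G k (r *\<^sub>R z)))\<^sup>2 \<partial>\<sigma>)"
          unfolding u_def by (intro nn_integral_eq_integral integrable_cont continuous_on_power continuous_on_norm cs) auto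
        also have "(\<integral>z. (cmod (\<Sum>k<n. G k (r *\<^sub>R z)))\<^sup>2 \<partial>\<sigma>) = (\<Sum>k<n. \<integral>z. (cmod (of_real (r ^ k) * G k z))\<^sup>2 \<partial>\<sigma>)"
          unfolding Gr by (rule integral_sum_homogeneous) (auto intro: homogeneous_poly_cmult hom)
        also have "\<dots> \<le> (\<Sum>k<n. a k)"
        proof (rule sum_mono)
          fix k
          have "(cmod (of_real (r ^ k) * G k z))\<^sup>2 \<le> (cmod (G k z))\<^sup>2" for z
            unfolding norm_mult norm_of_real
            by (intro power_mono mult_left_le_one_le) (use r in \<open>auto simp: power_le_one\<close>)
          thus "(\<integral>z. (cmod (of_real (r ^ k) * G k z))\<^sup>2 \<partial>\<sigma>) \<le> a k"
            unfolding a_def by (intro integral_mono integrable_cont continuous_intros cG)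
        qed
        also have "\<dots> \<le> (\<integral>z. (\<phi> z)\<^sup>2 \<partial>\<sigma>)" using bd[of n] unfolding a_def .
        finally show "(\<integral>\<^sup>+z. u n z \<partial>\<sigma>) \<le> ennreal (\<integral>z. (\<phi> z)\<^sup>2 \<partial>\<sigma>)" by (simp add: ennreal_leI)
      qed
    qed simp
    finally show ?thesis .
  qed
  define tail where "tail n = (\<Sum>k. a (k + K n))" for n
  have "(\<lambda>n. \<Sum>k. a (k + n)) \<longlonglongrightarrow> 0" by (rule suminf_exist_split2[OF sa])
  from LIMSEQ_subseq_LIMSEQ[OF this K] have tlim: "tail \<longlonglongrightarrow> 0" unfolding tail_def comp_def .
  define d where "d n = (\<integral>z. (\<phi> z - cmod (\<Sum>k<K n. G k z))\<^sup>2 \<partial>\<sigma>)" for n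
  \<comment> \<open>The rate (1/8)^i outweighs the loss 2^i in the maximal inequality at level
    (1/2)^i and leaves the summable bound 10 (1/4)^i. The second condition will make
    \<open>cmod (s i z)\<close> tend to \<open>\<phi> z\<close> almost everywhere.\<close>
  obtain \<nu> where \<nu>: "strict_mono \<nu>" "\<And>i. tail (\<nu> i) < ((1/8) ^ i)\<^sup>2 \<and> d (\<nu> i) < (1/4) ^ i"
  proof (rule exists_strict_mono_choice[of "\<lambda>i n. tail n < ((1/8) ^ i)\<^sup>2 \<and> d n < (1/4) ^ i"])
    fix i
    have "\<forall>\<^sub>F n in sequentially. tail n < ((1/8) ^ i)\<^sup>2" by (rule order_tendstoD(2)[OF tlim]) simp
    moreover have "\<forall>\<^sub>F n in sequentially. d n < (1/4) ^ i"
      unfolding d_def by (rule order_tendstoD(2)[OF dlim]) simp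
    ultimately show "\<forall>\<^sub>F n in sequentially. tail n < ((1/8) ^ i)\<^sup>2 \<and> d n < (1/4) ^ i" by (rule eventually_conj)
  qed (rule that)
  define N where "N i = K (\<nu> i)" for i
  have N: "strict_mono N" unfolding N_def using strict_mono_o[OF K \<nu>(1)] by (simp add: comp_def)
  have NS: "N i \<le> N (Suc i)" for i using N by (simp add: strict_mono_less_eq)
  define s where "s i z = (\<Sum>k<N i. G k z)" for i z
  define Q where "Q i z = (\<Sum>k\<in>{N i..<N (Suc i)}. G k z)" for i z
  have sQ: "s (Suc i) z = s i z + Q i z" for i z
    unfolding s_def Q_def using sum.atLeastLessThan_concat[of 0 "N i" "N (Suc i)" "\<lambda>k. G k z"] NS[of i]
    by (simp add: atLeast0LessThan)
  have cQ: "continuous_on X (Q i)" for X i unfolding Q_def by (intro continuous_on_sum cG)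
  have Q1: "(\<integral>z. cmod (Q i z) \<partial>\<sigma>) \<le> (1/8) ^ i" for i
  proof (rule integral_cmod_le[OF cQ])
    have "(\<integral>z. (cmod (Q i z))\<^sup>2 \<partial>\<sigma>) = (\<Sum>k\<in>{N i..<N (Suc i)}. a k)"
      unfolding Q_def a_def by (rule integral_sum_homogeneous) (auto intro: hom)
    also have "\<dots> = (\<Sum>k<N (Suc i) - N i. a (k + N i))"
      using sum.shift_bounds_nat_ivl[of a 0 "N i" "N (Suc i) - N i"] NS[of i] by (simp add: atLeast0LessThan)
    also have "\<dots> \<le> tail (\<nu> i)" unfolding tail_def N_def[symmetric]
      by (intro sum_le_suminf summable_ignore_initial_segment sa) (auto simp: a0)
    also have "\<dots> \<le> ((1/8) ^ i)\<^sup>2" using \<nu>(2)[of i] by simp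
    finally show "(\<integral>z. (cmod (Q i z))\<^sup>2 \<partial>\<sigma>) \<le> ((1/8) ^ i)\<^sup>2" .
  qed simp
  define A where "A i = {z \<in> S2. \<exists>r\<in>{0..<1}. (1/2) ^ i < cmod (Q i (of_real r *s z))}" for i
  have A: "A i \<in> sets \<sigma>" "measure \<sigma> (A i) \<le> 10 / (1/2) ^ i * (\<integral>z. cmod (Q i z) \<partial>\<sigma>)" for i
    unfolding A_def Q_def by (rule sphere_maximal; use hom in simp)+
  have "measure \<sigma> (A i) \<le> 10 * (1/4) ^ i" for i
  proof -
    have "10 / (1/2) ^ i * (\<integral>z. cmod (Q i z) \<partial>\<sigma>) \<le> 10 / (1/2) ^ i * (1/8) ^ i" by (intro mult_left_mono Q1) auto
    also have "\<dots> = 10 * ((1/8) ^ i / (1/2) ^ i)" by simp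
    also have "\<dots> = 10 * (1/4 :: real) ^ i" by (simp add: power_divide[symmetric])
    finally show ?thesis using A(2)[of i] by linarith
  qed
  hence "summable (\<lambda>i. measure \<sigma> (A i))"
    by (intro summable_comparison_test'[OF summable_mult[OF summable_geometric[of "1/4 :: real"], of 10]]) auto
  hence "AE z in \<sigma>. \<forall>\<^sub>F i in sequentially. z \<in> space \<sigma> - A i"
    by (intro borel_cantelli_AE1 A) (simp_all add: emeasure_eq_measure)
  moreover have "AE z in \<sigma>. \<forall>\<^sub>F i in sequentially. (\<phi> z - cmod (s i z))\<^sup>2 < (1/2) ^ i"
  proof (rule AE_eventually_less)
    show "integrable \<sigma> (\<lambda>z. (\<phi> z - cmod (s i z))\<^sup>2)" for i unfolding s_def N_def by (rule di)
    show "(\<integral>z. (\<phi> z - cmod (s i z))\<^sup>2 \<partial>\<sigma>) \<le> (1/4) ^ i" for i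
      using \<nu>(2)[of i] unfolding d_def s_def N_def by simp
  qed simp
  ultimately have radial: "AE z in \<sigma>. \<exists>L. ((\<lambda>r. S (r *\<^sub>R z)) \<longlongrightarrow> L) (at_left 1) \<and> cmod L = \<phi> z"
  proof (rule AE_mp[OF AE_conjI, OF _ _ AE_I2], intro impI, elim conjE)
    fix z assume "z \<in> space \<sigma>" and e1: "\<forall>\<^sub>F i in sequentially. z \<in> space \<sigma> - A i"
      and e2: "\<forall>\<^sub>F i in sequentially. (\<phi> z - cmod (s i z))\<^sup>2 < (1/2) ^ i"
    hence z: "z \<in> S2" by simp
    obtain i0 where i0: "\<And>i. i \<ge> i0 \<Longrightarrow> z \<notin> A i" using e1 unfolding eventually_sequentially by blast
    have cr: "continuous_on X (\<lambda>r. F (r *\<^sub>R z))" if "\<And>Y. continuous_on Y F" for F :: "C2 \<Rightarrow> complex" and X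
      by (rule continuous_on_compose2[OF that]) (auto intro!: continuous_intros)
    \<comment> \<open>The maximal function controls radii below 1; continuity of the polynomial
      \<open>Q i\<close> carries the bound to the endpoint 1.\<close>
    have Qr: "cmod (Q i (r *\<^sub>R z)) \<le> (1/2) ^ i" if i: "i \<ge> i0" and r: "r \<in> {0..1}" for i r
    proof -
      have "closed {r. cmod (Q i (r *\<^sub>R z)) \<le> (1/2) ^ i}"
        by (intro closed_Collect_le continuous_on_norm cr cQ continuous_on_const)
      moreover have "{0..<1} \<subseteq> {r. cmod (Q i (r *\<^sub>R z)) \<le> (1/2) ^ i}"
        using i0[OF i] z unfolding A_def rsm by (auto simp: not_less)
      ultimately have "closure {0..<1::real} \<subseteq> {r. cmod (Q i (r *\<^sub>R z)) \<le> (1/2) ^ i}" by (intro closure_minimal)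
      thus ?thesis using r by auto
    qed
    have ul: "uniform_limit {0..1} (\<lambda>n r. \<Sum>i<n. Q (i + i0) (r *\<^sub>R z)) (\<lambda>r. \<Sum>i. Q (i + i0) (r *\<^sub>R z)) sequentially"
    proof (rule Weierstrass_m_test)
      show "cmod (Q (i + i0) (r *\<^sub>R z)) \<le> (1/2) ^ i" if "r \<in> {0..1}" for i r
      proof -
        have "cmod (Q (i + i0) (r *\<^sub>R z)) \<le> (1/2) ^ (i + i0)" using that by (intro Qr) auto
        also have "\<dots> \<le> (1/2 :: real) ^ i" by (intro power_decreasing) auto
        finally show ?thesis .
      qed
    qed (simp add: summable_geometric)
    have tele: "s i0 w + (\<Sum>i<n. Q (i + i0) w) = s (n + i0) w" for n w
      by (induction n) (simp_all add: sQ add.assoc[symmetric])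
    define T where "T r = s i0 (r *\<^sub>R z) + (\<Sum>i. Q (i + i0) (r *\<^sub>R z))" for r
    have cs: "continuous_on X (s i)" for X i unfolding s_def by (intro continuous_on_sum cG)
    have cT: "continuous_on {0..1} T" unfolding T_def
    proof (rule continuous_on_add[OF cr[OF cs]])
      show "continuous_on {0..1} (\<lambda>r. \<Sum>i. Q (i + i0) (r *\<^sub>R z))"
        by (rule uniform_limit_theorem[OF _ ul]) (auto intro!: always_eventually continuous_on_sum cr cQ)
    qed
    have limT: "(\<lambda>n. s (n + i0) (r *\<^sub>R z)) \<longlonglongrightarrow> T r" if r: "r \<in> {0..1}" for r
    proof -
      have "(\<lambda>n. s i0 (r *\<^sub>R z) + (\<Sum>i<n. Q (i + i0) (r *\<^sub>R z))) \<longlonglongrightarrow> T r"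
        unfolding T_def by (intro tendsto_add tendsto_const tendsto_uniform_limitI[OF ul r])
      thus ?thesis unfolding tele .
    qed
    have TS: "T r = S (r *\<^sub>R z)" if r: "0 \<le> r" "r < 1" for r
    proof -
      have "norm (r *\<^sub>R z) < 1" using r z by simp
      from sums_S[OF this] have "(\<lambda>n. \<Sum>k<n. G k (r *\<^sub>R z)) \<longlonglongrightarrow> S (r *\<^sub>R z)" unfolding sums_def .
      from LIMSEQ_subseq_LIMSEQ[OF this N] have "(\<lambda>i. s i (r *\<^sub>R z)) \<longlonglongrightarrow> S (r *\<^sub>R z)"
        unfolding s_def comp_def .
      from LIMSEQ_ignore_initial_segment[OF this, of i0] show ?thesis
        using limT[of r] r by (auto intro: LIMSEQ_unique)
    qed
    have "(T \<longlongrightarrow> T 1) (at 1 within {0..1})" using cT by (simp add: continuous_on_def)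
    hence "(T \<longlongrightarrow> T 1) (at_left 1)" by (simp add: at_within_Icc_at_left)
    moreover have "\<forall>\<^sub>F r in at_left (1::real). T r = S (r *\<^sub>R z)"
      by (rule eventually_at_leftI[of 0]) (use TS in auto)
    ultimately have L: "((\<lambda>r. S (r *\<^sub>R z)) \<longlongrightarrow> T 1) (at_left 1)"
      by (rule Lim_transform_eventually)
    have "(\<lambda>i. (1/2 :: real) ^ i) \<longlonglongrightarrow> 0" by (rule LIMSEQ_realpow_zero) auto
    hence "(\<lambda>i. (\<phi> z - cmod (s i z))\<^sup>2) \<longlonglongrightarrow> 0"
      by (rule tendsto_sandwich[OF _ _ tendsto_const, rotated 2]) (use e2 in \<open>auto elim: eventually_mono\<close>)
    hence "(\<lambda>i. sqrt ((\<phi> z - cmod (s i z))\<^sup>2)) \<longlonglongrightarrow> sqrt 0" by (rule tendsto_real_sqrt)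
    hence "(\<lambda>i. \<phi> z - cmod (s i z)) \<longlonglongrightarrow> 0" by (simp add: tendsto_rabs_zero_iff)
    from LIMSEQ_ignore_initial_segment[OF this, of i0]
    have "(\<lambda>i. \<phi> z - cmod (s (i + i0) z)) \<longlonglongrightarrow> 0" .
    moreover have "(\<lambda>i. \<phi> z - cmod (s (i + i0) z)) \<longlonglongrightarrow> \<phi> z - cmod (T 1)"
      using limT[of 1] by (intro tendsto_diff tendsto_const tendsto_norm) simp
    ultimately have "\<phi> z - cmod (T 1) = 0" using LIMSEQ_unique by blast
    thus "\<exists>L. ((\<lambda>r. S (r *\<^sub>R z)) \<longlongrightarrow> L) (at_left 1) \<and> cmod L = \<phi> z" using L by (intro exI[of _ "T 1"]) simp
  qed
  show ?thesis
  proof (rule that[of G S])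
    show "\<not> S constant_on B2" by (rule not_constant_S[OF _ nz]) (simp add: GE)
  qed (use hom GE holo_on_S uniform_limit_S h2 radial in blast)+
qed

end

section \<open>Transfer to the covering\<close>

lemma holo_map_continuous:
  assumes "holo_map_on f U"
  shows "continuous_on U f"
proof -
  have "continuous_on U (\<lambda>z. \<chi> i. f z $ i)"
    using assms unfolding holo_map_on_def by (intro continuous_on_vec_lambda holo_on_continuous) blast
  thus ?thesis by simp
qed

lemma holo_on_compose:
  assumes f: "holo_map_on f U" and F: "holo_on F W" and fU: "f ` U \<subseteq> W"
  shows "holo_on (F \<circ> f) U"
  unfolding holo_on_def
proof
  fix z assume z: "z \<in> U"
  have fi: "holo_on (\<lambda>z. f z $ i) U" for i using f unfolding holo_map_on_def by blast
  obtain D1 where D1: "((\<lambda>z. f z $ 1) has_derivative D1) (at z)" "\<And>c v. D1 (c *s v) = c * D1 v"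
    using fi[of 1] z unfolding holo_on_def by blast
  obtain D2 where D2: "((\<lambda>z. f z $ 2) has_derivative D2) (at z)" "\<And>c v. D2 (c *s v) = c * D2 v"
    using fi[of 2] z unfolding holo_on_def by blast
  obtain D where D: "(F has_derivative D) (at (f z))" "\<And>c v. D (c *s v) = c * D v"
    using F z fU unfolding holo_on_def by blast
  have bl: "bounded_linear (\<lambda>x::complex. x *s (a::C2))" for a
  proof -
    have "linear (\<lambda>x::complex. x *s a)" by (rule linearI) (simp_all add: vec_eq_iff forall_2 algebra_simps)
    thus ?thesis by (simp add: linear_conv_bounded_linear)
  qed
  have "((\<lambda>z. f z $ 1 *s (axis 1 1 :: C2) + f z $ 2 *s axis 2 1) has_derivative (\<lambda>v. D1 v *s axis 1 1 + D2 v *s axis 2 1)) (at z)"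
    by (rule has_derivative_add[OF bounded_linear.has_derivative[OF bl D1(1)] bounded_linear.has_derivative[OF bl D2(1)]])
  hence df: "(f has_derivative (\<lambda>v. pt (D1 v) (D2 v))) (at z)" unfolding pt_sum[symmetric] by simp
  have "((F \<circ> f) has_derivative (\<lambda>v. D (pt (D1 v) (D2 v)))) (at z)"
    unfolding comp_def using has_derivative_compose[OF df D(1)] .
  moreover have "pt (c * x) (c * y) = c *s pt x y" for c x y by (simp add: vec_eq_iff forall_2)
  ultimately show "\<exists>D. ((F \<circ> f) has_derivative D) (at z) \<and> (\<forall>c v. D (c *s v) = c * D v)"
    by (intro exI[of _ "\<lambda>v. D (pt (D1 v) (D2 v))"]) (simp add: D1(2) D2(2) D(2))
qed

text \<open>The covering counts N points only over the complement of \<open>T\<close>. At each point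
  of the fibre in \<open>M\<close> the map is open, so every \<open>y'\<close> near \<open>y\<close>
  has preimages in disjoint balls around all these points; a \<open>y'\<close> outside
  \<open>T\<close> shows that there are at most N of them.\<close>

lemma fibre_card_le:
  assumes f: "holo_map_on f UNIV" and M: "open M" and cov: "finite_ramified_covering (closure M) f Y N"
    and y: "y \<in> Y"
  shows "finite {w\<in>M. f w = y}" "card {w\<in>M. f w = y} \<le> N"
proof -
  define F0 where "F0 = {w\<in>M. f w = y}"
  have fib: "\<forall>y\<in>Y. finite {x\<in>closure M. f x = y}"
    using cov unfolding finite_ramified_covering_def by (elim conjE)
  from cov[unfolded finite_ramified_covering_def, THEN conjunct2, THEN conjunct2, THEN conjunct2]
  obtain T where T0: "Y \<subseteq> closure (Y - T)" "\<forall>y\<in>Y - T. card {x\<in>closure M. f x = y} = N"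
    by (elim exE conjE)
  note T = T0(1) bspec[OF T0(2)]
  have sub: "F0 \<subseteq> {x\<in>closure M. f x = y}" using closure_subset unfolding F0_def by blast
  have fin: "finite F0" using finite_subset[OF sub bspec[OF fib y]] .
  thus "finite {w\<in>M. f w = y}" unfolding F0_def .
  show "card {w\<in>M. f w = y} \<le> N"
  proof (cases "F0 = {}")
    case True thus ?thesis by (simp add: F0_def[symmetric])
  next
    case False
    \<comment> \<open>With the factor 3 two radii add up to at most two thirds of the distance of
      the centres, so the balls are disjoint; moreover no other point of the fibre lies on the
      boundary of a ball, as the openness lemma requires.\<close>
    have "\<forall>w\<in>F0. \<exists>e>0. cball w e \<subseteq> M \<and> (\<forall>w'\<in>F0. w' \<noteq> w \<longrightarrow> 3 * e \<le> dist w w')"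
    proof
      fix w assume "w \<in> F0"
      then obtain e1 where e1: "e1 > 0" "cball w e1 \<subseteq> M"
        using M open_contains_cball unfolding F0_def by blast
      obtain d where d: "d > 0" "\<forall>w'\<in>F0. w' \<noteq> w \<longrightarrow> d \<le> dist w w'" using finite_set_avoid[OF fin, of w] by blast
      show "\<exists>e>0. cball w e \<subseteq> M \<and> (\<forall>w'\<in>F0. w' \<noteq> w \<longrightarrow> 3 * e \<le> dist w w')"
      proof (intro exI[of _ "min e1 (d/3)"] conjI ballI impI)
        show "cball w (min e1 (d/3)) \<subseteq> M" using e1(2) by auto
        fix w' assume "w' \<in> F0" "w' \<noteq> w"
        hence "d \<le> dist w w'" using d(2) by blast
        thus "3 * min e1 (d/3) \<le> dist w w'" by linarith
      qed (use e1 d in auto)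
    qed
    from bchoice[OF this] obtain e where e: "\<And>w. w \<in> F0 \<Longrightarrow> e w > 0" "\<And>w. w \<in> F0 \<Longrightarrow> cball w (e w) \<subseteq> M"
      "\<And>w w'. w \<in> F0 \<Longrightarrow> w' \<in> F0 \<Longrightarrow> w' \<noteq> w \<Longrightarrow> 3 * e w \<le> dist w w'" by blast
    have "\<forall>w\<in>F0. \<exists>c>0. ball y c \<subseteq> f ` ball w (e w)"
    proof
      fix w assume w: "w \<in> F0"
      have fw: "f w = y" using w by (simp add: F0_def)
      obtain c where "c > 0" "ball (f w) c \<subseteq> f ` ball w (e w)"
      proof (rule open_at_isolated_preimage[OF f, of "ball w (e w)" w])
        fix v assume "v \<in> frontier (ball w (e w))"
        hence v: "dist w v = e w" using e(1)[OF w] by (simp add: frontier_ball)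
        show "f v \<noteq> f w"
        proof
          assume "f v = f w"
          hence "v \<in> F0" using e(2)[OF w] v fw unfolding F0_def by auto
          moreover have "v \<noteq> w" using v e(1)[OF w] by auto
          ultimately show False using e(3)[OF w, of v] v e(1)[OF w] by linarith
        qed
      qed (use e(1)[OF w] in auto)
      thus "\<exists>c>0. ball y c \<subseteq> f ` ball w (e w)" unfolding fw by blast
    qed
    from bchoice[OF this] obtain c where c: "\<And>w. w \<in> F0 \<Longrightarrow> c w > 0" "\<And>w. w \<in> F0 \<Longrightarrow> ball y (c w) \<subseteq> f ` ball w (e w)" by blast
    define c0 where "c0 = Min (c ` F0)"
    have c0: "c0 > 0" "\<And>w. w \<in> F0 \<Longrightarrow> c0 \<le> c w" using c(1) fin False unfolding c0_def by auto
    obtain y' where y': "y' \<in> Y - T" "dist y' y < c0"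
      using T(1) y c0(1) closure_approachable[of y "Y - T"] by blast
    have "\<forall>w\<in>F0. \<exists>v. v \<in> ball w (e w) \<and> f v = y'"
    proof
      fix w assume w: "w \<in> F0"
      have "y' \<in> ball y (c w)" using y'(2) c0(2)[OF w] by (simp add: dist_commute)
      thus "\<exists>v. v \<in> ball w (e w) \<and> f v = y'" using c(2)[OF w] by blast
    qed
    from bchoice[OF this] obtain g where g: "\<And>w. w \<in> F0 \<Longrightarrow> g w \<in> ball w (e w)" "\<And>w. w \<in> F0 \<Longrightarrow> f (g w) = y'" by blast
    have "inj_on g F0"
    proof (rule inj_onI, rule ccontr)
      fix w w' assume w: "w \<in> F0" "w' \<in> F0" and eq: "g w = g w'" and ne: "w \<noteq> w'"
      have "dist w w' \<le> dist w (g w) + dist w' (g w')" unfolding eq by (rule dist_triangle2)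
      moreover have "dist w (g w) < e w" "dist w' (g w') < e w'" using g(1) w by auto
      moreover have "3 * e w \<le> dist w w'" "3 * e w' \<le> dist w w'"
        using e(3)[OF w(1,2)] e(3)[OF w(2,1)] ne by (auto simp: dist_commute)
      ultimately show False using e(1)[OF w(1)] e(1)[OF w(2)] by linarith
    qed
    moreover have "g ` F0 \<subseteq> {x\<in>closure M. f x = y'}"
    proof
      fix v assume "v \<in> g ` F0"
      then obtain w where w: "w \<in> F0" "v = g w" by blast
      have "g w \<in> M" using g(1)[OF w(1)] e(2)[OF w(1)] ball_subset_cball by blast
      thus "v \<in> {x\<in>closure M. f x = y'}" using w g(2) closure_subset by auto
    qed
    ultimately have "card F0 \<le> card {x\<in>closure M. f x = y'}" using y'(1) fib by (intro card_inj_on_le) auto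
    thus ?thesis using T(2)[OF y'(1)] by (simp add: F0_def)
  qed
qed

text \<open>Near a point of a sheet, the inverse branch of \<open>f\<close> maps the part of a small ball inside the unit
  ball into \<open>M\<close>: the image is connected, avoids the boundary and meets \<open>M\<close>.\<close>

lemma sheet_boundary_value:
  assumes fM: "f ` M = B2" and fr: "f ` frontier M = S2"
    and \<zeta>: "\<zeta> \<in> frontier M" "\<zeta> \<in> V'" and bi: "biholomorphism V' U' f"
    and lim: "((\<lambda>r. F (r *\<^sub>R f \<zeta>)) \<longlongrightarrow> L) (at_left 1)"
  shows "has_boundary_value f M (F \<circ> f) \<zeta> L"
proof -
  have V': "open V'" "open U'" "bij_betw f V' U'" "holo_map_on f V'" "holo_map_on (inv_into V' f) U'"
    using bi unfolding biholomorphism_def by blast+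
  define g where "g = inv_into V' f"
  have cf: "continuous_on V' f" by (rule holo_map_continuous[OF V'(4)])
  have cg: "continuous_on U' g" unfolding g_def by (rule holo_map_continuous[OF V'(5)])
  have gf: "g (f v) = v" if "v \<in> V'" for v
    unfolding g_def using that V'(3) by (simp add: bij_betw_inv_into_left)
  have fg: "f (g u) = u" "g u \<in> V'" if "u \<in> U'" for u
    unfolding g_def using that V'(3) by (auto simp: bij_betw_inv_into_right bij_betw_def inv_into_into)
  define y where "y = f \<zeta>"
  have y: "y \<in> U'" "norm y = 1" using \<zeta> V'(3) fr unfolding y_def by (auto simp: bij_betw_def)
  obtain e where e: "e > 0" "ball y e \<subseteq> U'" using V'(2) y(1) open_contains_ball by blast
  define B0 where "B0 = ball y e \<inter> B2"
  have B0U: "B0 \<subseteq> U'" using e(2) by (auto simp: B0_def)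
  have inM: "g u \<in> M" if u: "u \<in> B0" for u
  proof (rule ccontr)
    assume "g u \<notin> M"
    have "open (V' \<inter> f -` ball y e)" by (rule continuous_open_preimage[OF cf V'(1) open_ball])
    moreover have "\<zeta> \<in> V' \<inter> f -` ball y e" using \<zeta>(2) e(1) by (simp add: y_def)
    moreover have "\<zeta> \<in> closure M" using \<zeta>(1) by (simp add: frontier_def)
    ultimately obtain w where w: "w \<in> M" "w \<in> V'" "f w \<in> ball y e"
      using open_Int_closure_eq_empty[of "V' \<inter> f -` ball y e" M] by blast
    have "f w \<in> B0" using w fM by (auto simp: B0_def)
    hence "w \<in> g ` B0" using gf[OF w(2)] by force
    have "connected (g ` B0)"
      by (intro connected_continuous_image continuous_on_subset[OF cg B0U] convex_connected)
        (simp add: B0_def convex_Int)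
    moreover have "g ` B0 \<inter> M \<noteq> {}" using \<open>w \<in> g ` B0\<close> w(1) by blast
    moreover have "g ` B0 - M \<noteq> {}" using u \<open>g u \<notin> M\<close> by blast
    ultimately obtain v where v: "v \<in> g ` B0" "v \<in> frontier M" using connected_Int_frontier by blast
    obtain b where b: "b \<in> B0" "v = g b" using v(1) by blast
    have "f v = b" using b fg(1) B0U by blast
    hence "norm b = 1" using v(2) fr by auto
    thus False using b(1) by (auto simp: B0_def)
  qed
  \<comment> \<open>The boundary value is not vacuous: the inverse branch lifts the end of the
    radius of the ball to points of \<open>M\<close> that approach \<open>\<zeta>\<close>.\<close>
  have lp: "\<zeta> islimpt f_radius f M \<zeta>"
    unfolding islimpt_approachable
  proof (intro allI impI)
    fix d :: real assume d: "d > 0"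
    have "isCont g y" using cg V'(2) y(1) by (simp add: continuous_on_eq_continuous_at)
    then obtain d1 where d1: "d1 > 0" "\<And>u. dist u y < d1 \<Longrightarrow> dist (g u) (g y) < d"
      using d unfolding continuous_at_eps_delta by blast
    define t where "t = min (min e d1) 1 / 2"
    have t: "0 < t" "t < e" "t < d1" "t < 1" using e(1) d1(1) by (auto simp: t_def)
    define u where "u = (1 - t) *\<^sub>R y"
    have du: "dist u y = t" unfolding u_def using t y(2) by (simp add: dist_norm scaleR_left_diff_distrib)
    have nu: "norm u < 1" unfolding u_def using t y(2) by simp
    have uB: "u \<in> B0" using du nu t by (simp add: B0_def dist_commute)
    have gy: "g y = \<zeta>" unfolding y_def by (rule gf[OF \<zeta>(2)])
    have fgu: "f (g u) = u" using fg(1) uB B0U by blast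
    have "g u \<in> f_radius f M \<zeta>" unfolding f_radius_def
      using inM[OF uB] fgu t by (auto simp: u_def y_def intro!: bexI[of _ "1 - t"])
    moreover have "g u \<noteq> \<zeta>" using fgu nu y(2) unfolding y_def by auto
    moreover have "dist (g u) \<zeta> < d" using d1(2)[of u] du t gy by simp
    ultimately show "\<exists>x'\<in>f_radius f M \<zeta>. x' \<noteq> \<zeta> \<and> dist x' \<zeta> < d" by blast
  qed
  \<comment> \<open>On the lifted radius \<open>f w = norm (f w) *\<^sub>R f \<zeta>\<close>, so
    \<open>F \<circ> f\<close> depends there on \<open>norm (f w)\<close> alone, which tends to 1
    from below as \<open>w\<close> tends to \<open>\<zeta>\<close>.\<close>
  have "isCont f \<zeta>" using cf V'(1) \<zeta>(2) by (simp add: continuous_on_eq_continuous_at)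
  hence "((\<lambda>w. norm (f w)) \<longlongrightarrow> norm (f \<zeta>)) (at \<zeta> within f_radius f M \<zeta>)"
    by (intro tendsto_norm) (metis isCont_def tendsto_within_subset subset_UNIV)
  moreover have ev: "\<forall>\<^sub>F w in at \<zeta> within f_radius f M \<zeta>. w \<in> f_radius f M \<zeta>"
    unfolding eventually_at_filter by simp
  have rad: "f w = norm (f w) *\<^sub>R f \<zeta>" "norm (f w) < 1" if "w \<in> f_radius f M \<zeta>" for w
    using that y(2) unfolding f_radius_def y_def by auto
  have "\<forall>\<^sub>F w in at \<zeta> within f_radius f M \<zeta>. norm (f w) \<in> {..<1} \<and> norm (f w) \<noteq> 1"
    by (rule eventually_mono[OF ev]) (use rad(2) in force)
  ultimately have "filterlim (\<lambda>w. norm (f w)) (at_left 1) (at \<zeta> within f_radius f M \<zeta>)"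
    using y(2) unfolding filterlim_at y_def by simp
  from filterlim_compose[OF lim this]
  have "((\<lambda>w. F (norm (f w) *\<^sub>R f \<zeta>)) \<longlongrightarrow> L) (at \<zeta> within f_radius f M \<zeta>)" .
  moreover have "\<forall>\<^sub>F w in at \<zeta> within f_radius f M \<zeta>. F (norm (f w) *\<^sub>R f \<zeta>) = (F \<circ> f) w"
    by (rule eventually_mono[OF ev]) (simp add: rad(1)[symmetric])
  ultimately have "((F \<circ> f) \<longlongrightarrow> L) (at \<zeta> within f_radius f M \<zeta>)"
    by (rule Lim_transform_eventually)
  thus ?thesis using lp unfolding has_boundary_value_def by blast
qed

text \<open>A continuous map on a compact set is closed: the points of \<open>Y\<close> outside a
  superlevel set of \<open>\<phi>\<close> form the image of the compact set of points outside the
  corresponding superlevel set in \<open>X\<close>.\<close>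

lemma lsc_descends:
  fixes f :: "'a::metric_space \<Rightarrow> 'b::t2_space"
  assumes X: "compact X" and f: "continuous_on X f" "f ` X = Y" and lsc: "lower_semicontinuous_on X (\<phi> \<circ> f)"
  shows "lower_semicontinuous_on Y \<phi>"
  unfolding lower_semicontinuous_on_def
proof
  fix c
  have "openin (top_of_set X) {x\<in>X. c < (\<phi> \<circ> f) x}" using lsc unfolding lower_semicontinuous_on_def by blast
  hence "closedin (top_of_set X) (X - {x\<in>X. c < (\<phi> \<circ> f) x})" by (intro closedin_diff) auto
  hence "compact (X - {x\<in>X. c < (\<phi> \<circ> f) x})" using X closedin_compact by blast
  hence "compact (f ` (X - {x\<in>X. c < (\<phi> \<circ> f) x}))"
    by (intro compact_continuous_image continuous_on_subset[OF f(1)]) auto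
  hence cl: "closed (f ` (X - {x\<in>X. c < (\<phi> \<circ> f) x}))" by (rule compact_imp_closed)
  have "{y\<in>Y. c < \<phi> y} = Y \<inter> - f ` (X - {x\<in>X. c < (\<phi> \<circ> f) x})" using f(2) by auto
  thus "openin (top_of_set Y) {y\<in>Y. c < \<phi> y}" 
    unfolding openin_open using cl by (intro exI[of _ "- f ` (X - {x\<in>X. c < (\<phi> \<circ> f) x})"] conjI open_Compl)
qed

section \<open>Sheets and measures on the boundary\<close>

locale covering_setting = sphere_measure +
  fixes f :: "C2 \<Rightarrow> C2" and M :: "C2 set" and N :: nat and \<U> :: "C2 set set" and \<sigma>M :: "C2 measure"
  assumes ram: "ramified_setting f M N \<U>"
    and ind: "induced_boundary_measure f M \<U> \<sigma> \<sigma>M"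
begin

lemma
  shows f_holo: "holo_map_on f UNIV" and M_open: "open M" and M_bounded: "bounded M"
    and f_M: "f ` M = B2" and f_frontier: "f ` frontier M = S2"
    and f_cov: "finite_ramified_covering (closure M) f (closure B2) N"
    and f_sheets: "sheet_cover f M N \<U>"
  using ram unfolding ramified_setting_def by blast+

lemma f_cont: "continuous_on X f"
  using holo_map_continuous[OF f_holo] continuous_on_subset by blast

lemma
  shows U_finite: "finite \<U>" and U_open: "U \<in> \<U> \<Longrightarrow> openin (top_of_set S2) U"
    and U_cover: "\<Union>\<U> = S2 - Z2 f M"
    and sheet_bih: "U \<in> \<U> \<Longrightarrow> V \<in> sheets f M U \<Longrightarrow> maps_biholomorphically f V U"
    and sheet_cover: "frontier M - Z1 f M \<subseteq> (\<Union>U\<in>\<U>. \<Union>(sheets f M U))"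
proof -
  note c = f_sheets[unfolded sheet_cover_def]
  show "finite \<U>" using c by (elim conjE)
  have "\<forall>U\<in>\<U>. openin (top_of_set S2) U" using c by (elim conjE)
  thus "U \<in> \<U> \<Longrightarrow> openin (top_of_set S2) U" by (rule bspec)
  show "\<Union>\<U> = S2 - Z2 f M" using c by (elim conjE)
  have "\<forall>U\<in>\<U>. card (sheets f M U) = N \<and> (\<forall>V\<in>sheets f M U. maps_biholomorphically f V U)"
    using c by (elim conjE)
  thus "U \<in> \<U> \<Longrightarrow> V \<in> sheets f M U \<Longrightarrow> maps_biholomorphically f V U"
    by simp
  show "frontier M - Z1 f M \<subseteq> (\<Union>U\<in>\<U>. \<Union>(sheets f M U))" using c by (elim conjE)
qed

lemma sets_M: "sets \<sigma>M = sets (restrict_space borel (frontier M))"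
  using ind unfolding induced_boundary_measure_def by (elim conjE)

lemma space_M [simp]: "space \<sigma>M = frontier M"
  using sets_eq_imp_space_eq[OF sets_M] by (simp add: space_restrict_space)

lemma in_sets_M: "A \<in> sets \<sigma>M \<longleftrightarrow> A \<in> sets borel \<and> A \<subseteq> frontier M"
  unfolding sets_M by (subst sets_restrict_space_iff) auto

lemma emeasure_Z1: "emeasure \<sigma>M (Z1 f M) = 0"
  using ind unfolding induced_boundary_measure_def by (elim conjE)

lemma emeasure_sheet:
  "U \<in> \<U> \<Longrightarrow> V \<in> sheets f M U \<Longrightarrow> A \<in> sets \<sigma>M \<Longrightarrow> A \<subseteq> V \<Longrightarrow> emeasure \<sigma>M A = emeasure \<sigma> (f ` A)"
  using ind[unfolded induced_boundary_measure_def, THEN conjunct2, THEN conjunct2] by simp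

lemma U_borel: "U \<in> \<U> \<Longrightarrow> U \<in> sets \<sigma>"
proof -
  assume "U \<in> \<U>"
  from U_open[OF this] obtain T where "open T" "U = S2 \<inter> T" unfolding openin_open by blast
  thus ?thesis unfolding in_sets_sigma by auto
qed

lemma f_vimage_borel: "A \<in> sets borel \<Longrightarrow> f -` A \<in> sets borel"
  using measurable_sets[OF borel_measurable_continuous_onI[OF f_cont], of A] by simp

lemma sheet_image: "U \<in> \<U> \<Longrightarrow> V \<in> sheets f M U \<Longrightarrow> f ` V = U"
  using sheet_bih unfolding maps_biholomorphically_def by blast

lemma sheet_sub: "V \<in> sheets f M U \<Longrightarrow> V \<subseteq> closure M \<inter> f -` U"
  unfolding sheets_def by (rule in_components_subset)

lemma sheet_sets:
  assumes U: "U \<in> \<U>" and V: "V \<in> sheets f M U"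
  shows "V \<in> sets \<sigma>M"
proof -
  have "U \<subseteq> S2" using U_borel[OF U] unfolding in_sets_sigma by blast
  have "V \<subseteq> frontier M"
  proof
    fix w assume w: "w \<in> V"
    have "w \<in> closure M" "f w \<in> S2" using sheet_sub[OF V] w \<open>U \<subseteq> S2\<close> by blast+
    moreover have "w \<notin> M"
    proof
      assume "w \<in> M"
      hence "f w \<in> B2" using f_M by blast
      thus False using \<open>f w \<in> S2\<close> by simp
    qed
    ultimately show "w \<in> frontier M" using M_open by (simp add: frontier_def interior_open)
  qed
  moreover have "closedin (top_of_set (closure M \<inter> f -` U)) V"
    using V unfolding sheets_def by (rule closedin_component)
  then obtain C where "closed C" "V = (closure M \<inter> f -` U) \<inter> C" unfolding closedin_closed by blast
  hence "V \<in> sets borel"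
    using f_vimage_borel[of U] U_borel[OF U] unfolding in_sets_sigma by auto
  ultimately show ?thesis unfolding in_sets_M by blast
qed

text \<open>The argument goes through the fibres, because \<open>card\<close> is 0 for infinite sets
  too and the count of sheets alone would not exclude them when N = 0. Every sheet meets the finite
  fibre above a fixed point of \<open>U\<close>, and distinct components are disjoint.\<close>

lemma sheets_finite:
  assumes U: "U \<in> \<U>"
  shows "finite (sheets f M U)"
proof (cases "U = {}")
  case True thus ?thesis by (simp add: sheets_def)
next
  case False
  then obtain u where u: "u \<in> U" by blast
  have "U \<subseteq> S2" using U_borel[OF U] unfolding in_sets_sigma by blast
  hence "u \<in> closure B2" using u by auto
  hence fin: "finite {x\<in>closure M. f x = u}" using f_cov unfolding finite_ramified_covering_def by blast
  have "\<exists>x\<in>V. f x = u" if "V \<in> sheets f M U" for V using sheet_image[OF U that] u by blast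
  then obtain x where x: "\<And>V. V \<in> sheets f M U \<Longrightarrow> x V \<in> V \<and> f (x V) = u" by metis
  have "inj_on x (sheets f M U)"
  proof (rule inj_onI)
    fix V V' assume V: "V \<in> sheets f M U" "V' \<in> sheets f M U" and "x V = x V'"
    hence "V \<inter> V' \<noteq> {}" using x[OF V(1)] x[OF V(2)] by auto
    thus "V = V'" using V components_eq unfolding sheets_def by blast
  qed
  moreover have "x ` sheets f M U \<subseteq> {x\<in>closure M. f x = u}" using x sheet_sub by blast
  ultimately show ?thesis using fin inj_on_finite by blast
qed

lemma f_image_sheet_vimage:
  assumes "U \<in> \<U>" "V \<in> sheets f M U"
  shows "f ` (V \<inter> f -` A) = U \<inter> A"
  using sheet_image[OF assms] by blast

lemma sheet_vimage_sets:
  assumes "U \<in> \<U>" "V \<in> sheets f M U" "A \<in> sets \<sigma>"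
  shows "V \<inter> f -` A \<in> sets \<sigma>M"
  using sheet_sets[OF assms(1,2)] f_vimage_borel assms(3) unfolding in_sets_M in_sets_sigma by blast

text \<open>Outside \<open>Z1\<close> the boundary is covered by finitely many sheets, and on each
  of them \<open>\<sigma>M\<close> is the \<open>\<sigma>\<close>-measure of the image; so null sets
  of the sphere have null preimages.\<close>

lemma AE_pullback:
  assumes A: "A \<in> sets \<sigma>" "emeasure \<sigma> A = 0"
  shows "AE \<zeta> in \<sigma>M. \<zeta> \<notin> Z1 f M \<and> f \<zeta> \<notin> A"
proof -
  define B where "B = Z1 f M \<union> (\<Union>U\<in>\<U>. \<Union>V\<in>sheets f M U. V \<inter> f -` A)"
  have Z1s: "Z1 f M \<in> sets \<sigma>M"
  proof -
    have "closed {w. f w $ 1 = 0}" "closed {w. f w $ 2 = 0}"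
      by (intro closed_Collect_eq continuous_intros f_cont)+
    hence "closed (closure M \<inter> ({w. f w $ 1 = 0} \<union> {w. f w $ 2 = 0}) \<inter> frontier M)"
      by (intro closed_Int closed_Un closed_closure frontier_closed)
    moreover have "closure M \<inter> ({w. f w $ 1 = 0} \<union> {w. f w $ 2 = 0}) \<inter> frontier M = Z1 f M"
      unfolding Z1_def Z_set_def by blast
    ultimately show ?thesis unfolding in_sets_M by (auto simp: Z1_def)
  qed
  have null: "V \<inter> f -` A \<in> null_sets \<sigma>M" if "U \<in> \<U>" "V \<in> sheets f M U" for U V
  proof (rule null_setsI)
    have "emeasure \<sigma>M (V \<inter> f -` A) = emeasure \<sigma> (U \<inter> A)"
      using emeasure_sheet[OF that sheet_vimage_sets[OF that A(1)]] f_image_sheet_vimage[OF that] by simp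
    also have "\<dots> \<le> emeasure \<sigma> A" by (rule emeasure_mono) (use A in auto)
    finally show "emeasure \<sigma>M (V \<inter> f -` A) = 0" using A(2) by simp
  qed (rule sheet_vimage_sets[OF that A(1)])
  have "B \<in> null_sets \<sigma>M" unfolding B_def
    by (intro null_sets.Un null_sets.finite_UN U_finite sheets_finite null) (auto intro: null_setsI emeasure_Z1 Z1s)
  moreover have "{\<zeta> \<in> space \<sigma>M. \<not> (\<zeta> \<notin> Z1 f M \<and> f \<zeta> \<notin> A)} \<subseteq> B"
    using sheet_cover unfolding B_def by auto
  ultimately show ?thesis by (rule AE_I')
qed

text \<open>A point of \<open>Z2\<close> has a vanishing coordinate and thus lies on one of two null
  circles; \<open>Z2\<close> is measurable as the complement of a finite relatively open
  cover.\<close>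

lemma Z2_null: "Z2 f M \<in> null_sets \<sigma>"
proof -
  have n: "{z \<in> S2. z $ 1 = 0} \<in> null_sets \<sigma>" "{z \<in> S2. z $ 2 = 0} \<in> null_sets \<sigma>"
  proof -
    have "closed {z::C2. z $ i = 0}" for i by (intro closed_Collect_eq continuous_intros)
    hence "S2 \<inter> {z. z $ i = 0} \<in> sets \<sigma>" for i unfolding in_sets_sigma by auto
    moreover have "{z \<in> S2. z $ i = 0} = S2 \<inter> {z. z $ i = 0}" for i by blast
    ultimately have "{z \<in> S2. z $ i = 0} \<in> sets \<sigma>" for i by simp
    thus "{z \<in> S2. z $ 1 = 0} \<in> null_sets \<sigma>" "{z \<in> S2. z $ 2 = 0} \<in> null_sets \<sigma>"
      using emeasure_coordinate_circle by (auto intro: null_setsI)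
  qed
  have "S2 - \<Union>\<U> \<in> sets \<sigma>" using U_borel U_finite by (metis sets.Diff sets.finite_Union sets.top space_sigma subsetI)
  moreover have "S2 - \<Union>\<U> = Z2 f M" unfolding U_cover Z2_def by blast
  moreover have "Z2 f M \<subseteq> {z \<in> S2. z $ 1 = 0} \<union> {z \<in> S2. z $ 2 = 0}"
    unfolding Z2_def Z_set_def by auto
  ultimately show ?thesis using null_sets_subset[OF null_sets.Un[OF n]] by simp
qed

text \<open>The sheet condition equates measures of sets. Read as the statement that
  \<open>f\<close> pushes \<open>\<sigma>M\<close> restricted to \<open>V\<close> forward to
  \<open>\<sigma>\<close> restricted to \<open>U\<close>, it extends to integrals.\<close>

lemma nn_integral_sheet:
  assumes U: "U \<in> \<U>" and V: "V \<in> sheets f M U" and h: "h \<in> borel_measurable \<sigma>"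
  shows "(\<integral>\<^sup>+z. indicator U z * h z \<partial>\<sigma>) = (\<integral>\<^sup>+\<zeta>. indicator V \<zeta> * h (f \<zeta>) \<partial>\<sigma>M)"
proof -
  have fm: "f \<in> measurable \<sigma>M \<sigma>"
  proof (rule measurableI)
    show "f x \<in> space \<sigma>" if "x \<in> space \<sigma>M" for x using that f_frontier by auto
    show "f -` A \<inter> space \<sigma>M \<in> sets \<sigma>M" if "A \<in> sets \<sigma>" for A
      using that f_vimage_borel[of A] unfolding in_sets_M in_sets_sigma by auto
  qed
  have Vm: "V \<in> sets \<sigma>M" by (rule sheet_sets[OF U V])
  have Um: "U \<in> sets \<sigma>" by (rule U_borel[OF U])
  have eq: "distr (density \<sigma>M (indicator V)) \<sigma> f = density \<sigma> (indicator U)"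
  proof (rule measure_eqI)
    fix A assume "A \<in> sets (distr (density \<sigma>M (indicator V)) \<sigma> f)"
    hence A: "A \<in> sets \<sigma>" by simp
    have pre: "f -` A \<inter> space \<sigma>M \<in> sets \<sigma>M" using fm A by (rule measurable_sets)
    have "emeasure (distr (density \<sigma>M (indicator V)) \<sigma> f) A = emeasure (density \<sigma>M (indicator V)) (f -` A \<inter> space \<sigma>M)"
      using fm A by (subst emeasure_distr) auto
    also have "\<dots> = (\<integral>\<^sup>+\<zeta>. indicator V \<zeta> * indicator (f -` A \<inter> space \<sigma>M) \<zeta> \<partial>\<sigma>M)"
      using Vm pre by (intro emeasure_density) auto
    also have "\<dots> = (\<integral>\<^sup>+\<zeta>. indicator (V \<inter> f -` A) \<zeta> \<partial>\<sigma>M)"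
      by (rule nn_integral_cong) (auto simp: indicator_def)
    also have "\<dots> = emeasure \<sigma>M (V \<inter> f -` A)" using sheet_vimage_sets[OF U V A] by simp
    also have "\<dots> = emeasure \<sigma> (U \<inter> A)"
      using emeasure_sheet[OF U V sheet_vimage_sets[OF U V A]] f_image_sheet_vimage[OF U V] by simp
    also have "\<dots> = (\<integral>\<^sup>+z. indicator (U \<inter> A) z \<partial>\<sigma>)" using Um A by simp
    also have "\<dots> = (\<integral>\<^sup>+z. indicator U z * indicator A z \<partial>\<sigma>)"
      by (rule nn_integral_cong) (auto simp: indicator_def)
    also have "\<dots> = emeasure (density \<sigma> (indicator U)) A" using Um A by (intro emeasure_density[symmetric]) auto
    finally show "emeasure (distr (density \<sigma>M (indicator V)) \<sigma> f) A = emeasure (density \<sigma> (indicator U)) A" .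
  qed simp
  have "(\<integral>\<^sup>+z. indicator U z * h z \<partial>\<sigma>) = (\<integral>\<^sup>+z. h z \<partial>density \<sigma> (indicator U))"
    using Um h by (intro nn_integral_density[symmetric]) auto
  also have "\<dots> = (\<integral>\<^sup>+\<zeta>. h (f \<zeta>) \<partial>density \<sigma>M (indicator V))"
    unfolding eq[symmetric] using fm h by (intro nn_integral_distr) auto
  also have "\<dots> = (\<integral>\<^sup>+\<zeta>. indicator V \<zeta> * h (f \<zeta>) \<partial>\<sigma>M)"
    using Vm measurable_compose[OF fm h] by (intro nn_integral_density) auto
  finally show ?thesis .
qed

text \<open>Integrability of \<open>\<phi>\<^sup>2\<close> is given on the boundary of
  \<open>M\<close> but needed on the sphere. Each nonempty \<open>U\<close> has at least one sheet,
  over which the integral is the same, and finitely many \<open>U\<close> cover the sphere up to the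
  null set \<open>Z2\<close>.\<close>

lemma nn_integral_finite_descends:
  assumes h: "h \<in> borel_measurable \<sigma>" and fin: "(\<integral>\<^sup>+\<zeta>. h (f \<zeta>) \<partial>\<sigma>M) < \<infinity>"
  shows "(\<integral>\<^sup>+z. h z \<partial>\<sigma>) < \<infinity>"
proof -
  have "AE z in \<sigma>. h z \<le> (\<Sum>U\<in>\<U>. indicator U z * h z)"
  proof (rule AE_mp[OF AE_not_in[OF Z2_null]], rule AE_I2, rule impI)
    fix z assume "z \<in> space \<sigma>" "z \<notin> Z2 f M"
    hence "z \<in> \<Union>\<U>" unfolding U_cover by simp
    then obtain U where U: "U \<in> \<U>" "z \<in> U" by blast
    have "h z = indicator U z * h z" using U(2) by simp
    also have "\<dots> \<le> (\<Sum>U\<in>\<U>. indicator U z * h z)" by (rule member_le_sum[OF U(1)]) (auto simp: U_finite)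
    finally show "h z \<le> (\<Sum>U\<in>\<U>. indicator U z * h z)" .
  qed
  hence "(\<integral>\<^sup>+z. h z \<partial>\<sigma>) \<le> (\<integral>\<^sup>+z. (\<Sum>U\<in>\<U>. indicator U z * h z) \<partial>\<sigma>)" by (rule nn_integral_mono_AE)
  also have "\<dots> = (\<Sum>U\<in>\<U>. \<integral>\<^sup>+z. indicator U z * h z \<partial>\<sigma>)"
    using h U_borel by (intro nn_integral_sum) auto
  also have "\<dots> < \<infinity>"
  proof -
    have "(\<integral>\<^sup>+z. indicator U z * h z \<partial>\<sigma>) < \<infinity>" if U: "U \<in> \<U>" for U
    proof (cases "U = {}")
      case False
      have "U \<subseteq> S2" using U_borel[OF U] unfolding in_sets_sigma by blast
      moreover from False obtain u where u: "u \<in> U" by blast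
      ultimately have "u \<in> f ` frontier M" unfolding f_frontier by blast
      with u obtain w where "w \<in> frontier M" "f w \<in> U" by blast
      hence "closure M \<inter> f -` U \<noteq> {}" by (auto simp: frontier_def)
      hence "sheets f M U \<noteq> {}" unfolding sheets_def by (simp add: components_eq_empty)
      then obtain V where V: "V \<in> sheets f M U" by blast
      have "(\<integral>\<^sup>+z. indicator U z * h z \<partial>\<sigma>) = (\<integral>\<^sup>+\<zeta>. indicator V \<zeta> * h (f \<zeta>) \<partial>\<sigma>M)"
        by (rule nn_integral_sheet[OF U V h])
      also have "\<dots> \<le> (\<integral>\<^sup>+\<zeta>. h (f \<zeta>) \<partial>\<sigma>M)" by (rule nn_integral_mono) (auto simp: indicator_def)
      also note fin
      finally show ?thesis .
    qed simp
    thus ?thesis using U_finite by simp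
  qed
  finally show ?thesis .
qed

lemma exists_Ef_function:
  fixes \<phi> :: "C2 \<Rightarrow> real"
  assumes pos: "\<And>z. z \<in> S2 \<Longrightarrow> \<phi> z > 0"
    and lsc: "lower_semicontinuous_on (frontier M) (\<phi> \<circ> f)"
    and int: "integrable \<sigma>M (\<lambda>\<zeta>. ((\<phi> \<circ> f) \<zeta>)\<^sup>2)"
    and LI: "LI_set E"
  shows "\<exists>F. Ef_function E f M F \<and> F \<in> Hardy2 f M \<sigma> \<and> \<not> F constant_on M \<and>
           (AE \<zeta> in \<sigma>M. \<exists>L. has_boundary_value f M F \<zeta> L \<and> cmod L = \<phi> (f \<zeta>))"
proof -
  have cfr: "compact (frontier M)" using M_bounded by (simp add: compact_frontier_bounded)
  have lsc': "lower_semicontinuous_on S2 \<phi>" by (rule lsc_descends[OF cfr f_cont f_frontier lsc])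
  have \<phi>m: "\<phi> \<in> borel_measurable \<sigma>" by (rule borel_measurable_lsc[OF lsc' pos])
  have int': "integrable \<sigma> (\<lambda>z. (\<phi> z)\<^sup>2)"
  proof (rule integrableI_nonneg)
    have "(\<integral>\<^sup>+\<zeta>. ennreal ((\<phi> (f \<zeta>))\<^sup>2) \<partial>\<sigma>M) < \<infinity>"
      using int by (simp add: nn_integral_eq_integral)
    thus "(\<integral>\<^sup>+z. ennreal ((\<phi> z)\<^sup>2) \<partial>\<sigma>) < \<infinity>"
      using \<phi>m by (intro nn_integral_finite_descends) auto
  qed (use \<phi>m in auto)
  obtain G F where hom: "\<And>k. homogeneous_poly k (G k)" and GE: "\<And>k. k \<notin> E \<Longrightarrow> G k = (\<lambda>z. 0)" and
    holo: "holo_on F B2" and nc: "\<not> F constant_on B2" and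
    ul: "\<And>K. compact K \<Longrightarrow> K \<subseteq> B2 \<Longrightarrow> uniform_limit K (\<lambda>n z. \<Sum>k<n. G k z) F sequentially" and
    h2: "\<And>r. 0 < r \<Longrightarrow> r < 1 \<Longrightarrow> (\<integral>\<^sup>+z. ennreal ((cmod (F (r *\<^sub>R z)))\<^sup>2) \<partial>\<sigma>) \<le> ennreal (\<integral>z. (\<phi> z)\<^sup>2 \<partial>\<sigma>)" and
    rad: "AE z in \<sigma>. \<exists>L. ((\<lambda>r. F (r *\<^sub>R z)) \<longlongrightarrow> L) (at_left 1) \<and> cmod L = \<phi> z"
    by (rule exists_E_function_ball[OF lsc' pos int' LI]) (assumption, rule that, assumption+)
  have "Ef_function E f M (F \<circ> f)" unfolding Ef_function_def
  proof (intro exI[of _ "\<lambda>k. G k \<circ> f"] conjI ballI allI impI)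
    show "f_homogeneous_poly f k (G k \<circ> f)" for k
      unfolding f_homogeneous_poly_def using hom by blast
    fix K assume K: "compact K \<and> K \<subseteq> M"
    have "compact (f ` K)" using K by (intro compact_continuous_image f_cont) simp
    moreover have "f ` K \<subseteq> B2" using K f_M by blast
    ultimately have "uniform_limit (f ` K) (\<lambda>n z. \<Sum>k<n. G k z) F sequentially" by (rule ul)
    hence "uniform_limit K (\<lambda>n w. \<Sum>k<n. G k (f w)) (\<lambda>w. F (f w)) sequentially"
      by (rule uniform_limit_compose') auto
    moreover have "(\<Sum>k<n. G k z) = (\<Sum>k\<in>E \<inter> {..<n}. G k z)" for n z
    proof (rule sum.mono_neutral_right)
      have "G k z = 0" if "k \<notin> E" for k using GE[OF that] by simp
      thus "\<forall>k\<in>{..<n} - E \<inter> {..<n}. G k z = 0" by blast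
    qed auto
    ultimately show "uniform_limit K (\<lambda>n w. \<Sum>k\<in>E \<inter> {..<n}. (G k \<circ> f) w) (F \<circ> f) sequentially"
      by (simp add: comp_def)
  qed
  moreover have "F \<circ> f \<in> Hardy2 f M \<sigma>" unfolding Hardy2_def
  proof (rule CollectI, rule conjI)
    show "holo_on (F \<circ> f) M"
    proof (rule holo_on_compose[OF _ holo])
      show "holo_map_on f M" using f_holo unfolding holo_map_on_def holo_on_def by blast
    qed (use f_M in blast)
    have cF: "continuous_on S2 (\<lambda>z. F (r *\<^sub>R z))" if "0 < r" "r < 1" for r
      by (rule continuous_on_compose2[OF holo_on_continuous[OF holo]]) (use that in \<open>auto intro!: continuous_intros\<close>)
    have "(\<integral>\<^sup>+ z. (\<Sum>w\<in>{w\<in>M. f w = r *\<^sub>R z}. ennreal ((cmod ((F \<circ> f) w))\<^sup>2)) \<partial>\<sigma>)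
        \<le> ennreal (real N) * ennreal (\<integral>z. (\<phi> z)\<^sup>2 \<partial>\<sigma>)" if "r \<in> {0<..<1}" for r
    proof -
      have r: "0 < r" "r < 1" using that by auto
      have "(\<integral>\<^sup>+ z. (\<Sum>w\<in>{w\<in>M. f w = r *\<^sub>R z}. ennreal ((cmod ((F \<circ> f) w))\<^sup>2)) \<partial>\<sigma>)
          \<le> (\<integral>\<^sup>+ z. ennreal (real N) * ennreal ((cmod (F (r *\<^sub>R z)))\<^sup>2) \<partial>\<sigma>)"
      proof (rule nn_integral_mono)
        fix z assume "z \<in> space \<sigma>"
        hence "r *\<^sub>R z \<in> B2" using r by simp
        hence "r *\<^sub>R z \<in> closure B2" using closure_subset by blast
        from fibre_card_le(2)[OF f_holo M_open f_cov this]
        have "of_nat (card {w\<in>M. f w = r *\<^sub>R z}) \<le> (of_nat N :: ennreal)" by simp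
        moreover have "(\<Sum>w\<in>{w\<in>M. f w = r *\<^sub>R z}. ennreal ((cmod ((F \<circ> f) w))\<^sup>2))
            = (\<Sum>w\<in>{w\<in>M. f w = r *\<^sub>R z}. ennreal ((cmod (F (r *\<^sub>R z)))\<^sup>2))"
          by (rule sum.cong) auto
        ultimately show "(\<Sum>w\<in>{w\<in>M. f w = r *\<^sub>R z}. ennreal ((cmod ((F \<circ> f) w))\<^sup>2))
            \<le> ennreal (real N) * ennreal ((cmod (F (r *\<^sub>R z)))\<^sup>2)"
          by (simp add: ennreal_of_nat_eq_real_of_nat mult_right_mono)
      qed
      also have "\<dots> = ennreal (real N) * (\<integral>\<^sup>+ z. ennreal ((cmod (F (r *\<^sub>R z)))\<^sup>2) \<partial>\<sigma>)"
      proof (rule nn_integral_cmult)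
        define u where "u = (\<lambda>z. F (r *\<^sub>R z))"
        have "u \<in> borel_measurable \<sigma>" unfolding u_def by (rule borel_measurable_cont[OF cF[OF r]])
        hence "(\<lambda>z. ennreal ((cmod (u z))\<^sup>2)) \<in> borel_measurable \<sigma>" by measurable
        thus "(\<lambda>z. ennreal ((cmod (F (r *\<^sub>R z)))\<^sup>2)) \<in> borel_measurable \<sigma>" by (simp add: u_def)
      qed
      also have "\<dots> \<le> ennreal (real N) * ennreal (\<integral>z. (\<phi> z)\<^sup>2 \<partial>\<sigma>)" by (intro mult_left_mono h2 r) simp
      finally show ?thesis .
    qed
    hence "(SUP r\<in>{0<..<1::real}. \<integral>\<^sup>+ z. (\<Sum>w\<in>{w\<in>M. f w = r *\<^sub>R z}. ennreal ((cmod ((F \<circ> f) w))\<^sup>2)) \<partial>\<sigma>)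
        \<le> ennreal (real N) * ennreal (\<integral>z. (\<phi> z)\<^sup>2 \<partial>\<sigma>)" by (rule SUP_least)
    also have "\<dots> < \<infinity>" by (simp add: ennreal_mult_less_top)
    finally show "(SUP r\<in>{0<..<1::real}. \<integral>\<^sup>+ z. (\<Sum>w\<in>{w\<in>M. f w = r *\<^sub>R z}. ennreal ((cmod ((F \<circ> f) w))\<^sup>2)) \<partial>\<sigma>) < \<infinity>" .
  qed
  moreover have "\<not> (F \<circ> f) constant_on M"
  proof
    assume "(F \<circ> f) constant_on M"
    then obtain c where "\<And>w. w \<in> M \<Longrightarrow> F (f w) = c" unfolding constant_on_def by auto
    hence "F constant_on f ` M" unfolding constant_on_def by auto
    thus False using nc unfolding f_M by blast
  qed
  moreover have "AE \<zeta> in \<sigma>M. \<exists>L. has_boundary_value f M (F \<circ> f) \<zeta> L \<and> cmod L = \<phi> (f \<zeta>)"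
  proof -
    \<comment> \<open>The exceptional set is enlarged to a measurable null set, since only such a
      set can be pulled back along \<open>f\<close>.\<close>
    obtain A where A: "{z \<in> space \<sigma>. \<not> (\<exists>L. ((\<lambda>r. F (r *\<^sub>R z)) \<longlongrightarrow> L) (at_left 1) \<and> cmod L = \<phi> z)} \<subseteq> A"
      "emeasure \<sigma> A = 0" "A \<in> sets \<sigma>" using rad by (rule AE_E)
    from AE_pullback[OF A(3,2)] show ?thesis
    proof (rule AE_mp, intro AE_I2 impI, elim conjE)
      fix \<zeta> assume \<zeta>: "\<zeta> \<in> space \<sigma>M" "\<zeta> \<notin> Z1 f M" "f \<zeta> \<notin> A"
      hence "\<zeta> \<in> frontier M" by simp
      hence "f \<zeta> \<in> space \<sigma>" using f_frontier by auto
      then obtain L where L: "((\<lambda>r. F (r *\<^sub>R f \<zeta>)) \<longlongrightarrow> L) (at_left 1)" "cmod L = \<phi> (f \<zeta>)"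
        using A(1) \<zeta>(3) by blast
      obtain U V where UV: "U \<in> \<U>" "V \<in> sheets f M U" "\<zeta> \<in> V"
        using sheet_cover \<open>\<zeta> \<in> frontier M\<close> \<zeta>(2) by blast
      obtain V' U' where "V \<subseteq> V'" "biholomorphism V' U' f"
        using sheet_bih[OF UV(1,2)] unfolding maps_biholomorphically_def by blast
      hence "has_boundary_value f M (F \<circ> f) \<zeta> L"
        using UV(3) by (intro sheet_boundary_value[OF f_M f_frontier \<open>\<zeta> \<in> frontier M\<close> _ _ L(1)]) auto
      thus "\<exists>L. has_boundary_value f M (F \<circ> f) \<zeta> L \<and> cmod L = \<phi> (f \<zeta>)" using L(2) by blast
    qed
  qed
  ultimately show ?thesis by blast
qed

end

theorem theorem5p3:
  fixes f :: "C2 \<Rightarrow> C2" and M :: "C2 set" and N :: nat and \<U> :: "C2 set set"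
    and \<sigma> \<sigma>M :: "C2 measure" and \<phi> :: "C2 \<Rightarrow> real" and E :: "nat set"
  assumes "ramified_setting f M N \<U>"
    and "rotation_invariant_probability \<sigma>"
    and "induced_boundary_measure f M \<U> \<sigma> \<sigma>M"
    and "\<And>z. z \<in> S2 \<Longrightarrow> \<phi> z > 0"
    and "lower_semicontinuous_on (frontier M) (\<phi> \<circ> f)"
    and "integrable \<sigma>M (\<lambda>\<zeta>. ((\<phi> \<circ> f) \<zeta>)\<^sup>2)"
    and "LI_set E"
  shows "\<exists>F. Ef_function E f M F \<and> F \<in> Hardy2 f M \<sigma> \<and> \<not> F constant_on M \<and>
           (AE \<zeta> in \<sigma>M. \<exists>L. has_boundary_value f M F \<zeta> L \<and> cmod L = \<phi> (f \<zeta>))"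
proof -
  interpret covering_setting \<sigma> f M N \<U> \<sigma>M
    by unfold_locales (use assms in auto)
  show ?thesis by (rule exists_Ef_function[OF assms(4-7)])
qed

end
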